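(* (In $\mathbf{ZF}$.) For every non-empty $\mathbb{N}$-compact space $\mathbf{X}$ whose Banaschewski compactification exists, $\mathbf{CMC}$ implies that $\mathbf{X}$ is strongly zero-dimensional if and only if there exists a Tychonoff space $\mathbf{Y}$ such that the rings $U_{\aleph_0}(\mathbf{X})$ and $C(\mathbf{Y})$ are isomorphic.
   Context: The base theory is $\mathbf{ZF}$ (the Axiom of Choice is not assumed). $\mathbf{CMC}$ is the statement: for every family $\{A_n:n\in\omega\}$ of non-empty sets there is a function assigning to each $n\in\omega$ a non-empty finite subset of $A_n$. A space is $\mathbb{N}$-compact if for some non-empty set $J$ it is homeomorphic with a closed subspace of $\mathbb{N}^J$, where $\mathbb{N}$ carries the discrete topology (such a space is a zero-dimensional $T_1$-space, i.e. its clopen sets form a base). A space is compact if every open cover has a finite subcover. A compactification of $\mathbf{X}$ is a pair $\langle\alpha\mathbf{X},\alpha\rangle$ with $\alpha\mathbf{X}$ compact and $\alpha:\mathbf{X}\to\alpha\mathbf{X}$ a homeomorphic embedding with dense image. A Banaschewski compactification of a zero-dimensional $T_1$-space $\mathbf{X}$ is a zero-dimensional $T_1$-compactification $\beta_0\mathbf{X}$ such that for every compact zero-dimensional $T_1$-space $\mathbf{K}$ and every continuous $f:\mathbf{X}\to\mathbf{K}$ there is a continuous $\tilde f:\beta_0\mathbf{X}\to\mathbf{K}$ with $\tilde f\circ\beta_0=f$. $C(\mathbf{X})$ is the ring of continuous real functions on $\mathbf{X}$; a zero-set is a set $f^{-1}[\{0\}]$ with $f\in C(\mathbf{X})$. $\mathbf{X}$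 is completely regular if the complements of zero-sets form a base, and Tychonoff if moreover it is $T_1$. $\mathbf{X}$ is strongly zero-dimensional if it is completely regular and for every pair $Z_1,Z_2$ of disjoint zero-sets there is a clopen set $U$ with $Z_1\subseteq U\subseteq X\setminus Z_2$. For $A\subseteq X$, $\mathrm{osc}_A(f)=\sup\{|f(x)-f(y)|:x,y\in A\}$ if $A\neq\emptyset$ and $\mathrm{osc}_\emptyset(f)=0$. $U_{\aleph_0}(\mathbf{X})$ is the subring of all $f\in C(\mathbf{X})$ such that for every real $\varepsilon>0$ there is a countable (equipotent to a subset of $\omega$) family $\mathcal{A}$ of clopen subsets of $\mathbf{X}$ with $\bigcup\mathcal{A}=X$ and $\mathrm{osc}_A(f)\leq\varepsilon$ for every $A\in\mathcal{A}$. *)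

theory Defs
  imports "HOL-Algebra.QuotRing"
begin

text \<open>
  HOL proves the Axiom of Choice, so a statement about HOL sets and HOL types could not express
  that it holds in ZF alone, and countable multiple choice would be a theorem instead of a
  hypothesis.  Everything is therefore interpreted in an arbitrary model of first-order ZF: a type
  \<^typ>\<open>'v\<close> of \<^emph>\<open>sets\<close> with a binary membership relation satisfying the ZF axioms, where Separation
  and Replacement are schemas over (deeply embedded) first-order formulas with parameters.  By
  soundness and completeness, a first-order sentence holds in all these models iff ZF proves it.

  All notions below are first-order over the membership relation: quantifiers range over elements
  of the model, never over HOL sets or functions (HOL sets are used only as notation for
  definable classes).
\<close>

datatype set_formula =
    Mem nat nat
  | Eq nat nat
  | Neg set_formula
  | Conj set_formula set_formula
  | Forall set_formula

record 'v tspace =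
  points :: 'v
  opens :: 'v

record 'v real_structure =
  rcarrier :: 'v
  rplus :: 'v
  rtimes :: 'v
  rzero :: 'v
  rone :: 'v
  rle :: 'v

locale universe =
  fixes mem :: "'v \<Rightarrow> 'v \<Rightarrow> bool"
begin

text \<open>Variables are de Bruijn indices: \<^term>\<open>Forall\<close> binds index 0.\<close>

primrec sat :: "(nat \<Rightarrow> 'v) \<Rightarrow> set_formula \<Rightarrow> bool" where
  "sat e (Mem i j) \<longleftrightarrow> mem (e i) (e j)"
| "sat e (Eq i j) \<longleftrightarrow> e i = e j"
| "sat e (Neg p) \<longleftrightarrow> \<not> sat e p"
| "sat e (Conj p q) \<longleftrightarrow> sat e p \<and> sat e q"
| "sat e (Forall p) \<longleftrightarrow> (\<forall>x. sat (case_nat x e) p)"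

definition elts :: "'v \<Rightarrow> 'v set" where
  "elts a = {x. mem x a}"

text \<open>The element of the model with a given extension.  It is applied only to definable classes
  that ZF proves to be sets.\<close>

definition vset :: "'v set \<Rightarrow> 'v" where
  "vset S = (THE a. elts a = S)"

end

locale ZF_universe = universe mem for mem :: "'v \<Rightarrow> 'v \<Rightarrow> bool" +
  assumes extensionality: "elts a = elts b \<Longrightarrow> a = b"
    and foundation: "elts a \<noteq> {} \<Longrightarrow> \<exists>x\<in>elts a. elts x \<inter> elts a = {}"
    and pairing: "\<exists>c. elts c = {a, b}"
    and union: "\<exists>c. elts c = (\<Union>x\<in>elts a. elts x)"
    and power_set: "\<exists>c. elts c = {x. elts x \<subseteq> elts a}"
    and infinity: "\<exists>w. (\<exists>z\<in>elts w. elts z = {}) \<and>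
                       (\<forall>n\<in>elts w. \<exists>s\<in>elts w. elts s = insert n (elts n))"
    and separation: "\<exists>c. elts c = {x \<in> elts a. sat (case_nat x e) p}"
    and replacement:
      "(\<And>x y y'. x \<in> elts a \<Longrightarrow> sat (case_nat x (case_nat y e)) p \<Longrightarrow>
          sat (case_nat x (case_nat y' e)) p \<Longrightarrow> y = y') \<Longrightarrow>
       \<exists>c. elts c = {y. \<exists>x\<in>elts a. sat (case_nat x (case_nat y e)) p}"

context universe
begin

section \<open>Sets and functions\<close>

definition opair :: "'v \<Rightarrow> 'v \<Rightarrow> 'v" where
  "opair a b = vset {vset {a}, vset {a, b}}"

definition cartesian :: "'v \<Rightarrow> 'v \<Rightarrow> 'v" where
  "cartesian A B = vset {p. \<exists>a\<in>elts A. \<exists>b\<in>elts B. p = opair a b}"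

definition is_function :: "'v \<Rightarrow> 'v \<Rightarrow> 'v \<Rightarrow> bool" where
  "is_function f A B \<longleftrightarrow>
     elts f \<subseteq> elts (cartesian A B) \<and> (\<forall>x\<in>elts A. \<exists>!y. opair x y \<in> elts f)"

definition app :: "'v \<Rightarrow> 'v \<Rightarrow> 'v" where
  "app f x = (THE y. opair x y \<in> elts f)"

definition lam :: "'v \<Rightarrow> ('v \<Rightarrow> 'v) \<Rightarrow> 'v" where
  "lam A F = vset {p. \<exists>x\<in>elts A. p = opair x (F x)}"

definition is_bijection :: "'v \<Rightarrow> 'v \<Rightarrow> 'v \<Rightarrow> bool" where
  "is_bijection f A B \<longleftrightarrow> is_function f A B \<and> bij_betw (app f) (elts A) (elts B)"

definition equipotent :: "'v \<Rightarrow> 'v \<Rightarrow> bool" where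
  "equipotent A B \<longleftrightarrow> (\<exists>f. is_bijection f A B)"

definition is_inductive :: "'v \<Rightarrow> bool" where
  "is_inductive I \<longleftrightarrow>
     vset {} \<in> elts I \<and> (\<forall>n\<in>elts I. vset (insert n (elts n)) \<in> elts I)"

definition omega :: 'v where
  "omega = vset {n. \<forall>I. is_inductive I \<longrightarrow> n \<in> elts I}"

definition finite_set :: "'v \<Rightarrow> bool" where
  "finite_set A \<longleftrightarrow> (\<exists>n\<in>elts omega. equipotent A n)"

definition countable_set :: "'v \<Rightarrow> bool" where
  "countable_set A \<longleftrightarrow> (\<exists>B. elts B \<subseteq> elts omega \<and> equipotent A B)"

definition CMC :: bool where
  "CMC \<longleftrightarrow>
     (\<forall>A B. is_function A omega B \<and> (\<forall>n\<in>elts omega. elts (app A n) \<noteq> {}) \<longrightarrow>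
        (\<exists>F C. is_function F omega C \<and>
           (\<forall>n\<in>elts omega. elts (app F n) \<noteq> {} \<and> finite_set (app F n) \<and>
              elts (app F n) \<subseteq> elts (app A n))))"

section \<open>Topological spaces\<close>

text \<open>The HOL set argument \<^term>\<open>S\<close> below stands for a definable class; openness of \<^term>\<open>S\<close>
  includes that it is (the extension of) a set of the model.\<close>

definition open_in :: "'v tspace \<Rightarrow> 'v set \<Rightarrow> bool" where
  "open_in X S \<longleftrightarrow> (\<exists>U\<in>elts (opens X). elts U = S)"

definition closed_in :: "'v tspace \<Rightarrow> 'v set \<Rightarrow> bool" where
  "closed_in X S \<longleftrightarrow> S \<subseteq> elts (points X) \<and> open_in X (elts (points X) - S)"

definition clopen_in :: "'v tspace \<Rightarrow> 'v set \<Rightarrow> bool" where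
  "clopen_in X S \<longleftrightarrow> open_in X S \<and> closed_in X S"

definition topological_space :: "'v tspace \<Rightarrow> bool" where
  "topological_space X \<longleftrightarrow>
     (\<forall>U\<in>elts (opens X). elts U \<subseteq> elts (points X)) \<and>
     open_in X {} \<and> open_in X (elts (points X)) \<and>
     (\<forall>U\<in>elts (opens X). \<forall>V\<in>elts (opens X). open_in X (elts U \<inter> elts V)) \<and>
     (\<forall>\<U>. elts \<U> \<subseteq> elts (opens X) \<longrightarrow> open_in X (\<Union>U\<in>elts \<U>. elts U))"

definition continuous :: "'v tspace \<Rightarrow> 'v tspace \<Rightarrow> 'v \<Rightarrow> bool" where
  "continuous X Y f \<longleftrightarrow>
     is_function f (points X) (points Y) \<and>
     (\<forall>V\<in>elts (opens Y). open_in X {x \<in> elts (points X). app f x \<in> elts V})"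

definition homeomorphism :: "'v tspace \<Rightarrow> 'v tspace \<Rightarrow> 'v \<Rightarrow> bool" where
  "homeomorphism X Y f \<longleftrightarrow>
     is_bijection f (points X) (points Y) \<and> continuous X Y f \<and>
     (\<forall>U\<in>elts (opens X). open_in Y (app f ` elts U))"

definition subspace :: "'v tspace \<Rightarrow> 'v \<Rightarrow> 'v tspace" where
  "subspace X A =
     \<lparr>points = A, opens = vset {U. \<exists>V\<in>elts (opens X). elts U = elts V \<inter> elts A}\<rparr>"

definition T1_space :: "'v tspace \<Rightarrow> bool" where
  "T1_space X \<longleftrightarrow> (\<forall>x\<in>elts (points X). closed_in X {x})"

definition is_base :: "'v tspace \<Rightarrow> ('v \<Rightarrow> bool) \<Rightarrow> bool" where
  "is_base X P \<longleftrightarrow>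
     (\<forall>B. P B \<longrightarrow> B \<in> elts (opens X)) \<and>
     (\<forall>U\<in>elts (opens X). \<forall>x\<in>elts U. \<exists>B. P B \<and> x \<in> elts B \<and> elts B \<subseteq> elts U)"

definition zero_dimensional :: "'v tspace \<Rightarrow> bool" where
  "zero_dimensional X \<longleftrightarrow> is_base X (\<lambda>B. clopen_in X (elts B))"

definition compact_space :: "'v tspace \<Rightarrow> bool" where
  "compact_space X \<longleftrightarrow>
     (\<forall>\<U>. elts \<U> \<subseteq> elts (opens X) \<and> (\<Union>U\<in>elts \<U>. elts U) = elts (points X) \<longrightarrow>
        (\<exists>\<F>. finite_set \<F> \<and> elts \<F> \<subseteq> elts \<U> \<and> (\<Union>U\<in>elts \<F>. elts U) = elts (points X)))"

section \<open>N-compact spaces\<close>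

definition discrete_omega :: "'v tspace" where
  "discrete_omega = \<lparr>points = omega, opens = vset {U. elts U \<subseteq> elts omega}\<rparr>"

text \<open>The product topology on the power: the coarsest topology making all projections
  continuous, that is, the intersection of all such topologies.\<close>

definition power_space :: "'v tspace \<Rightarrow> 'v \<Rightarrow> 'v tspace" where
  "power_space Y J =
     (let P = vset {f. is_function f J (points Y)} in
      \<lparr>points = P,
       opens = vset {U. \<forall>T. topological_space \<lparr>points = P, opens = T\<rparr> \<and>
                  (\<forall>j\<in>elts J. \<forall>V\<in>elts (opens Y).
                     open_in \<lparr>points = P, opens = T\<rparr> {f \<in> elts P. app f j \<in> elts V}) \<longrightarrow>
                  U \<in> elts T}\<rparr>)"

definition N_compact :: "'v tspace \<Rightarrow> bool" where
  "N_compact X \<longleftrightarrow>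
     (\<exists>J F h. elts J \<noteq> {} \<and> closed_in (power_space discrete_omega J) (elts F) \<and>
        homeomorphism X (subspace (power_space discrete_omega J) F) h)"

section \<open>Banaschewski compactifications\<close>

definition embedding :: "'v tspace \<Rightarrow> 'v tspace \<Rightarrow> 'v \<Rightarrow> bool" where
  "embedding X Y f \<longleftrightarrow>
     is_function f (points X) (points Y) \<and>
     homeomorphism X (subspace Y (vset (app f ` elts (points X)))) f"

definition compactification :: "'v tspace \<Rightarrow> 'v tspace \<Rightarrow> 'v \<Rightarrow> bool" where
  "compactification X K c \<longleftrightarrow>
     topological_space K \<and> compact_space K \<and> embedding X K c \<and>
     (\<forall>U\<in>elts (opens K). elts U \<noteq> {} \<longrightarrow> elts U \<inter> app c ` elts (points X) \<noteq> {})"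

definition Banaschewski_compactification :: "'v tspace \<Rightarrow> 'v tspace \<Rightarrow> 'v \<Rightarrow> bool" where
  "Banaschewski_compactification X B b \<longleftrightarrow>
     compactification X B b \<and> zero_dimensional B \<and> T1_space B \<and>
     (\<forall>K f. topological_space K \<and> compact_space K \<and> zero_dimensional K \<and> T1_space K \<and>
        continuous X K f \<longrightarrow>
        (\<exists>g. continuous B K g \<and> (\<forall>x\<in>elts (points X). app g (app b x) = app f x)))"

section \<open>The real numbers\<close>

text \<open>The operations and the order of \<^term>\<open>R\<close> are sets of the model; \<open>real_ring\<close> presents them
  as a HOL-Algebra ring.\<close>

definition real_ring :: "'v real_structure \<Rightarrow> 'v ring" where
  "real_ring R =
     \<lparr>carrier = elts (rcarrier R),
      mult = (\<lambda>a b. app (rtimes R) (opair a b)), one = rone R,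
      zero = rzero R, add = (\<lambda>a b. app (rplus R) (opair a b))\<rparr>"

definition leq :: "'v real_structure \<Rightarrow> 'v \<Rightarrow> 'v \<Rightarrow> bool" where
  "leq R a b \<longleftrightarrow> opair a b \<in> elts (rle R)"

definition less :: "'v real_structure \<Rightarrow> 'v \<Rightarrow> 'v \<Rightarrow> bool" where
  "less R a b \<longleftrightarrow> leq R a b \<and> a \<noteq> b"

definition is_upper_bound :: "'v real_structure \<Rightarrow> 'v set \<Rightarrow> 'v \<Rightarrow> bool" where
  "is_upper_bound R S b \<longleftrightarrow> b \<in> elts (rcarrier R) \<and> (\<forall>s\<in>S. leq R s b)"

definition is_sup :: "'v real_structure \<Rightarrow> 'v set \<Rightarrow> 'v \<Rightarrow> bool" where
  "is_sup R S b \<longleftrightarrow> is_upper_bound R S b \<and> (\<forall>c. is_upper_bound R S c \<longrightarrow> leq R b c)"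

text \<open>In every model of ZF a Dedekind-complete ordered field exists and is unique up to a unique
  isomorphism in the model; any one of them serves as the real numbers.\<close>

definition complete_ordered_field :: "'v real_structure \<Rightarrow> bool" where
  "complete_ordered_field R \<longleftrightarrow>
     is_function (rplus R) (cartesian (rcarrier R) (rcarrier R)) (rcarrier R) \<and>
     is_function (rtimes R) (cartesian (rcarrier R) (rcarrier R)) (rcarrier R) \<and>
     elts (rle R) \<subseteq> elts (cartesian (rcarrier R) (rcarrier R)) \<and>
     field (real_ring R) \<and>
     (\<forall>a\<in>elts (rcarrier R). leq R a a) \<and>
     (\<forall>a\<in>elts (rcarrier R). \<forall>b\<in>elts (rcarrier R).
        (leq R a b \<or> leq R b a) \<and> (leq R a b \<and> leq R b a \<longrightarrow> a = b)) \<and>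
     (\<forall>a\<in>elts (rcarrier R). \<forall>b\<in>elts (rcarrier R). \<forall>c\<in>elts (rcarrier R).
        leq R a b \<and> leq R b c \<longrightarrow> leq R a c) \<and>
     (\<forall>a\<in>elts (rcarrier R). \<forall>b\<in>elts (rcarrier R). \<forall>c\<in>elts (rcarrier R).
        leq R a b \<longrightarrow> leq R (a \<oplus>\<^bsub>real_ring R\<^esub> c) (b \<oplus>\<^bsub>real_ring R\<^esub> c)) \<and>
     (\<forall>a\<in>elts (rcarrier R). \<forall>b\<in>elts (rcarrier R).
        leq R (rzero R) a \<and> leq R (rzero R) b \<longrightarrow> leq R (rzero R) (a \<otimes>\<^bsub>real_ring R\<^esub> b)) \<and>
     (\<forall>S. elts S \<subseteq> elts (rcarrier R) \<and> elts S \<noteq> {} \<and> (\<exists>b. is_upper_bound R (elts S) b) \<longrightarrow>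
        (\<exists>b. is_sup R (elts S) b))"

definition rabs :: "'v real_structure \<Rightarrow> 'v \<Rightarrow> 'v" where
  "rabs R a = (if leq R (rzero R) a then a else \<ominus>\<^bsub>real_ring R\<^esub> a)"

definition real_line :: "'v real_structure \<Rightarrow> 'v tspace" where
  "real_line R =
     \<lparr>points = rcarrier R,
      opens = vset {U. elts U \<subseteq> elts (rcarrier R) \<and>
                 (\<forall>x\<in>elts U. \<exists>a\<in>elts (rcarrier R). \<exists>b\<in>elts (rcarrier R). less R a x \<and> less R x b \<and>
                    (\<forall>y\<in>elts (rcarrier R). less R a y \<and> less R y b \<longrightarrow> y \<in> elts U))}\<rparr>"

section \<open>Rings of continuous functions\<close>

definition C_ring :: "'v real_structure \<Rightarrow> 'v tspace \<Rightarrow> 'v ring" where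
  "C_ring R X =
     \<lparr>carrier = {f. continuous X (real_line R) f},
      mult = (\<lambda>f g. lam (points X) (\<lambda>x. app f x \<otimes>\<^bsub>real_ring R\<^esub> app g x)),
      one = lam (points X) (\<lambda>x. rone R),
      zero = lam (points X) (\<lambda>x. rzero R),
      add = (\<lambda>f g. lam (points X) (\<lambda>x. app f x \<oplus>\<^bsub>real_ring R\<^esub> app g x))\<rparr>"

definition zero_set :: "'v real_structure \<Rightarrow> 'v tspace \<Rightarrow> 'v \<Rightarrow> bool" where
  "zero_set R X Z \<longleftrightarrow>
     (\<exists>f\<in>carrier (C_ring R X). elts Z = {x \<in> elts (points X). app f x = rzero R})"

definition completely_regular :: "'v real_structure \<Rightarrow> 'v tspace \<Rightarrow> bool" where
  "completely_regular R X \<longleftrightarrow>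
     is_base X (\<lambda>B. \<exists>Z. zero_set R X Z \<and> elts B = elts (points X) - elts Z)"

definition Tychonoff :: "'v real_structure \<Rightarrow> 'v tspace \<Rightarrow> bool" where
  "Tychonoff R X \<longleftrightarrow> completely_regular R X \<and> T1_space X"

definition strongly_zero_dimensional :: "'v real_structure \<Rightarrow> 'v tspace \<Rightarrow> bool" where
  "strongly_zero_dimensional R X \<longleftrightarrow>
     completely_regular R X \<and>
     (\<forall>Z1 Z2. zero_set R X Z1 \<and> zero_set R X Z2 \<and> elts Z1 \<inter> elts Z2 = {} \<longrightarrow>
        (\<exists>U. clopen_in X (elts U) \<and> elts Z1 \<subseteq> elts U \<and> elts U \<subseteq> elts (points X) - elts Z2))"

text \<open>\<^term>\<open>s\<close> is the oscillation of \<^term>\<open>f\<close> on \<^term>\<open>A\<close>; no \<^term>\<open>s\<close> qualifies when the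
  oscillation is infinite.\<close>

definition is_osc :: "'v real_structure \<Rightarrow> 'v \<Rightarrow> 'v \<Rightarrow> 'v \<Rightarrow> bool" where
  "is_osc R f A s \<longleftrightarrow>
     (if elts A = {} then s = rzero R
      else is_sup R {d. \<exists>x\<in>elts A. \<exists>y\<in>elts A.
                       d = rabs R (app f x \<ominus>\<^bsub>real_ring R\<^esub> app f y)} s)"

definition U_aleph0 :: "'v real_structure \<Rightarrow> 'v tspace \<Rightarrow> 'v ring" where
  "U_aleph0 R X = (C_ring R X)
     \<lparr>carrier := {f \<in> carrier (C_ring R X).
        \<forall>\<epsilon>\<in>elts (rcarrier R). less R (rzero R) \<epsilon> \<longrightarrow>
          (\<exists>\<A>. countable_set \<A> \<and> (\<Union>A\<in>elts \<A>. elts A) = elts (points X) \<and>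
             (\<forall>A\<in>elts \<A>. clopen_in X (elts A) \<and> (\<exists>s. is_osc R f A s \<and> leq R s \<epsilon>)))}\<rparr>"

text \<open>The isomorphism has to be a function of the model: an arbitrary HOL bijection between the
  carriers is not enough.\<close>

definition isomorphic_rings :: "'v ring \<Rightarrow> 'v ring \<Rightarrow> bool" where
  "isomorphic_rings A B \<longleftrightarrow>
     (\<exists>\<phi>. is_function \<phi> (vset (carrier A)) (vset (carrier B)) \<and> app \<phi> \<in> ring_iso A B)"

end

end

theory Submission
  imports Defs "HOL-Algebra.Weak_Morphisms" HOL.Rat
begin

text \<open>
  Write \<open>U(X)\<close> for the ring of functions that oscillate little on the pieces of countable clopen covers, and
  \<open>C(X)\<close> for the ring of all continuous functions. Both implications reduce to the equality
  \<open>U(X) = C(X)\<close>.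

  If \<open>X\<close> is strongly zero-dimensional and \<open>f\<close> is continuous, the closed sets on which \<open>f\<close> is close
  to a given multiple of \<open>\<delta>\<close> are separated by clopen sets from the points where \<open>f\<close> is farther away. There
  are countably many multiples, and countable multiple choice yields finitely many separating
  sets for each of them, whose union separates too. Hence \<open>f\<close> is in \<open>U(X)\<close>, and \<open>Y = X\<close> is as required
  (\<open>strongly_zero_dimensional_cont_ucont\<close>). Conversely, \<open>U(X) = C(X)\<close> implies that disjoint
  zero-sets are separated: a continuous function that is 0 on one and 1 on the other is in \<open>U(X)\<close>, and
  a countable clopen cover with small oscillations can be made disjoint
  (\<open>ucont_clopen_separation\<close>).

  Now let \<open>\<phi>\<close> be an isomorphism from \<open>U(X)\<close> to \<open>C(Y)\<close>. Every \<open>y\<close> in \<open>Y\<close> gives the homomorphism \<open>f \<mapsto> \<phi>(f)(y)\<close>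
  from \<open>U(X)\<close> to the real numbers. It fixes the constants, because the only endomorphism of the real numbers is the
  identity. Regard \<open>X\<close> as a closed subspace of a power of the discrete natural numbers. For each
  coordinate the homomorphism is 1 on the characteristic function of exactly one fibre; otherwise the
  coordinate, made real-valued, would differ from its image under the homomorphism by a unit. The values so
  singled out are the coordinates of a point \<open>h(y)\<close>, which belongs to \<open>X\<close> because \<open>X\<close> is
  closed, and \<open>\<phi>(f)(y) = f(h(y))\<close> for all \<open>f\<close> in \<open>U(X)\<close>. The map \<open>h\<close> is continuous and has dense range. For a continuous \<open>f\<close> on \<open>X\<close>
  the function \<open>f \<circ> h\<close> is in \<open>C(Y)\<close>, hence equal to \<open>\<phi>(g) = g \<circ> h\<close> for some \<open>g\<close> in \<open>U(X)\<close>. By density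
  \<open>f = g\<close>, so \<open>U(X) = C(X)\<close> (\<open>cont_imp_ucont\<close>).

  All objects have to be sets of the given model of ZF. Two devices keep this manageable.
  Definability with parameters is treated as a property of HOL predicates on environments and derived
  by syntax-directed rules, so Separation and Replacement apply to HOL expressions. And the
  real numbers of the model are presented by a type of class \<^class>\<open>linordered_field\<close>; the last section explains why
  such a type may be assumed.
\<close>

section \<open>Definability over the model\<close>

context universe
begin

text \<open>Binders are crossed by lifting the renaming; this is what allows the variables of several formulas
  to be merged into one environment.\<close>

primrec rename_vars :: "(nat \<Rightarrow> nat) \<Rightarrow> set_formula \<Rightarrow> set_formula" where
  "rename_vars r (Mem i j) = Mem (r i) (r j)"
| "rename_vars r (Eq i j) = Eq (r i) (r j)"
| "rename_vars r (Neg p) = Neg (rename_vars r p)"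
| "rename_vars r (Conj p q) = Conj (rename_vars r p) (rename_vars r q)"
| "rename_vars r (Forall p) = Forall (rename_vars (case_nat 0 (\<lambda>i. Suc (r i))) p)"

lemma sat_rename_vars: "sat e (rename_vars r p) \<longleftrightarrow> sat (\<lambda>i. e (r i)) p"
proof (induction p arbitrary: e r)
  case (Forall p)
  have "(\<lambda>i. case_nat x e (case_nat 0 (\<lambda>i. Suc (r i)) i)) = case_nat x (\<lambda>i. e (r i))" for x
    by (auto split: nat.splits)
  then show ?case by (simp add: Forall.IH)
qed auto

text \<open>A formula sees an environment in which each variable is either a parameter, that is, a fixed
  element of the model, or an entry of the environment that varies. Both kinds are assigned
  position by position, so that parameters never have to be placed before or after the
  infinitely many variables.\<close>

definition fill :: "(nat \<Rightarrow> 'v + nat) \<Rightarrow> (nat \<Rightarrow> 'v) \<Rightarrow> nat \<Rightarrow> 'v" where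
  "fill \<kappa> e i = (case \<kappa> i of Inl c \<Rightarrow> c | Inr k \<Rightarrow> e k)"

text \<open>First-order definability with parameters, as a property of HOL predicates on environments. With
  this higher-order encoding definability is derived by resolution along the syntax of the
  predicate: entry \<open>e 0\<close> is the variable bound last, and going under a binder replaces
  \<open>e\<close> by \<open>\<lambda>i. e (Suc i)\<close>. The rules collected under \<open>dfn\<close> do this for all notions below, and
  they stand in for writing down formulas.\<close>

definition dpred :: "((nat \<Rightarrow> 'v) \<Rightarrow> bool) \<Rightarrow> bool" where
  "dpred P \<longleftrightarrow> (\<exists>\<kappa> p. \<forall>e. P e \<longleftrightarrow> sat (fill \<kappa> e) p)"

text \<open>A term is definable if its graph is; by this choice a defined term can be substituted into
  a definable predicate by an existential quantifier.\<close>

definition dterm :: "((nat \<Rightarrow> 'v) \<Rightarrow> 'v) \<Rightarrow> bool" where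
  "dterm t \<longleftrightarrow> dpred (\<lambda>e. e 0 = t (\<lambda>i. e (Suc i)))"

named_theorems dfn

lemma dpredI: "(\<And>e. P e \<longleftrightarrow> sat (fill \<kappa> e) p) \<Longrightarrow> dpred P"
  unfolding dpred_def by blast

lemma dpred_const [dfn]: "dpred (\<lambda>e. b)"
  by (rule dpredI[where \<kappa> = Inr and p = "if b then Eq 0 0 else Neg (Eq 0 0)"]) simp

lemma dpred_not [dfn]: "dpred P \<Longrightarrow> dpred (\<lambda>e. \<not> P e)"
  unfolding dpred_def by (metis sat.simps(3))

text \<open>The two formulas receive the even and the odd variables, so their parameters do not collide.\<close>

lemma dpred_conj [dfn]:
  assumes "dpred P" "dpred Q"
  shows "dpred (\<lambda>e. P e \<and> Q e)"
proof -
  obtain \<kappa> p where p: "\<And>e. P e \<longleftrightarrow> sat (fill \<kappa> e) p"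
    using assms(1) unfolding dpred_def by blast
  obtain \<kappa>' q where q: "\<And>e. Q e \<longleftrightarrow> sat (fill \<kappa>' e) q"
    using assms(2) unfolding dpred_def by blast
  define \<rho> where "\<rho> i = (if even i then \<kappa> (i div 2) else \<kappa>' (i div 2))" for i :: nat
  have "(\<lambda>i. fill \<rho> e (2 * i)) = fill \<kappa> e" "(\<lambda>i. fill \<rho> e (2 * i + 1)) = fill \<kappa>' e" for e
    by (auto simp: \<rho>_def fill_def)
  then show ?thesis
    by (intro dpredI[of _ \<rho> "Conj (rename_vars (\<lambda>i. 2 * i) p) (rename_vars (\<lambda>i. 2 * i + 1) q)"])
      (simp only: sat.simps sat_rename_vars p q)
qed

text \<open>A formula whose variables are filled by \<open>\<kappa>\<close> can mention entry 0 of the environment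
  at many positions. Before quantifying, all these positions are identified with the bound variable 0,
  and the remaining ones move up by one.\<close>

definition bind_index :: "(nat \<Rightarrow> 'v + nat) \<Rightarrow> nat \<Rightarrow> nat" where
  "bind_index \<kappa> i = (if \<kappa> i = Inr 0 then 0 else Suc i)"

definition unbind :: "(nat \<Rightarrow> 'v + nat) \<Rightarrow> nat \<Rightarrow> 'v + nat" where
  "unbind \<kappa> i = map_sum id (\<lambda>k. k - 1) (\<kappa> i)"

lemma fill_bind: "(\<lambda>i. case_nat x (fill (unbind \<kappa>) e) (bind_index \<kappa> i)) = fill \<kappa> (case_nat x e)"
  by (auto simp: fun_eq_iff fill_def bind_index_def unbind_def split: sum.splits nat.splits)

lemma dpred_all:
  assumes "dpred P"
  shows "dpred (\<lambda>e. \<forall>x. P (case_nat x e))"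
proof -
  obtain \<kappa> p where p: "\<And>e. P e \<longleftrightarrow> sat (fill \<kappa> e) p"
    using assms unfolding dpred_def by blast
  show ?thesis
    by (rule dpredI[of _ "unbind \<kappa>" "Forall (rename_vars (bind_index \<kappa>) p)"])
      (simp add: sat_rename_vars fill_bind p)
qed

lemma dpred_All [dfn]:
  assumes "dpred (\<lambda>e. P (\<lambda>i. e (Suc i)) (e 0))"
  shows "dpred (\<lambda>e. \<forall>x. P e x)"
  using dpred_all[OF assms] by simp

lemma dpred_substitute:
  assumes "dpred P"
  shows "dpred (\<lambda>e. P (fill \<rho> e))"
proof -
  obtain \<kappa> p where p: "\<And>e. P e \<longleftrightarrow> sat (fill \<kappa> e) p"
    using assms(1) unfolding dpred_def by blast
  have "fill (\<lambda>i. case \<kappa> i of Inl c \<Rightarrow> Inl c | Inr k \<Rightarrow> \<rho> k) e = fill \<kappa> (fill \<rho> e)" for e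
    by (auto simp: fun_eq_iff fill_def split: sum.splits)
  then show ?thesis
    by (intro dpredI[of _ "\<lambda>i. case \<kappa> i of Inl c \<Rightarrow> Inl c | Inr k \<Rightarrow> \<rho> k" p]) (simp add: p)
qed

lemma dpred_shift: "dpred P \<Longrightarrow> dpred (\<lambda>e. P (\<lambda>i. e (r i)))"
  using dpred_substitute[of P "\<lambda>i. Inr (r i)"] by (simp add: fill_def [abs_def])

lemma dpred_disj [dfn]: "dpred P \<Longrightarrow> dpred Q \<Longrightarrow> dpred (\<lambda>e. P e \<or> Q e)"
  using dpred_not[OF dpred_conj[OF dpred_not[of P] dpred_not[of Q]]] by simp

lemma dpred_imp [dfn]: "dpred P \<Longrightarrow> dpred Q \<Longrightarrow> dpred (\<lambda>e. P e \<longrightarrow> Q e)"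
  using dpred_not[OF dpred_conj[OF _ dpred_not[of Q]]] by simp

lemma dpred_iff [dfn]: "dpred P \<Longrightarrow> dpred Q \<Longrightarrow> dpred (\<lambda>e. P e \<longleftrightarrow> Q e)"
  using dpred_conj[OF dpred_imp[of P Q] dpred_imp[of Q P]] by (simp add: iff_conv_conj_imp)

lemma dpred_Ex [dfn]:
  assumes "dpred (\<lambda>e. P (\<lambda>i. e (Suc i)) (e 0))"
  shows "dpred (\<lambda>e. \<exists>x. P e x)"
  using dpred_not[OF dpred_All[of "\<lambda>e x. \<not> P e x", OF dpred_not[OF assms]]] by simp

lemma dpred_mem_var: "dpred (\<lambda>e. mem (e i) (e j))"
  by (rule dpredI[of _ Inr "Mem i j"]) (simp add: fill_def)

lemma dpred_eq_var: "dpred (\<lambda>e. e i = e j)"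
  by (rule dpredI[of _ Inr "Eq i j"]) (simp add: fill_def)

lemma dterm_var [dfn]: "dterm (\<lambda>e. e k)"
  unfolding dterm_def by (rule dpred_eq_var)

lemma dterm_const [dfn]: "dterm (\<lambda>e. c)"
  unfolding dterm_def
  by (rule dpredI[of _ "case_nat (Inr 0) (\<lambda>_. Inl c)" "Eq 0 1"]) (simp add: fill_def)

lemma dpred_term:
  assumes "dterm t" "dpred (\<lambda>e. P (\<lambda>i. e (Suc i)) (e 0))"
  shows "dpred (\<lambda>e. P e (t e))"
proof -
  have "dpred (\<lambda>e. \<exists>x. x = t e \<and> P e x)"
    using assms(1) unfolding dterm_def by (intro dfn assms(2))
  then show ?thesis by simp
qed

lemma dterm_shift: "dterm t \<Longrightarrow> dterm (\<lambda>e. t (\<lambda>i. e (r i)))"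
  unfolding dterm_def by (drule dpred_shift[of _ "case_nat 0 (\<lambda>i. Suc (r i))"]) simp

lemma dpred_rel2:
  assumes "dpred (\<lambda>e. Q (e 0) (e 1))" "dterm s" "dterm t"
  shows "dpred (\<lambda>e. Q (s e) (t e))"
proof (rule dpred_term[OF assms(2)], rule dpred_term[OF dterm_shift[OF assms(3)]])
  show "dpred (\<lambda>e. Q ((\<lambda>i. e (Suc i)) 0) (e 0))"
    using dpred_shift[OF assms(1), of "case_nat 1 (\<lambda>_. 0)"] by simp
qed

lemma dpred_mem [dfn]: "dterm s \<Longrightarrow> dterm t \<Longrightarrow> dpred (\<lambda>e. mem (s e) (t e))"
  by (rule dpred_rel2[where Q = mem, OF dpred_mem_var])

lemma dpred_eq [dfn]: "dterm s \<Longrightarrow> dterm t \<Longrightarrow> dpred (\<lambda>e. s e = t e)"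
  by (rule dpred_rel2[where Q = "(=)", OF dpred_eq_var])

lemma mem_elts [simp]: "x \<in> elts a \<longleftrightarrow> mem x a"
  by (simp add: elts_def)

lemma dpred_elts [dfn]: "dterm s \<Longrightarrow> dterm t \<Longrightarrow> dpred (\<lambda>e. s e \<in> elts (t e))"
  by (simp add: dpred_mem)

lemma dpred_Ball [dfn]:
  assumes "dterm t" "dpred (\<lambda>e. P (\<lambda>i. e (Suc i)) (e 0))"
  shows "dpred (\<lambda>e. \<forall>x\<in>elts (t e). P e x)"
  unfolding Ball_def by (intro dfn assms dterm_shift[OF assms(1)])

lemma dpred_Bex [dfn]:
  assumes "dterm t" "dpred (\<lambda>e. P (\<lambda>i. e (Suc i)) (e 0))"
  shows "dpred (\<lambda>e. \<exists>x\<in>elts (t e). P e x)"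
  unfolding Bex_def by (intro dfn assms dterm_shift[OF assms(1)])

lemma dpred_subset [dfn]:
  assumes "dterm s" "dterm t"
  shows "dpred (\<lambda>e. elts (s e) \<subseteq> elts (t e))"
  unfolding subset_iff by (intro dfn dterm_shift[OF assms(1)] dterm_shift[OF assms(2)])

lemma dtermI:
  assumes "dpred (\<lambda>e. Q (e 0) (\<lambda>i. e (Suc i)))" "\<And>y e. y = t e \<longleftrightarrow> Q y e"
  shows "dterm t"
  unfolding dterm_def assms(2) by (rule assms(1))

lemma dterm_fun1:
  assumes "dterm (\<lambda>e. F (e 0))" "dterm s"
  shows "dterm (\<lambda>e. F (s e))"
  unfolding dterm_def
  by (rule dpred_term[OF dterm_shift[OF assms(2)]])
    (intro dfn dterm_shift[OF assms(1), of "\<lambda>_. 0"])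

lemma dterm_fun2:
  assumes "dterm (\<lambda>e. F (e 0) (e 1))" "dterm s" "dterm t"
  shows "dterm (\<lambda>e. F (s e) (t e))"
  unfolding dterm_def
  apply (rule dpred_term[OF dterm_shift[OF assms(2)]])
  apply (rule dpred_term[OF dterm_shift[OF assms(3)]])
  using dterm_shift[OF assms(1), of "case_nat 1 (\<lambda>_. 0)"] by (intro dfn) simp

lemma dterm_If [dfn]:
  assumes "dpred P" "dterm s" "dterm t"
  shows "dterm (\<lambda>e. if P e then s e else t e)"
  by (rule dtermI[where Q = "\<lambda>y e. (P e \<and> y = s e) \<or> (\<not> P e \<and> y = t e)"])
    (intro dfn dpred_shift[OF assms(1)] dterm_shift[OF assms(2)] dterm_shift[OF assms(3)], auto)

end

section \<open>Elementary set theory in the model\<close>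

context ZF_universe
begin

lemma elts_inject: "elts a = elts b \<longleftrightarrow> a = b"
  using extensionality by auto

lemma vset_elts [simp]: "vset (elts a) = a"
  unfolding vset_def by (simp add: elts_inject)

lemma elts_vset: "\<exists>a. elts a = S \<Longrightarrow> elts (vset S) = S"
  by auto

text \<open>Separation for every HOL predicate that is definable, where the entries of \<open>e\<close> serve as additional
  parameters.\<close>

lemma separation_param:
  assumes "dpred (\<lambda>e. P (\<lambda>i. e (Suc i)) (e 0))"
  shows "\<exists>c. elts c = {x \<in> elts a. P e x}"
proof -
  obtain \<kappa> p where p: "\<And>e. P (\<lambda>i. e (Suc i)) (e 0) \<longleftrightarrow> sat (fill \<kappa> e) p"
    using assms unfolding dpred_def by metis
  have "sat (case_nat x (fill (unbind \<kappa>) e)) (rename_vars (bind_index \<kappa>) p) \<longleftrightarrow> P e x" for x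
    using p[of "case_nat x e"] by (simp add: sat_rename_vars fill_bind)
  then show ?thesis
    using separation[of a "fill (unbind \<kappa>) e" "rename_vars (bind_index \<kappa>) p"] by simp
qed

definition sep :: "'v \<Rightarrow> ('v \<Rightarrow> bool) \<Rightarrow> 'v" where
  "sep a P = vset {x \<in> elts a. P x}"

lemma ex_sep: "dpred (\<lambda>e. P (e 0)) \<Longrightarrow> \<exists>c. elts c = {x \<in> elts a. P x}"
  by (rule separation_param[of "\<lambda>_. P"])

lemma elts_sep: "dpred (\<lambda>e. P (e 0)) \<Longrightarrow> elts (sep a P) = {x \<in> elts a. P x}"
  unfolding sep_def by (rule elts_vset[OF ex_sep])

lemma mem_sep: "dpred (\<lambda>e. P (e 0)) \<Longrightarrow> mem x (sep a P) \<longleftrightarrow> mem x a \<and> P x"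
  by (subst mem_elts[symmetric], subst elts_sep) simp_all

text \<open>How sets of the model are obtained throughout: bound the class by a set and show that membership
  in it is definable.\<close>

lemma ex_subclass:
  assumes "S \<subseteq> elts a" "dpred (\<lambda>e. e 0 \<in> S)"
  shows "\<exists>c. elts c = S"
proof -
  have "{x \<in> elts a. x \<in> S} = S" using assms(1) by auto
  then show ?thesis using ex_sep[OF assms(2), of a] by simp
qed

lemma dterm_vset:
  assumes ex: "\<And>e. \<exists>c. elts c = {x. P e x}" and P: "dpred (\<lambda>e. P (\<lambda>i. e (Suc i)) (e 0))"
  shows "dterm (\<lambda>e. vset {x. P e x})"
proof (rule dtermI[where Q = "\<lambda>y e. \<forall>x. mem x y \<longleftrightarrow> P e x"])
  show "dpred (\<lambda>e. \<forall>x. mem x (e 0) \<longleftrightarrow> P (\<lambda>i. e (Suc i)) x)"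
    using dpred_shift[OF P, of "case_nat 0 (\<lambda>i. Suc (Suc i))"] by (intro dfn) simp
  show "y = vset {x. P e x} \<longleftrightarrow> (\<forall>x. mem x y \<longleftrightarrow> P e x)" for y e
    using elts_vset[OF ex[of e]] elts_inject[of y "vset {x. P e x}"] by (auto simp: set_eq_iff)
qed

lemma dterm_sep [dfn]:
  assumes "dterm a" and P: "dpred (\<lambda>e. P (\<lambda>i. e (Suc i)) (e 0))"
  shows "dterm (\<lambda>e. sep (a e) (P e))"
  unfolding sep_def
  by (rule dterm_vset[OF separation_param[OF P]]) (intro dfn dterm_shift[OF assms(1)] P)

text \<open>In the formula the value comes before the argument, whereas Replacement expects the argument
  first; hence the exchange of the variables 0 and 1 in the renaming.\<close>

lemma replacement_param:
  assumes "dterm (\<lambda>e. F (e 0))"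
  shows "\<exists>c. elts c = F ` elts a"
proof -
  have D: "dpred (\<lambda>e. e 0 = F (e 1))"
    using assms by (simp add: dterm_def)
  obtain \<kappa> p where p: "\<And>e. e 0 = F (e 1) \<longleftrightarrow> sat (fill \<kappa> e) p"
    using D unfolding dpred_def by metis
  define h where "h = fill (unbind (unbind \<kappa>)) (\<lambda>_. undefined)"
  define r where "r i = (if \<kappa> i = Inr 0 then 1 else if \<kappa> i = Inr 1 then 0 else Suc (Suc i))" for i
  have "(\<lambda>i. case_nat x (case_nat y h) (r i)) = fill \<kappa> (case_nat y (case_nat x (\<lambda>_. undefined)))" for x y
    by (auto simp: fun_eq_iff fill_def unbind_def h_def r_def numeral_2_eq_2
        split: sum.splits nat.splits)
  then have *: "sat (case_nat x (case_nat y h)) (rename_vars r p) \<longleftrightarrow> y = F x" for x y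
    using p[of "case_nat y (case_nat x (\<lambda>_. undefined))"] by (simp add: sat_rename_vars)
  have "\<exists>c. elts c = {y. \<exists>x\<in>elts a. sat (case_nat x (case_nat y h)) (rename_vars r p)}"
    by (rule replacement) (simp add: *)
  then show ?thesis by (auto simp: * image_def)
qed

lemma elts_image: "dterm (\<lambda>e. F (e 0)) \<Longrightarrow> elts (vset (F ` elts a)) = F ` elts a"
  by (rule elts_vset[OF replacement_param])

lemma elts_pair [simp]: "elts (vset {a, b}) = {a, b}"
  by (rule elts_vset[OF pairing])

lemma elts_singleton [simp]: "elts (vset {a}) = {a}"
  using elts_pair[of a a] by simp

lemma ex_empty: "\<exists>c. elts c = {}"
  using ex_sep[OF dpred_const[of False]] by simp

lemma elts_empty [simp]: "elts (vset {}) = {}"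
  by (rule elts_vset[OF ex_empty])

lemma not_mem_empty [simp]: "\<not> mem x (vset {})"
  using elts_empty mem_elts by blast

lemma ex_Un: "\<exists>c. elts c = elts a \<union> elts b"
  using union[of "vset {a, b}"] by simp

lemma elts_insert [simp]: "elts (vset (insert a (elts b))) = insert a (elts b)"
  using elts_vset[OF ex_Un[of "vset {a}" b]] by simp

definition pow :: "'v \<Rightarrow> 'v" where
  "pow a = vset {x. elts x \<subseteq> elts a}"

lemma elts_pow [simp]: "elts (pow a) = {x. elts x \<subseteq> elts a}"
  unfolding pow_def by (rule elts_vset[OF power_set])

lemma mem_pow [simp]: "mem x (pow a) \<longleftrightarrow> elts x \<subseteq> elts a"
  using elts_pow mem_elts by blast

lemma dterm_pair [dfn]:
  assumes "dterm s" "dterm t"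
  shows "dterm (\<lambda>e. vset {s e, t e})"
proof -
  have *: "{x. x = s e \<or> x = t e} = {s e, t e}" for e
    by auto
  have "dterm (\<lambda>e. vset {x. x = s e \<or> x = t e})"
    by (rule dterm_vset, unfold *, rule pairing)
      (intro dfn dterm_shift[OF assms(1)] dterm_shift[OF assms(2)])
  then show ?thesis by (simp only: *)
qed

lemma dterm_singleton [dfn]: "dterm s \<Longrightarrow> dterm (\<lambda>e. vset {s e})"
  using dterm_pair[of s s] by simp

lemma dterm_insert [dfn]: "dterm s \<Longrightarrow> dterm t \<Longrightarrow> dterm (\<lambda>e. vset (insert (s e) (elts (t e))))"
proof -
  assume *: "dterm s" "dterm t"
  have "dterm (\<lambda>e. vset {x. x = s e \<or> mem x (t e)})"
  proof (rule dterm_vset)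
    fix e
    have "{x. x = s e \<or> mem x (t e)} = insert (s e) (elts (t e))"
      by auto
    then show "\<exists>c. elts c = {x. x = s e \<or> mem x (t e)}"
      by (metis elts_insert)
  qed (intro dfn dterm_shift[OF *(1)] dterm_shift[OF *(2)])
  moreover have "{x. x = s e \<or> mem x (t e)} = insert (s e) (elts (t e))" for e
    by auto
  ultimately show ?thesis by simp
qed

lemma dterm_opair [dfn]: "dterm s \<Longrightarrow> dterm t \<Longrightarrow> dterm (\<lambda>e. opair (s e) (t e))"
  unfolding opair_def by (intro dfn)

lemma opair_inject [simp]: "opair a b = opair c d \<longleftrightarrow> a = c \<and> b = d"
proof
  assume "opair a b = opair c d"
  then have "{vset {a}, vset {a, b}} = {vset {c}, vset {c, d}}"
    unfolding opair_def by (metis elts_pair)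
  moreover have "vset {x} = vset {y, z} \<longleftrightarrow> x = y \<and> x = z" "vset {x} = vset {y} \<longleftrightarrow> x = y"
     "vset {y, z} = vset {x} \<longleftrightarrow> x = y \<and> x = z" "vset {x, u} = vset {y, z} \<longleftrightarrow> {x, u} = {y, z}" for x y z u
    by (metis elts_pair elts_singleton doubleton_eq_iff singleton_insert_inj_eq insert_absorb2)+
  ultimately show "a = c \<and> b = d"
    by (auto simp: doubleton_eq_iff)
qed auto

lemma elts_cartesian: "elts (cartesian A B) = {p. \<exists>a\<in>elts A. \<exists>b\<in>elts B. p = opair a b}"
proof -
  obtain c where c: "elts c = elts A \<union> elts B" using ex_Un by blast
  have "opair a b \<in> elts (pow (pow c))" if "a \<in> elts A" "b \<in> elts B" for a b
    using that c by (auto simp: opair_def)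
  then have "\<exists>p. elts p = {p. \<exists>a\<in>elts A. \<exists>b\<in>elts B. p = opair a b}"
    by (intro ex_subclass[of _ "pow (pow c)"]) (blast, simp only: mem_Collect_eq, intro dfn)
  then show ?thesis unfolding cartesian_def by (rule elts_vset)
qed

lemma opair_mem_cartesian [simp]: "mem (opair a b) (cartesian A B) \<longleftrightarrow> mem a A \<and> mem b B"
proof -
  have "opair a b \<in> elts (cartesian A B) \<longleftrightarrow> mem a A \<and> mem b B"
    unfolding elts_cartesian by auto
  then show ?thesis by simp
qed

text \<open>Outside the domain of \<^term>\<open>f\<close> the value \<^term>\<open>app f x\<close> is a choice operator
  applied to a class without a unique element, which need not be definable.\<close>

definition apply0 :: "'v \<Rightarrow> 'v \<Rightarrow> 'v" where
  "apply0 f x = (if \<exists>!y. opair x y \<in> elts f then app f x else vset {})"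

lemma dterm_apply0 [dfn]: "dterm s \<Longrightarrow> dterm t \<Longrightarrow> dterm (\<lambda>e. apply0 (s e) (t e))"
proof (rule dterm_fun2[where F = apply0])
  define U where "U f x \<longleftrightarrow> (\<exists>y. \<forall>z. mem (opair x z) f \<longleftrightarrow> z = y)" for f x
  have U: "(\<exists>!y. opair x y \<in> elts f) \<longleftrightarrow> U f x" for f x
    unfolding U_def by auto
  show "dterm (\<lambda>e. apply0 (e 0) (e 1))"
  proof (rule dtermI)
    show "y = apply0 (e 0) (e 1) \<longleftrightarrow>
        (U (e 0) (e 1) \<and> mem (opair (e 1) y) (e 0)) \<or> (\<not> U (e 0) (e 1) \<and> y = vset {})" for y e
    proof (cases "U (e 0) (e 1)")
      case True
      then have "\<exists>!y. opair (e 1) y \<in> elts (e 0)" using U by blast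
      then have "mem (opair (e 1) y) (e 0) \<longleftrightarrow> y = app (e 0) (e 1)"
        unfolding app_def by (metis (no_types, lifting) the1_equality mem_elts)
      then show ?thesis using True U unfolding apply0_def by simp
    next
      case False
      then show ?thesis using U unfolding apply0_def by simp
    qed
    show "dpred (\<lambda>e. (U (e (Suc 0)) (e (Suc 1)) \<and> mem (opair (e (Suc 1)) (e 0)) (e (Suc 0))) \<or>
        (\<not> U (e (Suc 0)) (e (Suc 1)) \<and> e 0 = vset {}))"
      unfolding U_def by (intro dfn)
  qed
qed

lemma function_ex1: "is_function f A B \<Longrightarrow> mem x A \<Longrightarrow> \<exists>!y. opair x y \<in> elts f"
  unfolding is_function_def by auto

lemma apply0_eq: "is_function f A B \<Longrightarrow> mem x A \<Longrightarrow> apply0 f x = app f x"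
  unfolding apply0_def using function_ex1 by auto

lemma function_graph: "is_function f A B \<Longrightarrow> mem x A \<Longrightarrow> mem (opair x y) f \<longleftrightarrow> y = app f x"
  unfolding app_def by (metis (no_types, lifting) function_ex1 the1_equality mem_elts)

lemma app_mem: "is_function f A B \<Longrightarrow> mem x A \<Longrightarrow> mem (app f x) B"
  using function_graph[of f A B x "app f x"] unfolding is_function_def
  by (metis mem_elts opair_mem_cartesian subsetD)

lemma function_elts: "is_function f A B \<Longrightarrow> elts f = {p. \<exists>x\<in>elts A. p = opair x (app f x)}"
  using function_graph[of f A B] unfolding is_function_def
  by (auto simp: subset_iff elts_cartesian)

lemma function_ext:
  assumes "is_function f A B" "is_function g A C" "\<And>x. mem x A \<Longrightarrow> app f x = app g x"
  shows "f = g"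
proof -
  have "elts f = elts g"
    using assms(3) unfolding function_elts[OF assms(1)] function_elts[OF assms(2)] by auto
  then show ?thesis by (rule extensionality)
qed

lemma elts_lam: "dterm (\<lambda>e. F (e 0)) \<Longrightarrow> elts (lam A F) = {p. \<exists>x\<in>elts A. p = opair x (F x)}"
  using elts_image[of "\<lambda>x. opair x (F x)" A] dterm_opair[OF dterm_var]
  unfolding lam_def image_def by auto

lemma lam_function:
  "dterm (\<lambda>e. F (e 0)) \<Longrightarrow> (\<And>x. mem x A \<Longrightarrow> mem (F x) B) \<Longrightarrow> is_function (lam A F) A B"
  unfolding is_function_def by (auto simp: elts_lam elts_cartesian)

lemma app_lam: "dterm (\<lambda>e. F (e 0)) \<Longrightarrow> mem x A \<Longrightarrow> app (lam A F) x = F x"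
  unfolding app_def by (rule the_equality) (use elts_lam[of F A] in auto)

lemma apply0_lam: "dterm (\<lambda>e. F (e 0)) \<Longrightarrow> mem x A \<Longrightarrow> apply0 (lam A F) x = F x"
  unfolding apply0_def using app_lam[of F x A] elts_lam[of F A] by auto

lemma dterm_lam [dfn]:
  assumes A: "dterm A" and F: "dterm (\<lambda>e. F (\<lambda>i. e (Suc i)) (e 0))"
  shows "dterm (\<lambda>e. lam (A e) (F e))"
proof -
  have F': "dterm (\<lambda>e'. F e (e' 0))" for e
  proof -
    have "dpred (\<lambda>e. e 0 = F (\<lambda>i. e (Suc (Suc i))) (e 1))"
      using F by (simp add: dterm_def)
    then have "dpred (\<lambda>e'. e' 0 = F e (e' 1))"
      using dpred_substitute[of "\<lambda>e. e 0 = F (\<lambda>i. e (Suc (Suc i))) (e 1)"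
        "case_nat (Inr 0) (case_nat (Inr 1) (\<lambda>i. Inl (e i)))"]
      by (simp add: fill_def)
    then show ?thesis by (simp add: dterm_def)
  qed
  show ?thesis unfolding lam_def
  proof (rule dterm_vset)
    show "\<exists>c. elts c = {p. \<exists>x\<in>elts (A e). p = opair x (F e x)}" for e
      using elts_lam[OF F'] by blast
    have "dterm (\<lambda>e. F (\<lambda>i. e (Suc (Suc i))) (e 0))"
      using dterm_shift[OF F, of "case_nat 0 (\<lambda>i. Suc (Suc i))"] by simp
    then show "dpred (\<lambda>e. \<exists>x\<in>elts (A (\<lambda>i. e (Suc i))). e 0 = opair x (F (\<lambda>i. e (Suc i)) x))"
      by (intro dfn dterm_shift[OF A])
  qed
qed

end

section \<open>Natural numbers, recursion and countability in the model\<close>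

context ZF_universe
begin

abbreviation (input) zero :: 'v where "zero \<equiv> vset {}"

definition succ :: "'v \<Rightarrow> 'v" where
  "succ n = vset (insert n (elts n))"

lemma elts_succ: "elts (succ n) = insert n (elts n)"
  by (simp add: succ_def)

lemma mem_succ [simp]: "mem m (succ n) \<longleftrightarrow> m = n \<or> mem m n"
  using elts_succ[of n] mem_elts by blast

lemma dterm_succ [dfn]: "dterm t \<Longrightarrow> dterm (\<lambda>e. succ (t e))"
  unfolding succ_def by (intro dfn)

lemma is_inductive_iff: "is_inductive I \<longleftrightarrow> mem zero I \<and> (\<forall>n\<in>elts I. mem (succ n) I)"
  by (simp add: is_inductive_def succ_def)

lemma elts_omega: "elts omega = {n. \<forall>I. is_inductive I \<longrightarrow> n \<in> elts I}"
proof -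
  obtain w z where w: "z \<in> elts w" "elts z = {}" "\<forall>n\<in>elts w. \<exists>s\<in>elts w. elts s = insert n (elts n)"
    using infinity by blast
  then have "is_inductive w"
    unfolding is_inductive_def by (metis elts_insert elts_empty elts_inject)
  moreover have "dpred (\<lambda>e. \<forall>I. is_inductive I \<longrightarrow> e 0 \<in> elts I)"
    unfolding is_inductive_iff by (intro dfn)
  ultimately have "\<exists>c. elts c = {n. \<forall>I. is_inductive I \<longrightarrow> n \<in> elts I}"
    by (intro ex_subclass[of _ w]) auto
  then show ?thesis unfolding omega_def by (rule elts_vset)
qed

lemma mem_omega: "mem n omega \<longleftrightarrow> (\<forall>I. is_inductive I \<longrightarrow> mem n I)"
proof -
  have "n \<in> elts omega \<longleftrightarrow> (\<forall>I. is_inductive I \<longrightarrow> n \<in> elts I)"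
    unfolding elts_omega by simp
  then show ?thesis by simp
qed

lemma zero_omega [simp]: "mem zero omega"
  by (simp add: mem_omega is_inductive_iff)

lemma succ_omega [simp]: "mem n omega \<Longrightarrow> mem (succ n) omega"
  by (simp add: mem_omega is_inductive_iff)

text \<open>Induction is available only for definable predicates: the natural numbers of the model may be
  nonstandard, and seen from outside \<^term>\<open>omega\<close> may then have proper inductive subclasses.\<close>

lemma omega_induct [consumes 1, case_names definable zero succ]:
  assumes "mem n omega" "dpred (\<lambda>e. P (e 0))"
    and "P zero" "\<And>n. mem n omega \<Longrightarrow> P n \<Longrightarrow> P (succ n)"
  shows "P n"
proof -
  have "is_inductive (sep omega P)"
    using assms(3,4) by (auto simp: is_inductive_iff mem_sep[OF assms(2)])
  then show ?thesis
    using assms(1) mem_omega mem_sep[OF assms(2)] by blast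
qed

lemma omega_elts_subset: "mem n omega \<Longrightarrow> elts n \<subseteq> elts omega"
proof (induction n rule: omega_induct)
  show "dpred (\<lambda>e. elts (e 0) \<subseteq> elts omega)" by (intro dfn)
qed (auto simp: elts_succ)

lemma omega_transitive:
  assumes "mem n omega" "mem m n" "mem k m"
  shows "mem k n"
proof -
  have "\<forall>m\<in>elts n. elts m \<subseteq> elts n"
    using assms(1)
  proof (induction n rule: omega_induct)
    show "dpred (\<lambda>e. \<forall>m\<in>elts (e 0). elts m \<subseteq> elts (e 0))" by (intro dfn)
  qed (auto simp: elts_succ)
  then show ?thesis using assms by (auto simp: subset_iff)
qed

lemma not_mem_self: "\<not> mem x x"
  using foundation[of "vset {x}"] by auto

lemma succ_inject:
  assumes "mem m omega" "mem n omega"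
  shows "succ m = succ n \<longleftrightarrow> m = n"
  by (metis assms mem_succ not_mem_self omega_transitive)

lemma succ_not_zero: "succ n \<noteq> zero"
  by (metis mem_succ not_mem_empty)

lemma omega_linear:
  assumes "mem m omega" "mem n omega"
  shows "mem m n \<or> m = n \<or> mem n m"
proof -
  have zero_least: "zero = m \<or> mem zero m" if "mem m omega" for m
    using that
  proof (induction m rule: omega_induct)
    show "dpred (\<lambda>e. zero = e 0 \<or> mem zero (e 0))" by (intro dfn)
  qed auto
  have suc: "\<forall>k\<in>elts m. mem (succ k) (succ m)" if "mem m omega" for m
    using that
  proof (induction m rule: omega_induct)
    show "dpred (\<lambda>e. \<forall>k\<in>elts (e 0). mem (succ k) (succ (e 0)))" by (intro dfn)
  qed auto
  have "\<forall>m\<in>elts omega. mem m n \<or> m = n \<or> mem n m"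
    using assms(2)
  proof (induction n rule: omega_induct)
    show "dpred (\<lambda>e. \<forall>m\<in>elts omega. mem m (e 0) \<or> m = e 0 \<or> mem (e 0) m)" by (intro dfn)
  next
    case zero
    then show ?case by (metis mem_elts zero_least)
  next
    case (succ n)
    show ?case
    proof
      fix m assume m: "m \<in> elts omega"
      then consider "mem m n" | "m = n" | "mem n m" using succ(2) by blast
      then show "mem m (succ n) \<or> m = succ n \<or> mem (succ n) m"
      proof cases
        case 3
        then have "mem (succ n) (succ m)" using suc[of m] m by simp
        then show ?thesis by auto
      qed auto
    qed
  qed
  then show ?thesis using assms by simp
qed

text \<open>Membership is the order of \<^term>\<open>omega\<close>, so Foundation provides least elements.\<close>

lemma omega_least:
  assumes "dpred (\<lambda>e. P (e 0))" "mem n omega" "P n"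
  obtains m where "mem m omega" "P m" "\<And>k. mem k m \<Longrightarrow> \<not> P k"
proof -
  have "elts (sep omega P) \<noteq> {}"
    using assms(2,3) unfolding elts_sep[OF assms(1)] by auto
  from foundation[OF this] obtain m where
    m: "m \<in> elts (sep omega P)" "elts m \<inter> elts (sep omega P) = {}" by blast
  then have m': "mem m omega" "P m" unfolding elts_sep[OF assms(1)] by auto
  moreover have "\<not> P k" if "mem k m" for k
    using m(2) that omega_elts_subset[OF m'(1)] unfolding elts_sep[OF assms(1)]
    by (auto simp: set_eq_iff subset_iff)
  ultimately show ?thesis using that by blast
qed

text \<open>The function is the least set of pairs that contains the initial pair and is closed under the
  step. Its values are unique because the pairs that are initial or arise from an earlier pair by a step
  form such a set again.\<close>

lemma omega_recursion:
  assumes a: "mem a A" and G: "dterm (\<lambda>e. G (e 0))" "\<And>x. mem x A \<Longrightarrow> mem (G x) A"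
  obtains F where "is_function F omega A" "app F zero = a"
    "\<And>n. mem n omega \<Longrightarrow> app F (succ n) = G (app F n)"
proof -
  note G' [dfn] = dterm_fun1[of G, OF G(1)]
  define closed where "closed S \<longleftrightarrow> mem (opair zero a) S \<and>
    (\<forall>n\<in>elts omega. \<forall>x\<in>elts A. mem (opair n x) S \<longrightarrow> mem (opair (succ n) (G x)) S)" for S
  define W where "W = sep (cartesian omega A) (\<lambda>p. \<forall>S. closed S \<longrightarrow> mem p S)"
  have dW: "dpred (\<lambda>e. \<forall>S. closed S \<longrightarrow> mem (e 0) S)"
    unfolding closed_def by (intro dfn)
  have mem_W: "mem (opair n x) W \<longleftrightarrow> mem n omega \<and> mem x A \<and> (\<forall>S. closed S \<longrightarrow> mem (opair n x) S)" for n x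
    unfolding W_def mem_sep[OF dW] by simp
  have W0: "mem (opair zero a) W"
    unfolding mem_W using a by (auto simp: closed_def)
  have WS: "mem (opair (succ n) (G x)) W" if "mem (opair n x) W" for n x
    using that G(2) unfolding mem_W by (auto simp: closed_def)
  define Q where "Q p \<longleftrightarrow> p = opair zero a \<or>
    (\<exists>n\<in>elts omega. \<exists>x\<in>elts A. mem (opair n x) W \<and> p = opair (succ n) (G x))" for p
  have dQ: "dpred (\<lambda>e. Q (e 0))"
    unfolding Q_def by (intro dfn)
  note memSW = mem_sep[OF dQ]
  have "closed (sep W Q)"
    unfolding closed_def memSW using W0 WS by (auto simp: Q_def)
  then have inv: "Q (opair n x)" if "mem (opair n x) W" for n x
    using that memSW mem_W by blast
  have ex1: "\<exists>x. \<forall>y. mem (opair n y) W \<longleftrightarrow> y = x" if "mem n omega" for n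
    using that
  proof (induction n rule: omega_induct)
    show "dpred (\<lambda>e. \<exists>x. \<forall>y. mem (opair (e 0) y) W \<longleftrightarrow> y = x)" by (intro dfn)
  next
    case zero
    have "y = a" if "mem (opair zero y) W" for y
      using inv[OF that] succ_not_zero unfolding Q_def by (metis opair_inject)
    then show ?case using W0 by blast
  next
    case (succ n)
    then obtain x where x: "\<And>y. mem (opair n y) W \<longleftrightarrow> y = x" by blast
    have "y = G x" if "mem (opair (succ n) y) W" for y
      using inv[OF that] succ_not_zero x succ_inject succ(1) unfolding Q_def
      by (metis opair_inject mem_elts)
    then show ?case using WS x by blast
  qed
  have fn: "is_function W omega A"
  proof -
    have "elts W \<subseteq> elts (cartesian omega A)"
      unfolding W_def elts_sep[OF dW] by blast
    then show ?thesis unfolding is_function_def using ex1 by (metis mem_elts)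
  qed
  then show ?thesis
  proof (rule that)
    show "app W zero = a" using function_graph[OF fn, of zero a] W0 by simp
    show "app W (succ n) = G (app W n)" if "mem n omega" for n
      using function_graph[OF fn, of "succ n" "G (app W n)"] WS
        function_graph[OF fn that, of "app W n"] that by simp
  qed
qed

text \<open>An injective map whose range misses the starting point never returns to a value: two equal
  iterates can be traced back simultaneously until one of them is the starting point.\<close>

lemma orbit_injective:
  assumes F: "is_function F omega A" "\<And>n. mem n omega \<Longrightarrow> app F (succ n) = G (app F n)"
    and G: "\<And>x. mem x A \<Longrightarrow> G x \<noteq> app F zero"
      "\<And>x y. mem x A \<Longrightarrow> mem y A \<Longrightarrow> G x = G y \<Longrightarrow> x = y"
    and mn: "mem m omega" "mem n omega" "app F m = app F n"
  shows "m = n"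
proof -
  have cases: "n = zero \<or> (\<exists>k\<in>elts omega. n = succ k)" if "mem n omega" for n
    using that
  proof (induction n rule: omega_induct)
    show "dpred (\<lambda>e. e 0 = zero \<or> (\<exists>k\<in>elts omega. e 0 = succ k))" by (intro dfn)
  qed auto
  have "\<forall>n\<in>elts omega. apply0 F m = apply0 F n \<longrightarrow> m = n"
    using mn(1)
  proof (induction m rule: omega_induct)
    show "dpred (\<lambda>e. \<forall>n\<in>elts omega. apply0 F (e 0) = apply0 F n \<longrightarrow> e 0 = n)" by (intro dfn)
  next
    case zero
    show ?case
    proof (intro ballI impI)
      fix n assume n: "n \<in> elts omega" "apply0 F zero = apply0 F n"
      then have "app F zero = app F n"
        using apply0_eq[OF F(1)] by simp
      then show "zero = n"
        using cases[of n] n F(2) G(1) app_mem[OF F(1)] by (metis mem_elts)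
    qed
  next
    case (succ m)
    show ?case
    proof (intro ballI impI)
      fix n assume n: "n \<in> elts omega" "apply0 F (succ m) = apply0 F n"
      then have eq: "G (app F m) = app F n"
        using apply0_eq[OF F(1)] F(2) succ(1) by simp
      then obtain k where k: "mem k omega" "n = succ k"
        using cases[of n] n G(1) app_mem[OF F(1)] succ(1) by (metis mem_elts)
      then have "app F m = app F k"
        using eq F(2) G(2) app_mem[OF F(1)] succ(1) by metis
      then have "m = k"
        using succ(1,2) k(1) apply0_eq[OF F(1)] by (metis mem_elts)
      then show "succ m = n"
        using k(2) by simp
    qed
  qed
  then show ?thesis using mn apply0_eq[OF F(1)] by auto
qed

text \<open>The values are taken with \<^const>\<open>apply0\<close>, which makes the property definable in all three arguments.\<close>

definition injects :: "'v \<Rightarrow> 'v \<Rightarrow> 'v \<Rightarrow> bool" where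
  "injects g A B \<longleftrightarrow> (\<forall>a\<in>elts A. apply0 g a \<in> elts B) \<and>
     (\<forall>a\<in>elts A. \<forall>b\<in>elts A. apply0 g a = apply0 g b \<longrightarrow> a = b)"

lemma dpred_injects [dfn]:
  assumes "dterm s" "dterm t" "dterm u"
  shows "dpred (\<lambda>e. injects (s e) (t e) (u e))"
  unfolding injects_def
  by (intro dfn assms dterm_shift[OF assms(1)] dterm_shift[OF assms(2)] dterm_shift[OF assms(3)]
     )

lemma bijection_injects: "is_bijection g A B \<Longrightarrow> injects g A B"
  unfolding is_bijection_def injects_def using apply0_eq[of g A B] app_mem[of g A B]
  by (auto simp: bij_betw_def inj_on_def)

lemma countable_set_iff: "countable_set A \<longleftrightarrow> (\<exists>g. injects g A omega)"
proof
  assume "countable_set A"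
  then obtain B g where "elts B \<subseteq> elts omega" "is_bijection g A B"
    unfolding countable_set_def equipotent_def by blast
  then show "\<exists>g. injects g A omega"
    using bijection_injects[of g A B] unfolding injects_def by blast
next
  assume "\<exists>g. injects g A omega"
  then obtain g where g: "injects g A omega" by blast
  have d: "dterm (\<lambda>e. apply0 g (e 0))" by (intro dfn)
  define B where "B = vset (apply0 g ` elts A)"
  have B: "elts B = apply0 g ` elts A"
    unfolding B_def by (rule elts_image[OF d])
  have "is_function (lam A (apply0 g)) A B"
    by (rule lam_function[OF d]) (use B mem_elts in blast)
  moreover have "bij_betw (app (lam A (apply0 g))) (elts A) (elts B)"
    unfolding bij_betw_def inj_on_def B using g app_lam[OF d] by (auto simp: injects_def)
  ultimately have "equipotent A B"
    unfolding equipotent_def is_bijection_def by blast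
  moreover have "elts B \<subseteq> elts omega" using g unfolding B injects_def by auto
  ultimately show "countable_set A" unfolding countable_set_def by blast
qed

text \<open>Each element of the image is sent to its least index.\<close>

lemma countable_image_omega:
  assumes F: "dterm (\<lambda>e. F (e 0))"
  shows "countable_set (vset (F ` elts omega))"
proof -
  note F' [dfn] = dterm_fun1[of F, OF F]
  let ?A = "vset (F ` elts omega)"
  define L where "L a n \<longleftrightarrow> mem n omega \<and> F n = a \<and> (\<forall>k\<in>elts n. F k \<noteq> a)" for a n
  have A: "elts ?A = F ` elts omega" by (rule elts_image[OF F])
  have ex: "\<exists>n. L a n" if "a \<in> elts ?A" for a
  proof -
    obtain m where m: "mem m omega" "F m = a"
      using \<open>a \<in> elts ?A\<close> unfolding A by (metis imageE mem_elts)
    have "dpred (\<lambda>e. F (e 0) = a)" by (intro dfn)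
    from omega_least[of "\<lambda>n. F n = a", OF this m] show ?thesis
      unfolding L_def by (metis mem_elts)
  qed
  have uniq: "n = n'" if "L a n" "L a n'" for a n n'
    using that omega_linear[of n n'] unfolding L_def by auto
  define g where "g = sep (cartesian ?A omega) (\<lambda>p. \<exists>a\<in>elts ?A. \<exists>n\<in>elts omega. p = opair a n \<and> L a n)"
  have "elts g = {p \<in> elts (cartesian ?A omega). \<exists>a\<in>elts ?A. \<exists>n\<in>elts omega. p = opair a n \<and> L a n}"
    unfolding g_def L_def by (rule elts_sep) (intro dfn)
  then have g: "mem (opair a n) g \<longleftrightarrow> mem a ?A \<and> L a n" for a n
    using mem_elts[of "opair a n" g] unfolding L_def by auto
  have "is_function g ?A omega"
    unfolding is_function_def
  proof (intro conjI ballI)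
    show "elts g \<subseteq> elts (cartesian ?A omega)"
      unfolding g_def L_def by (subst elts_sep, intro dfn) auto
    show "\<exists>!y. opair x y \<in> elts g" if "x \<in> elts ?A" for x
      using ex[OF that] uniq g that by auto
  qed
  then have "L a (apply0 g a)" if "mem a ?A" for a
    using function_graph[of g ?A omega a "apply0 g a"] apply0_eq[of g ?A omega a] g that by auto
  then have "injects g ?A omega"
    unfolding injects_def L_def by (metis mem_elts)
  then show ?thesis unfolding countable_set_iff by blast
qed

lemma dpred_is_function: "dpred (\<lambda>e. is_function (e 0) A B)"
proof -
  have "is_function f A B \<longleftrightarrow>
     elts f \<subseteq> elts (cartesian A B) \<and> (\<forall>x\<in>elts A. \<exists>y. \<forall>z. mem (opair x z) f \<longleftrightarrow> z = y)" for f
  proof -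
    have "(\<exists>!y. opair x y \<in> elts f) \<longleftrightarrow> (\<exists>y. \<forall>z. mem (opair x z) f \<longleftrightarrow> z = y)" for x
      by (simp add: Ex1_def) blast
    then show ?thesis unfolding is_function_def by simp
  qed
  then show ?thesis by (simp only:) (intro dfn)
qed

lemma finite_set_injects: "finite_set A \<Longrightarrow> \<exists>n\<in>elts omega. \<exists>g. injects g A n"
  unfolding finite_set_def equipotent_def using bijection_injects by blast

end

section \<open>The real numbers of the model as a linearly ordered field\<close>

text \<open>The ordered field of the model is presented by a type \<^typ>\<open>'k\<close> of class
  \<^class>\<open>linordered_field\<close>, so that its arithmetic can be done with the arithmetic of that class.
  The bijection \<^term>\<open>rep\<close> carries no completeness: suprema exist only for definable classes of
  elements of \<^typ>\<open>'k\<close>.\<close>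

locale real_model = ZF_universe mem for mem :: "'v \<Rightarrow> 'v \<Rightarrow> bool" +
  fixes R :: "'v real_structure" and rep :: "'k::linordered_field \<Rightarrow> 'v"
  assumes R: "complete_ordered_field R"
    and rep_bij: "bij_betw rep UNIV (elts (rcarrier R))"
    and rep_add: "rep (a + b) = app (rplus R) (opair (rep a) (rep b))"
    and rep_mult: "rep (a * b) = app (rtimes R) (opair (rep a) (rep b))"
    and rep_zero: "rep 0 = rzero R"
    and rep_one: "rep 1 = rone R"
    and rep_le: "leq R (rep a) (rep b) \<longleftrightarrow> a \<le> b"
begin

text \<open>The value outside the carrier makes the inverse of \<^term>\<open>rep\<close> total and definable.\<close>

definition rl :: "'v \<Rightarrow> 'k" where
  "rl v = (if mem v (rcarrier R) then inv_into UNIV rep v else 0)"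

lemma rep_inject [simp]: "rep a = rep b \<longleftrightarrow> a = b"
  using rep_bij by (auto simp: bij_betw_def inj_on_def)

lemma rep_mem [simp]: "mem (rep a) (rcarrier R)"
  using rep_bij by (auto simp: bij_betw_def)

lemma rl_rep [simp]: "rl (rep a) = a"
  unfolding rl_def by (simp add: inj_def)

lemma ex_rep: "mem v (rcarrier R) \<Longrightarrow> \<exists>a. v = rep a"
  using rep_bij by (auto simp: bij_betw_def image_iff set_eq_iff)

lemma rep_rl [simp]: "mem v (rcarrier R) \<Longrightarrow> rep (rl v) = v"
  using ex_rep by fastforce

lemma rep_rl_If: "rep (rl v) = (if mem v (rcarrier R) then v else rep 0)"
  by (simp add: rl_def[of v] split: if_splits) (metis rep_rl rl_def)

lemma carrier_real_ring [simp]: "carrier (real_ring R) = elts (rcarrier R)"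
  by (simp add: real_ring_def)

lemma real_ring_add [simp]: "rep a \<oplus>\<^bsub>real_ring R\<^esub> rep b = rep (a + b)"
  by (simp add: real_ring_def rep_add)

lemma real_ring_mult [simp]: "rep a \<otimes>\<^bsub>real_ring R\<^esub> rep b = rep (a * b)"
  by (simp add: real_ring_def rep_mult)

lemma real_ring_field: "field (real_ring R)"
  using R unfolding complete_ordered_field_def by blast

lemma real_ring_a_inv [simp]: "\<ominus>\<^bsub>real_ring R\<^esub> rep a = rep (- a)"
proof -
  interpret field "real_ring R" by (rule real_ring_field)
  have "rep (- a) \<oplus>\<^bsub>real_ring R\<^esub> rep a = \<zero>\<^bsub>real_ring R\<^esub>"
    by (simp only: real_ring_add) (simp add: real_ring_def rep_zero)
  then show ?thesis by (intro minus_equality) simp_all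
qed

lemma real_ring_minus [simp]: "rep a \<ominus>\<^bsub>real_ring R\<^esub> rep b = rep (a - b)"
  by (simp add: a_minus_def)

lemma rabs_rep [simp]: "rabs R (rep a) = rep \<bar>a\<bar>"
  unfolding rabs_def by (simp add: rep_zero[symmetric] rep_le abs_if)

lemma less_rep [simp]: "less R (rep a) (rep b) \<longleftrightarrow> a < b"
  by (auto simp: less_def rep_le)

subsection \<open>Definability of real expressions\<close>

lemma dpred_All_real [dfn]:
  assumes "dpred (\<lambda>e. P (\<lambda>i. e (Suc i)) (rl (e 0)))"
  shows "dpred (\<lambda>e. \<forall>a. P e a)"
proof -
  have "(\<forall>a. P e a) \<longleftrightarrow> (\<forall>x. P e (rl x))" for e
    by (metis rl_rep)
  then show ?thesis using dpred_All[of "\<lambda>e x. P e (rl x)", OF assms] by simp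
qed

lemma dpred_Ex_real [dfn]:
  assumes "dpred (\<lambda>e. P (\<lambda>i. e (Suc i)) (rl (e 0)))"
  shows "dpred (\<lambda>e. \<exists>a. P e a)"
  using dpred_not[OF dpred_All_real[of "\<lambda>e a. \<not> P e a", OF dpred_not[OF assms]]] by simp

lemma dterm_rl [dfn]: "dterm t \<Longrightarrow> dterm (\<lambda>e. rep (rl (t e)))"
  unfolding rep_rl_If by (intro dfn)

lemma dpred_real_eq [dfn]:
  "dterm (\<lambda>e. rep (u e)) \<Longrightarrow> dterm (\<lambda>e. rep (v e)) \<Longrightarrow> dpred (\<lambda>e. u e = v e)"
  using dpred_eq[of "\<lambda>e. rep (u e)" "\<lambda>e. rep (v e)"] by simp

lemma dpred_real_le [dfn]:
  assumes "dterm (\<lambda>e. rep (u e))" "dterm (\<lambda>e. rep (v e))"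
  shows "dpred (\<lambda>e. u e \<le> v e)"
  unfolding rep_le[symmetric] leq_def by (intro dfn assms)

lemma dpred_real_less [dfn]:
  assumes "dterm (\<lambda>e. rep (u e))" "dterm (\<lambda>e. rep (v e))"
  shows "dpred (\<lambda>e. u e < v e)"
  unfolding not_le[symmetric] by (intro dfn assms)

text \<open>Operations that are not part of the structure, like subtraction and division, are definable
  through the equations that determine their results.\<close>

lemma dterm_real_graph:
  assumes "dpred (\<lambda>e. Q (rl (e 0)) (\<lambda>i. e (Suc i)))" "\<And>a e. a = u e \<longleftrightarrow> Q a e"
  shows "dterm (\<lambda>e. rep (u e))"
proof (rule dtermI)
  show "dpred (\<lambda>e. mem (e 0) (rcarrier R) \<and> Q (rl (e 0)) (\<lambda>i. e (Suc i)))"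
    by (intro dfn assms)
  show "y = rep (u e) \<longleftrightarrow> mem y (rcarrier R) \<and> Q (rl y) e" for y e
    unfolding assms(2)[symmetric] by (metis rep_mem rep_rl rl_rep)
qed

lemma dterm_real_add [dfn]:
  assumes "dterm (\<lambda>e. rep (u e))" "dterm (\<lambda>e. rep (v e))"
  shows "dterm (\<lambda>e. rep (u e + v e))"
proof -
  have f: "is_function (rplus R) (cartesian (rcarrier R) (rcarrier R)) (rcarrier R)"
    using R unfolding complete_ordered_field_def by blast
  show ?thesis unfolding rep_add apply0_eq[OF f, of "opair (rep a) (rep b)" for a b, simplified, symmetric]
    by (intro dfn assms)
qed

lemma dterm_real_mult [dfn]:
  assumes "dterm (\<lambda>e. rep (u e))" "dterm (\<lambda>e. rep (v e))"
  shows "dterm (\<lambda>e. rep (u e * v e))"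
proof -
  have f: "is_function (rtimes R) (cartesian (rcarrier R) (rcarrier R)) (rcarrier R)"
    using R unfolding complete_ordered_field_def by blast
  show ?thesis unfolding rep_mult apply0_eq[OF f, of "opair (rep a) (rep b)" for a b, simplified, symmetric]
    by (intro dfn assms)
qed

lemma dterm_real_minus [dfn]:
  assumes "dterm (\<lambda>e. rep (u e))" "dterm (\<lambda>e. rep (v e))"
  shows "dterm (\<lambda>e. rep (u e - v e))"
  by (rule dterm_real_graph[where Q = "\<lambda>a e. a + v e = u e"])
    (intro dfn dterm_shift[OF assms(1)] dterm_shift[OF assms(2)], auto simp: algebra_simps)

lemma dterm_real_uminus [dfn]:
  assumes "dterm (\<lambda>e. rep (u e))"
  shows "dterm (\<lambda>e. rep (- u e))"
  unfolding diff_0[symmetric] by (intro dfn assms)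

lemma dterm_real_divide [dfn]:
  assumes "dterm (\<lambda>e. rep (u e))" "dterm (\<lambda>e. rep (v e))"
  shows "dterm (\<lambda>e. rep (u e / v e))"
  by (rule dterm_real_graph[where Q = "\<lambda>a e. (v e = 0 \<and> a = 0) \<or> (v e \<noteq> 0 \<and> a * v e = u e)"])
    (intro dfn dterm_shift[OF assms(1)] dterm_shift[OF assms(2)], metis divide_eq_0_iff nonzero_eq_divide_eq)

lemma dterm_real_If [dfn]:
  assumes "dpred P" "dterm (\<lambda>e. rep (u e))" "dterm (\<lambda>e. rep (v e))"
  shows "dterm (\<lambda>e. rep (if P e then u e else v e))"
  unfolding if_distrib[of rep] by (intro dfn assms)

lemma dterm_real_max [dfn]:
  assumes "dterm (\<lambda>e. rep (u e))" "dterm (\<lambda>e. rep (v e))"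
  shows "dterm (\<lambda>e. rep (max (u e) (v e)))"
  unfolding max_def by (intro dfn assms)

lemma dterm_real_min [dfn]:
  assumes "dterm (\<lambda>e. rep (u e))" "dterm (\<lambda>e. rep (v e))"
  shows "dterm (\<lambda>e. rep (min (u e) (v e)))"
  unfolding min_def by (intro dfn assms)

lemma dterm_real_abs [dfn]:
  assumes "dterm (\<lambda>e. rep (u e))"
  shows "dterm (\<lambda>e. rep \<bar>u e\<bar>)"
  unfolding abs_if by (intro dfn assms)

definition val :: "'v \<Rightarrow> 'v \<Rightarrow> 'k" where
  "val f x = rl (apply0 f x)"

lemma dterm_val [dfn]: "dterm s \<Longrightarrow> dterm t \<Longrightarrow> dterm (\<lambda>e. rep (val (s e) (t e)))"
  unfolding val_def by (intro dfn)

lemma rep_val: "is_function f A (rcarrier R) \<Longrightarrow> mem x A \<Longrightarrow> rep (val f x) = app f x"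
  unfolding val_def by (simp add: apply0_eq app_mem)

lemma val_lam: "dterm (\<lambda>e. rep (F (e 0))) \<Longrightarrow> mem x A \<Longrightarrow> val (lam A (\<lambda>x. rep (F x))) x = F x"
  unfolding val_def by (simp add: apply0_lam)

lemma lam_val:
  assumes "is_function f A (rcarrier R)"
  shows "lam A (\<lambda>x. rep (val f x)) = f"
proof -
  have d: "dterm (\<lambda>e. rep (val f (e 0)))" by (intro dfn)
  show ?thesis
  proof (rule function_ext[OF _ assms])
    show "is_function (lam A (\<lambda>x. rep (val f x))) A (rcarrier R)"
      by (rule lam_function[OF d]) simp
    show "app (lam A (\<lambda>x. rep (val f x))) x = app f x" if "mem x A" for x
      using app_lam[OF d that] rep_val[OF assms that] by simp
  qed
qed

subsection \<open>Consequences of completeness\<close>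

lemma real_sup:
  assumes P: "dpred (\<lambda>e. P (rl (e 0)))" and ne: "P a" and bd: "\<And>x. P x \<Longrightarrow> x \<le> b"
  obtains s where "\<And>x. P x \<Longrightarrow> x \<le> s" "\<And>c. (\<And>x. P x \<Longrightarrow> x \<le> c) \<Longrightarrow> s \<le> c"
proof -
  define S where "S = sep (rcarrier R) (\<lambda>v. P (rl v))"
  have S: "elts S = {v \<in> elts (rcarrier R). P (rl v)}"
    unfolding S_def by (rule elts_sep[OF P])
  have ub: "is_upper_bound R (elts S) (rep c) \<longleftrightarrow> (\<forall>x. P x \<longrightarrow> x \<le> c)" for c
    unfolding is_upper_bound_def S by (auto simp: rep_le[symmetric])
  have "rep a \<in> elts S" using ne unfolding S by simp
  moreover have "elts S \<subseteq> elts (rcarrier R)" unfolding S by blast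
  moreover have "is_upper_bound R (elts S) (rep b)" using bd unfolding ub by blast
  ultimately obtain t where t: "is_sup R (elts S) t"
    using R unfolding complete_ordered_field_def by (metis empty_iff)
  then have "mem t (rcarrier R)"
    unfolding is_sup_def is_upper_bound_def by simp
  then obtain s where s: "t = rep s" using ex_rep by blast
  show ?thesis
  proof (rule that[of s])
    show "x \<le> s" if "P x" for x
      using t that unfolding is_sup_def s ub by blast
    show "s \<le> c" if "\<And>x. P x \<Longrightarrow> x \<le> c" for c
      using t that unfolding is_sup_def s by (metis ub rep_le)
  qed
qed

text \<open>The root is the supremum of the nonnegative elements with square at most \<open>a\<close>; if the
  square of the supremum differed from \<open>a\<close>, the supremum could be increased or decreased a little.\<close>

lemma real_sqrt_exists:
  fixes a :: 'k
  assumes a: "0 \<le> a"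
  obtains s where "s * s = a"
proof -
  let ?P = "\<lambda>x. 0 \<le> x \<and> x * x \<le> a"
  have d: "dpred (\<lambda>e. ?P (rl (e 0)))" by (intro dfn)
  have mono: "x \<le> y" if "x * x \<le> y * y" "0 \<le> y" for x y :: 'k
    using that by (meson mult_strict_mono' not_le)
  have P0: "?P 0" using a by simp
  have bd: "x \<le> a + 1" if "?P x" for x
    by (rule mono) (use that a in \<open>auto simp: algebra_simps intro: order_trans[of _ a]\<close>)
  then obtain s where s: "\<And>x. ?P x \<Longrightarrow> x \<le> s" "\<And>c. (\<And>x. ?P x \<Longrightarrow> x \<le> c) \<Longrightarrow> s \<le> c"
    using real_sup[of ?P, OF d P0 bd] by blast
  have s0: "0 \<le> s" using s(1)[of 0] a by simp
  have "\<not> s * s < a"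
  proof
    assume lt: "s * s < a"
    \<comment> \<open>For 0 < h <= 1 the square of s + h is at most s * s + h * (2 * s + 1).\<close>
    define h where "h = min 1 ((a - s * s) / (2 * s + 1))"
    have "h \<le> (a - s * s) / (2 * s + 1)" by (simp add: h_def)
    then have "h * (2 * s + 1) \<le> a - s * s"
      using s0 by (simp add: pos_le_divide_eq)
    moreover have "0 < h" "h \<le> 1"
      using lt s0 by (auto simp: h_def)
    ultimately have h: "0 < h" "h \<le> 1" "h * (2 * s + 1) \<le> a - s * s" by blast+
    have "h * h \<le> h" using h by (simp add: mult_left_le)
    then have "(s + h) * (s + h) \<le> a"
      using h(3) by (simp add: algebra_simps)
    then show False using s(1)[of "s + h"] h(1) s0 by simp
  qed
  moreover have "\<not> a < s * s"
  proof
    assume gt: "a < s * s"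
    then have s1: "0 < s" using s0 a by (cases "s = 0") auto
    \<comment> \<open>This is the Newton step from s towards the root.\<close>
    define h where "h = (s * s - a) / (2 * s)"
    have h: "0 < h" "2 * (h * s) = s * s - a"
      using gt s1 by (auto simp: h_def field_simps)
    have "h \<le> s" using s1 a h(1) by (simp add: h_def field_simps)
    have "a \<le> (s - h) * (s - h)"
      using h by (simp add: algebra_simps)
    then have "x \<le> s - h" if "?P x" for x
      using that \<open>h \<le> s\<close> order_trans mono[of x "s - h"] by auto
    then have "s \<le> s - h" by (rule s(2))
    then show False using h(1) by simp
  qed
  ultimately have "s * s = a" by simp
  then show ?thesis by (rule that)
qed

text \<open>Nonnegative elements are squares, so the endomorphism is monotone. Its fixed elements form a
  subfield. By completeness this subfield is unbounded and hence dense: an element \<open>c\<close> with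
  \<open>c < \<sigma> c\<close> would have a fixed element \<open>r\<close> between \<open>c\<close> and \<open>\<sigma> c\<close>, and monotonicity gives
  \<open>\<sigma> c \<le> \<sigma> r = r\<close>. Natural numbers are avoided because \<^typ>\<open>'k\<close> may fail to be Archimedean when
  seen from outside the model.\<close>

lemma real_endomorphism_id:
  fixes \<sigma> :: "'k \<Rightarrow> 'k"
  assumes d: "dpred (\<lambda>e. \<sigma> (rl (e 0)) = rl (e 0))"
    and add: "\<And>x y. \<sigma> (x + y) = \<sigma> x + \<sigma> y" and mult: "\<And>x y. \<sigma> (x * y) = \<sigma> x * \<sigma> y"
    and one: "\<sigma> 1 = 1"
  shows "\<sigma> c = c"
proof -
  have zero: "\<sigma> 0 = 0" using add[of 0 0] by simp
  have neg: "\<sigma> (- x) = - \<sigma> x" for x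
    using add[of x "- x"] zero by (simp add: eq_neg_iff_add_eq_0 add.commute)
  have mono: "\<sigma> x \<le> \<sigma> y" if xy: "x \<le> y" for x y
  proof -
    obtain s where "s * s = y - x" using real_sqrt_exists[of "y - x"] xy by auto
    then have "\<sigma> y = \<sigma> x + \<sigma> s * \<sigma> s" by (metis add mult add.commute diff_add_cancel)
    then show ?thesis by simp
  qed
  have unbounded: "\<exists>f. \<sigma> f = f \<and> b < f" for b
  proof (rule ccontr)
    assume "\<not> ?thesis"
    then have "x \<le> b" if "\<sigma> x = x" for x using that by (meson not_le)
    then obtain s where s: "\<And>x. \<sigma> x = x \<Longrightarrow> x \<le> s" "\<And>c. (\<And>x. \<sigma> x = x \<Longrightarrow> x \<le> c) \<Longrightarrow> s \<le> c"
      using real_sup[of "\<lambda>x. \<sigma> x = x", OF d, of 0] zero by metis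
    have "\<not> s \<le> s - 1" by simp
    then obtain x where "\<sigma> x = x" "s - 1 < x"
      using s(2)[of "s - 1"] by (meson not_le)
    then show False using s(1)[of "x + 1"] add one by simp
  qed
  have no: "\<not> c < \<sigma> c" for c
  proof
    assume lt: "c < \<sigma> c"
    obtain f where f: "\<sigma> f = f" "1 / (\<sigma> c - c) < f" using unbounded by blast
    have f0: "0 < f" using f(2) lt by (meson diff_gt_0_iff_gt divide_pos_pos less_trans zero_less_one)
    \<comment> \<open>Steps of the fixed length g cannot jump over the interval from c to \<sigma> c.\<close>
    define g where "g = 1 / f"
    have g: "\<sigma> g = g" "0 < g" "c + g < \<sigma> c"
    proof -
      have "\<sigma> g * f = 1" using mult[of g f] f f0 one by (simp add: g_def)
      then show "\<sigma> g = g" using f0 by (simp add: g_def field_simps)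
      show "0 < g" using f0 by (simp add: g_def)
      show "c + g < \<sigma> c" using f(2) f0 lt by (simp add: g_def field_simps)
    qed
    obtain f' where f': "\<sigma> f' = f'" "- c < f'" using unbounded by blast
    have d': "dpred (\<lambda>e. \<sigma> (rl (e 0)) = rl (e 0) \<and> rl (e 0) \<le> c)" by (intro dfn d)
    obtain s where s: "\<And>x. \<sigma> x = x \<and> x \<le> c \<Longrightarrow> x \<le> s"
        "\<And>b. (\<And>x. \<sigma> x = x \<and> x \<le> c \<Longrightarrow> x \<le> b) \<Longrightarrow> s \<le> b"
      using real_sup[of "\<lambda>x. \<sigma> x = x \<and> x \<le> c", OF d', of "- f'" c] f' neg by auto
    have "\<not> s \<le> s - g" using g by simp
    then obtain q where q: "\<sigma> q = q" "q \<le> c" "s - g < q"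
      using s(2)[of "s - g"] by (meson not_le)
    have fixed: "\<sigma> (q + g) = q + g" using q g add by simp
    then have "c < q + g" using s(1)[of "q + g"] q(3) by (meson less_diff_eq not_le diff_less_eq)
    then have "\<sigma> c \<le> q + g" using mono[of c "q + g"] fixed by simp
    then show False using q(2) g(3) by simp
  qed
  show ?thesis using no[of c] no[of "- c"] neg[of c] by simp
qed

text \<open>The orbit \<open>0, 1, -1, 2, -2, \<dots>\<close> of the map \<open>G\<close> below enumerates the integers of the model. Since
  \<open>G\<close> is injective and omits 0, no integer is repeated, and completeness shows that every real
  number is close to one of them.\<close>

lemma integer_sequence:
  obtains q :: "'v \<Rightarrow> 'k" where "dterm (\<lambda>e. rep (q (e 0)))"
    "\<And>m n. mem m omega \<Longrightarrow> mem n omega \<Longrightarrow> q m = q n \<Longrightarrow> m = n"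
    "\<And>r. \<exists>n\<in>elts omega. \<bar>r - q n\<bar> \<le> 1"
proof -
  define G where "G x = (if x \<le> 0 then 1 - x else - x)" for x :: 'k
  have dG: "dterm (\<lambda>e. rep (G (rl (e 0))))" unfolding G_def by (intro dfn)
  obtain F where F: "is_function F omega (rcarrier R)" "app F zero = rep 0"
    "\<And>n. mem n omega \<Longrightarrow> app F (succ n) = rep (G (rl (app F n)))"
    using omega_recursion[of "rep 0" "rcarrier R" "\<lambda>v. rep (G (rl v))", OF _ dG] by auto
  define q where "q = val F"
  have app_F: "app F n = rep (q n)" if "mem n omega" for n
    using rep_val[OF F(1) that] by (simp add: q_def)
  have q0: "q zero = 0" using F(2) app_F[of zero] by simp
  have qS: "q (succ n) = G (q n)" if "mem n omega" for n
    using F(3)[OF that] app_F[OF that] app_F[of "succ n"] that by simp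
  have dq [dfn]: "dterm t \<Longrightarrow> dterm (\<lambda>e. rep (q (t e)))" for t
    unfolding q_def by (intro dfn)
  define Q where "Q x \<longleftrightarrow> (\<exists>n\<in>elts omega. x = q n)" for x
  have dQ [dfn]: "dterm (\<lambda>e. rep (u e)) \<Longrightarrow> dpred (\<lambda>e. Q (u e))" for u
    unfolding Q_def by (intro dfn) (drule dterm_shift[of _ Suc], simp)
  have Q0: "Q 0" using q0 zero_omega unfolding Q_def by (metis mem_elts)
  have QG: "Q (G x)" if "Q x" for x
    using that qS succ_omega unfolding Q_def by (metis mem_elts)
  have Q1: "Q 1" using QG[OF Q0] by (simp add: G_def)
  have Qneg: "Q (- x)" if "Q x" "0 < x" for x
    using QG[OF that(1)] that(2) by (simp add: G_def)
  have Qadd: "Q (x + 1)" if "Q x" "0 \<le> x" for x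
  proof (cases "x = 0")
    case False
    then show ?thesis using QG[OF Qneg[OF that(1)]] that by (simp add: G_def add.commute)
  qed (use Q1 in simp)
  have dense0: "\<exists>x. Q x \<and> 0 \<le> x \<and> \<bar>r - x\<bar> \<le> 1" if r: "0 \<le> r" for r
  proof -
    have d: "dpred (\<lambda>e. Q (rl (e 0)) \<and> 0 \<le> rl (e 0) \<and> rl (e 0) \<le> r)" by (intro dfn)
    obtain s where s: "\<And>x. Q x \<and> 0 \<le> x \<and> x \<le> r \<Longrightarrow> x \<le> s"
        "\<And>b. (\<And>x. Q x \<and> 0 \<le> x \<and> x \<le> r \<Longrightarrow> x \<le> b) \<Longrightarrow> s \<le> b"
      using real_sup[of "\<lambda>x. Q x \<and> 0 \<le> x \<and> x \<le> r", OF d, of 0 r] Q0 r by auto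
    have "\<not> s \<le> s - 1" by simp
    then obtain x where x: "Q x" "0 \<le> x" "x \<le> r" "s - 1 < x"
      using s(2)[of "s - 1"] by (meson not_le)
    then have "\<not> x + 1 \<le> r" using s(1)[of "x + 1"] Qadd[of x] by (auto simp: algebra_simps)
    then show ?thesis using x by (intro exI[of _ x]) (auto simp: abs_if)
  qed
  have dense: "\<exists>x. Q x \<and> \<bar>r - x\<bar> \<le> 1" for r
  proof (cases "0 \<le> r")
    case True
    then show ?thesis using dense0 by blast
  next
    case False
    then obtain x where x: "Q x" "0 \<le> x" "\<bar>- r - x\<bar> \<le> 1" using dense0[of "- r"] by auto
    then have "Q (- x)" using Qneg[of x] by (cases "x = 0") auto
    moreover have "\<bar>r - (- x)\<bar> \<le> 1" using x(3) by (simp add: abs_if split: if_splits)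
    ultimately show ?thesis by blast
  qed
  show ?thesis
  proof (rule that[of q])
    show "dterm (\<lambda>e. rep (q (e 0)))" by (intro dfn)
    show "\<exists>n\<in>elts omega. \<bar>r - q n\<bar> \<le> 1" for r using dense[of r] unfolding Q_def by blast
    show "m = n" if "mem m omega" "mem n omega" "q m = q n" for m n
    proof (rule orbit_injective[OF F(1) F(3) _ _ that(1,2)])
      show "app F m = app F n" using that app_F by simp
      fix x y assume x: "mem x (rcarrier R)"
      show "rep (G (rl x)) \<noteq> app F zero" unfolding F(2) rep_inject by (simp add: G_def)
      assume y: "mem y (rcarrier R)" and "rep (G (rl x)) = rep (G (rl y))"
      then have "rl x = rl y" by (auto simp: G_def split: if_splits)
      then show "x = y" using x y by (metis rep_rl)
    qed
  qed
qed

end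

section \<open>Open and clopen sets\<close>

locale real_space = real_model mem R rep
  for mem :: "'v \<Rightarrow> 'v \<Rightarrow> bool" and R and rep :: "'k::linordered_field \<Rightarrow> 'v" +
  fixes X :: "'v tspace"
  assumes topology: "topological_space X"
begin

abbreviation pts :: "'v set" where
  "pts \<equiv> elts (points X)"

lemma open_points: "mem U (opens X) \<Longrightarrow> mem x U \<Longrightarrow> mem x (points X)"
  using topology unfolding topological_space_def by (auto simp: subset_iff)

lemma open_in_elts: "open_in X (elts U) \<longleftrightarrow> mem U (opens X)"
  unfolding open_in_def by (auto simp: elts_inject)

lemma open_inE:
  assumes "open_in X S"
  obtains U where "mem U (opens X)" "elts U = S"
  using assms unfolding open_in_def by auto

lemma open_Int: "open_in X S \<Longrightarrow> open_in X T \<Longrightarrow> open_in X (S \<inter> T)"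
  using topology unfolding topological_space_def open_in_def[of X S] open_in_def[of X T] by blast

lemma open_whole: "open_in X (pts)"
  using topology unfolding topological_space_def by blast

lemma open_empty: "open_in X {}"
  using topology unfolding topological_space_def by blast

lemma open_Union: "elts F \<subseteq> elts (opens X) \<Longrightarrow> open_in X (\<Union>U\<in>elts F. elts U)"
  using topology unfolding topological_space_def by blast

lemma open_Un:
  assumes "open_in X S" "open_in X T"
  shows "open_in X (S \<union> T)"
proof -
  obtain U V where U: "mem U (opens X)" "elts U = S" and V: "mem V (opens X)" "elts V = T"
    using assms open_inE by metis
  have "open_in X (\<Union>W\<in>elts (vset {U, V}). elts W)"
    by (rule open_Union) (use U V in simp)
  then show ?thesis using U V by simp
qed

text \<open>Openness includes being a set of the model. The union is taken over the set of all open subsets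
  of \<^term>\<open>S\<close>; no neighbourhoods have to be chosen.\<close>

lemma open_if_locally:
  assumes d: "dpred (\<lambda>e. e 0 \<in> S)"
    and loc: "\<And>x. x \<in> S \<Longrightarrow> \<exists>U. open_in X U \<and> x \<in> U \<and> U \<subseteq> S"
  shows "open_in X S"
proof -
  have d': "dpred (\<lambda>e. \<forall>y\<in>elts (e 0). y \<in> S)" by (intro dfn d)
  define F where "F = sep (opens X) (\<lambda>U. \<forall>y\<in>elts U. y \<in> S)"
  have F: "elts F = {U \<in> elts (opens X). \<forall>y\<in>elts U. y \<in> S}"
    unfolding F_def by (rule elts_sep[OF d'])
  have "open_in X (\<Union>U\<in>elts F. elts U)"
    by (rule open_Union) (use F in blast)
  moreover have "(\<Union>U\<in>elts F. elts U) = S"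
    using loc unfolding F open_in_def by fastforce
  ultimately show ?thesis by simp
qed

lemma clopen_in_iff:
  "clopen_in X (elts A) \<longleftrightarrow> mem A (opens X) \<and>
    (\<exists>B. mem B (opens X) \<and> (\<forall>x. mem x B \<longleftrightarrow> mem x (points X) \<and> \<not> mem x A))"
  unfolding clopen_in_def closed_in_def open_in_elts open_in_def[of X "pts - elts A"]
  using open_points by (auto simp: set_eq_iff)

lemma clopen_inE:
  assumes "clopen_in X S"
  obtains A where "elts A = S"
  using assms unfolding clopen_in_def open_in_def by blast

lemma dpred_clopen [dfn]:
  assumes "dterm t"
  shows "dpred (\<lambda>e. clopen_in X (elts (t e)))"
  unfolding clopen_in_iff by (intro dfn assms dterm_shift[OF assms] dterm_shift[OF assms, of "\<lambda>i. Suc (Suc i)"])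

lemma clopen_subset: "clopen_in X S \<Longrightarrow> S \<subseteq> pts"
  by (simp add: clopen_in_def closed_in_def)

lemma clopen_Compl: "clopen_in X S \<Longrightarrow> clopen_in X (pts - S)"
  unfolding clopen_in_def closed_in_def by (auto simp: double_diff)

lemma clopen_Int: "clopen_in X S \<Longrightarrow> clopen_in X T \<Longrightarrow> clopen_in X (S \<inter> T)"
  unfolding clopen_in_def closed_in_def by (auto simp: Diff_Int intro: open_Int open_Un)

lemma clopen_Un: "clopen_in X S \<Longrightarrow> clopen_in X T \<Longrightarrow> clopen_in X (S \<union> T)"
  unfolding clopen_in_def closed_in_def by (auto simp: Diff_Un intro: open_Int open_Un)

lemma clopen_empty: "clopen_in X {}"
  unfolding clopen_in_def closed_in_def using open_empty open_whole by simp

lemma clopen_whole: "clopen_in X (pts)"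
  unfolding clopen_in_def closed_in_def using open_empty open_whole by simp

text \<open>By induction along \<^term>\<open>omega\<close>: since the indexing is injective, each step adds at most one member
  of the family.\<close>

lemma clopen_initial_union:
  assumes g: "injects g F omega" and F: "\<And>A. mem A F \<Longrightarrow> clopen_in X (elts A)"
    and n: "mem n omega"
  shows "clopen_in X {x \<in> pts. \<exists>A\<in>elts F. mem (apply0 g A) n \<and> mem x A}"
proof -
  define B where "B n = sep (points X) (\<lambda>x. \<exists>A\<in>elts F. mem (apply0 g A) n \<and> mem x A)" for n
  have B: "elts (B n) = {x \<in> pts. \<exists>A\<in>elts F. mem (apply0 g A) n \<and> mem x A}" for n
    unfolding B_def by (rule elts_sep) (intro dfn)
  have "clopen_in X (elts (B n))"
    using n
  proof (induction n rule: omega_induct)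
    show "dpred (\<lambda>e. clopen_in X (elts (B (e 0))))"
      unfolding B_def by (intro dfn)
  next
    case zero
    have "elts (B zero) = {}" unfolding B by simp
    then show ?case using clopen_empty by simp
  next
    case (succ n)
    show ?case
    proof (cases "\<exists>A\<in>elts F. apply0 g A = n")
      case True
      then obtain A where A: "mem A F" "apply0 g A = n" by auto
      have uniq: "A' = A" if "mem A' F" "apply0 g A' = n" for A'
        using g A that unfolding injects_def by auto
      have "elts (B (succ n)) = elts (B n) \<union> elts A"
      proof (intro equalityI subsetI)
        fix x assume "x \<in> elts (B (succ n))"
        then obtain A' where "mem x (points X)" "mem A' F" "mem (apply0 g A') (succ n)" "mem x A'"
          unfolding B by auto
        then show "x \<in> elts (B n) \<union> elts A"
          using uniq[of A'] unfolding B by auto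
      next
        fix x assume "x \<in> elts (B n) \<union> elts A"
        then show "x \<in> elts (B (succ n))"
          using A clopen_subset[OF F[OF A(1)]] unfolding B by (auto simp: subset_iff)
      qed
      then show ?thesis using clopen_Un[OF succ(2) F[OF A(1)]] by simp
    next
      case False
      then have "elts (B (succ n)) = elts (B n)"
        unfolding B by auto
      then show ?thesis using succ(2) by simp
    qed
  qed
  then show ?thesis unfolding B .
qed

lemma clopen_finite_union:
  assumes fin: "finite_set F" and F: "\<And>A. mem A F \<Longrightarrow> clopen_in X (elts A)"
  shows "clopen_in X {x \<in> pts. \<exists>A\<in>elts F. mem x A}"
proof -
  obtain n g where n: "mem n omega" and g: "injects g F n"
    using finite_set_injects[OF fin] by auto
  have "injects g F omega"
    using g omega_elts_subset[OF n] unfolding injects_def by blast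
  from clopen_initial_union[OF this F n]
  have "clopen_in X {x \<in> pts. \<exists>A\<in>elts F. mem (apply0 g A) n \<and> mem x A}" .
  moreover have "mem (apply0 g A) n" if "mem A F" for A
    using g that unfolding injects_def by simp
  then have "{x \<in> pts. \<exists>A\<in>elts F. mem (apply0 g A) n \<and> mem x A} =
      {x \<in> pts. \<exists>A\<in>elts F. mem x A}" by auto
  ultimately show ?thesis by simp
qed

section \<open>Real functions on a space\<close>

abbreviation dfun :: "('v \<Rightarrow> 'k) \<Rightarrow> bool" where
  "dfun F \<equiv> dterm (\<lambda>e. rep (F (e 0)))"

text \<open>The function of the model that a definable HOL function induces; \<^const>\<open>val\<close> is the way back.\<close>

definition mk :: "('v \<Rightarrow> 'k) \<Rightarrow> 'v" where
  "mk F = lam (points X) (\<lambda>x. rep (F x))"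

text \<open>Stated for HOL functions, so that algebraic expressions and compositions need not be coded as
  sets; \<^const>\<open>mk\<close> translates to the functions of the model.\<close>

definition cont :: "('v \<Rightarrow> 'k) \<Rightarrow> bool" where
  "cont F \<longleftrightarrow> (\<forall>x\<in>pts. \<forall>d. 0 < d \<longrightarrow>
     (\<exists>U. mem U (opens X) \<and> mem x U \<and> (\<forall>z\<in>elts U. \<bar>F z - F x\<bar> < d)))"

definition clopen_cover :: "('v \<Rightarrow> 'k) \<Rightarrow> 'k \<Rightarrow> 'v \<Rightarrow> bool" where
  "clopen_cover F d \<A> \<longleftrightarrow> (\<exists>g. injects g \<A> omega) \<and> (\<forall>x\<in>pts. \<exists>A\<in>elts \<A>. mem x A) \<and>
     (\<forall>A\<in>elts \<A>. clopen_in X (elts A) \<and> (\<forall>x\<in>elts A. \<forall>y\<in>elts A. \<bar>F x - F y\<bar> \<le> d))"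

text \<open>This is membership in the ring of functions with small oscillation on the pieces of countable
  clopen covers.\<close>

definition ucont :: "('v \<Rightarrow> 'k) \<Rightarrow> bool" where
  "ucont F \<longleftrightarrow> (\<forall>d. 0 < d \<longrightarrow> (\<exists>\<A>. clopen_cover F d \<A>))"

lemma contE:
  assumes "cont F" "mem x (points X)" "0 < d"
  obtains U where "mem U (opens X)" "mem x U" "\<And>z. mem z U \<Longrightarrow> \<bar>F z - F x\<bar> < d"
  using assms unfolding cont_def by (metis mem_elts)

lemma cont_commonE:
  assumes "cont F" "cont G" "mem x (points X)" "0 < d"
  obtains W where "mem W (opens X)" "mem x W"
    "\<And>z. mem z W \<Longrightarrow> \<bar>F z - F x\<bar> < d" "\<And>z. mem z W \<Longrightarrow> \<bar>G z - G x\<bar> < d"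
proof -
  obtain U where U: "mem U (opens X)" "mem x U" "\<And>z. mem z U \<Longrightarrow> \<bar>F z - F x\<bar> < d"
    using contE[OF assms(1,3,4)] by blast
  obtain V where V: "mem V (opens X)" "mem x V" "\<And>z. mem z V \<Longrightarrow> \<bar>G z - G x\<bar> < d"
    using contE[OF assms(2,3,4)] by blast
  obtain W where W: "mem W (opens X)" "elts W = elts U \<inter> elts V"
    using open_Int[of "elts U" "elts V"] U(1) V(1) open_in_elts by (meson open_inE)
  have "mem z W \<longleftrightarrow> mem z U \<and> mem z V" for z
    using W(2) mem_elts[of z W] by simp
  then show ?thesis using U V W(1) by (intro that[of W]) simp_all
qed

lemma ucontE:
  assumes "ucont F" "0 < d"
  obtains g \<A> where "injects g \<A> omega" "\<And>x. mem x (points X) \<Longrightarrow> \<exists>A. mem A \<A> \<and> mem x A"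
    "\<And>A. mem A \<A> \<Longrightarrow> clopen_in X (elts A)"
    "\<And>A x y. mem A \<A> \<Longrightarrow> mem x A \<Longrightarrow> mem y A \<Longrightarrow> \<bar>F x - F y\<bar> \<le> d"
proof -
  obtain \<A> where A: "clopen_cover F d \<A>"
    using assms unfolding ucont_def by blast
  then obtain g where "injects g \<A> omega" unfolding clopen_cover_def by blast
  then show ?thesis
  proof (rule that)
    note A' = A[unfolded clopen_cover_def, THEN conjunct2]
    show "\<exists>A. mem A \<A> \<and> mem x A" if "mem x (points X)" for x
      using A'[THEN conjunct1, rule_format, of x] that by auto
    show "clopen_in X (elts A)" if "mem A \<A>" for A
      using A'[THEN conjunct2, rule_format, of A] that by simp
    show "\<bar>F x - F y\<bar> \<le> d" if "mem A \<A>" "mem x A" "mem y A" for A x y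
      using A'[THEN conjunct2, rule_format, of A] that by simp
  qed
qed

lemma dfun_at: "dfun F \<Longrightarrow> dterm t \<Longrightarrow> dterm (\<lambda>e. rep (F (t e)))"
  by (rule dterm_fun1)

lemma mk_function: "dfun F \<Longrightarrow> is_function (mk F) (points X) (rcarrier R)"
  unfolding mk_def by (rule lam_function) simp_all

lemma app_mk: "dfun F \<Longrightarrow> mem x (points X) \<Longrightarrow> app (mk F) x = rep (F x)"
  unfolding mk_def by (rule app_lam)

lemma val_mk: "dfun F \<Longrightarrow> mem x (points X) \<Longrightarrow> val (mk F) x = F x"
  unfolding mk_def by (rule val_lam)

lemma mk_val: "is_function f (points X) (rcarrier R) \<Longrightarrow> mk (val f) = f"
  unfolding mk_def by (rule lam_val)

lemma dfun_val: "dfun (val f)"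
  by (intro dfn)

lemma mk_cong:
  assumes "dfun F" "dfun G" "\<And>x. mem x (points X) \<Longrightarrow> F x = G x"
  shows "mk F = mk G"
  by (rule function_ext[OF mk_function[OF assms(1)] mk_function[OF assms(2)]])
    (simp add: app_mk assms)

lemma cont_cong: "(\<And>x. mem x (points X) \<Longrightarrow> F x = G x) \<Longrightarrow> cont F \<longleftrightarrow> cont G"
proof -
  assume *: "\<And>x. mem x (points X) \<Longrightarrow> F x = G x"
  have "cont G" if F: "cont F" and eq: "\<And>x. mem x (points X) \<Longrightarrow> F x = G x" for F G
    unfolding cont_def
  proof (intro ballI allI impI)
    fix x d assume x: "x \<in> pts" and d: "(0::'k) < d"
    obtain U where U: "mem U (opens X)" "mem x U" "\<forall>z\<in>elts U. \<bar>F z - F x\<bar> < d"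
      using F x d unfolding cont_def by blast
    then have "\<forall>z\<in>elts U. \<bar>G z - G x\<bar> < d"
      using eq open_points[OF U(1)] x by simp
    then show "\<exists>U. mem U (opens X) \<and> mem x U \<and> (\<forall>z\<in>elts U. \<bar>G z - G x\<bar> < d)"
      using U by blast
  qed
  from this[of F G] this[of G F] show ?thesis using * by auto
qed

lemma ucont_cong: "(\<And>x. mem x (points X) \<Longrightarrow> F x = G x) \<Longrightarrow> ucont F \<longleftrightarrow> ucont G"
proof -
  assume *: "\<And>x. mem x (points X) \<Longrightarrow> F x = G x"
  have "ucont G" if F: "ucont F" and eq: "\<And>x. mem x (points X) \<Longrightarrow> F x = G x" for F G
    unfolding ucont_def
  proof (intro allI impI)
    fix d assume d: "(0::'k) < d"
    obtain \<A> where A: "clopen_cover F d \<A>"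
      using F d unfolding ucont_def by blast
    have "\<bar>G x - G y\<bar> \<le> d" if "mem A \<A>" "mem x A" "mem y A" for A x y
      using A that eq clopen_subset[of "elts A"] unfolding clopen_cover_def by (metis mem_elts subsetD)
    then have "clopen_cover G d \<A>"
      using A unfolding clopen_cover_def by auto
    then show "\<exists>\<A>. clopen_cover G d \<A>" by blast
  qed
  from this[of F G] this[of G F] show ?thesis using * by auto
qed

lemma ucont_cont:
  assumes "ucont F"
  shows "cont F"
  unfolding cont_def
proof (intro ballI allI impI)
  fix x d assume x: "x \<in> pts" and d: "(0::'k) < d"
  then have d2: "0 < d / 2" by simp
  obtain g \<A> where "injects g \<A> omega" and A: "\<And>x. mem x (points X) \<Longrightarrow> \<exists>A. mem A \<A> \<and> mem x A"
    "\<And>A. mem A \<A> \<Longrightarrow> clopen_in X (elts A)"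
    "\<And>A x y. mem A \<A> \<Longrightarrow> mem x A \<Longrightarrow> mem y A \<Longrightarrow> \<bar>F x - F y\<bar> \<le> d / 2"
    by (rule ucontE[OF assms d2]) (rule that)
  obtain A where "mem A \<A>" "mem x A" using A(1) x by auto
  then have "mem A (opens X)" "\<forall>z\<in>elts A. \<bar>F z - F x\<bar> \<le> d / 2"
    using A(2)[of A] A(3)[of A] unfolding clopen_in_iff by auto
  moreover have "d / 2 < d" using d by simp
  ultimately show "\<exists>U. mem U (opens X) \<and> mem x U \<and> (\<forall>z\<in>elts U. \<bar>F z - F x\<bar> < d)"
    using \<open>mem x A\<close> by (meson le_less_trans)
qed

subsection \<open>Continuity and the rings\<close>

lemma ball_rep: "(\<forall>y\<in>elts (rcarrier R). Q y) \<longleftrightarrow> (\<forall>a. Q (rep a))"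
  by (metis ex_rep mem_elts rep_mem)

lemma bex_rep: "(\<exists>y\<in>elts (rcarrier R). Q y) \<longleftrightarrow> (\<exists>a. Q (rep a))"
  by (metis ex_rep mem_elts rep_mem)

lemma opens_real_line: "mem U (opens (real_line R)) \<longleftrightarrow> elts U \<subseteq> elts (rcarrier R) \<and>
    (\<forall>r. mem (rep r) U \<longrightarrow> (\<exists>a b. a < r \<and> r < b \<and> (\<forall>y. a < y \<and> y < b \<longrightarrow> mem (rep y) U)))"
proof -
  define P where "P U \<longleftrightarrow> (\<forall>x\<in>elts U. \<exists>a\<in>elts (rcarrier R). \<exists>b\<in>elts (rcarrier R).
    less R a x \<and> less R x b \<and> (\<forall>y\<in>elts (rcarrier R). less R a y \<and> less R y b \<longrightarrow> y \<in> elts U))" for U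

  have "dpred (\<lambda>e. P (e 0))"
    unfolding P_def less_def leq_def by (intro dfn)
  then have "dpred (\<lambda>e. e 0 \<in> {U. elts U \<subseteq> elts (rcarrier R) \<and> P U})"
    unfolding mem_Collect_eq by (intro dfn)
  from ex_subclass[OF _ this, of "pow (rcarrier R)"]
  have "\<exists>c. elts c = {U. elts U \<subseteq> elts (rcarrier R) \<and> P U}" by auto
  from elts_vset[OF this]
  have "elts (opens (real_line R)) = {U. elts U \<subseteq> elts (rcarrier R) \<and> P U}"
    by (simp add: real_line_def P_def)
  then have "mem U (opens (real_line R)) \<longleftrightarrow> elts U \<subseteq> elts (rcarrier R) \<and> P U"
    by (subst mem_elts[symmetric]) simp
  moreover have "P U \<longleftrightarrow> (\<forall>x\<in>elts (rcarrier R). mem x U \<longrightarrow> (\<exists>a\<in>elts (rcarrier R). \<exists>b\<in>elts (rcarrier R).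
    less R a x \<and> less R x b \<and> (\<forall>y\<in>elts (rcarrier R). less R a y \<and> less R y b \<longrightarrow> mem y U)))"
    if "elts U \<subseteq> elts (rcarrier R)"
    using that unfolding P_def by (auto simp: subset_iff)
  ultimately show ?thesis
    unfolding ball_rep bex_rep less_rep by auto
qed

lemma continuous_real_iff:
  assumes f: "is_function f (points X) (rcarrier R)"
  shows "continuous X (real_line R) f \<longleftrightarrow> cont (val f)"
proof
  assume c: "continuous X (real_line R) f"
  show "cont (val f)"
    unfolding cont_def
  proof (intro ballI allI impI)
    fix x and d :: 'k assume x: "x \<in> pts" and d: "0 < d"
    define V where "V = sep (rcarrier R) (\<lambda>v. \<bar>rl v - val f x\<bar> < d)"
    have dV: "dpred (\<lambda>e. \<bar>rl (e 0) - val f x\<bar> < d)" by (intro dfn)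
    have memV: "mem (rep y) V \<longleftrightarrow> \<bar>y - val f x\<bar> < d" for y
      unfolding V_def mem_sep[OF dV] by simp
    have "mem V (opens (real_line R))"
      unfolding opens_real_line memV
    proof (intro conjI allI impI)
      show "elts V \<subseteq> elts (rcarrier R)" unfolding V_def elts_sep[OF dV] by blast
      fix r assume "\<bar>r - val f x\<bar> < d"
      then show "\<exists>a b. a < r \<and> r < b \<and> (\<forall>y. a < y \<and> y < b \<longrightarrow> \<bar>y - val f x\<bar> < d)"
        by (intro exI[of _ "val f x - d"] exI[of _ "val f x + d"]) (auto simp: abs_less_iff)
    qed
    then have "open_in X {z \<in> pts. app f z \<in> elts V}"
      using c unfolding continuous_def by simp
    then obtain U where U: "mem U (opens X)" "elts U = {z \<in> pts. app f z \<in> elts V}"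
      by (rule open_inE)
    have "mem z U \<longleftrightarrow> mem z (points X) \<and> \<bar>val f z - val f x\<bar> < d" for z
    proof -
      have "mem z U \<longleftrightarrow> mem z (points X) \<and> mem (app f z) V"
        using U(2) mem_elts[of z U] by simp
      then show ?thesis using memV rep_val[OF f] by metis
    qed
    then show "\<exists>U. mem U (opens X) \<and> mem x U \<and> (\<forall>z\<in>elts U. \<bar>val f z - val f x\<bar> < d)"
      using U(1) x d by (intro exI[of _ U]) simp
  qed
next
  assume c: "cont (val f)"
  show "continuous X (real_line R) f"
    unfolding continuous_def
  proof (intro conjI ballI)
    show "is_function f (points X) (points (real_line R))" using f by (simp add: real_line_def)
    fix V assume "V \<in> elts (opens (real_line R))"
    then have V: "mem V (opens (real_line R))" by simp
    have eq: "{x \<in> pts. app f x \<in> elts V} = {x. mem x (points X) \<and> mem (rep (val f x)) V}"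
      using rep_val[OF f] by auto
    show "open_in X {x \<in> pts. app f x \<in> elts V}"
      unfolding eq
    proof (rule open_if_locally)
      show "dpred (\<lambda>e. e 0 \<in> {x. mem x (points X) \<and> mem (rep (val f x)) V})"
        unfolding mem_Collect_eq by (intro dfn)
      fix x assume "x \<in> {x. mem x (points X) \<and> mem (rep (val f x)) V}"
      then have x: "mem x (points X)" "mem (rep (val f x)) V" by auto
      obtain a b where ab: "a < val f x" "val f x < b" "\<And>y. a < y \<Longrightarrow> y < b \<Longrightarrow> mem (rep y) V"
        using V x(2) unfolding opens_real_line by blast
      define d where "d = min (val f x - a) (b - val f x)"
      have "0 < d" using ab by (simp add: d_def)
      then obtain U where U: "mem U (opens X)" "mem x U" "\<forall>z\<in>elts U. \<bar>val f z - val f x\<bar> < d"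
        using c x(1) unfolding cont_def by (metis mem_elts)
      have "mem z (points X) \<and> mem (rep (val f z)) V" if "mem z U" for z
      proof
        show "mem z (points X)" using open_points[OF U(1) that] .
        have "\<bar>val f z - val f x\<bar> < d" using U(3) that by simp
        then show "mem (rep (val f z)) V" by (intro ab(3)) (auto simp: d_def abs_less_iff)
      qed
      then show "\<exists>U. open_in X U \<and> x \<in> U \<and> U \<subseteq> {x. mem x (points X) \<and> mem (rep (val f x)) V}"
        using U(1,2) open_in_elts by (intro exI[of _ "elts U"]) auto
    qed
  qed
qed

lemma carrier_C: "f \<in> carrier (C_ring R X) \<longleftrightarrow> is_function f (points X) (rcarrier R) \<and> cont (val f)"
  unfolding C_ring_def using continuous_real_iff[of f]
  by (auto simp: continuous_def real_line_def)

text \<open>The oscillation of an arbitrary function may be infinite. A bound for the differences makes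
  completeness applicable, and then the supremum exists and has the same bound.\<close>

lemma osc_le_iff:
  assumes f: "is_function f (points X) (rcarrier R)" and A: "elts A \<subseteq> pts" and d: "0 < d"
  shows "(\<exists>s. is_osc R f A s \<and> leq R s (rep d)) \<longleftrightarrow>
    (\<forall>x\<in>elts A. \<forall>y\<in>elts A. \<bar>val f x - val f y\<bar> \<le> d)"
proof (cases "elts A = {}")
  case True
  then show ?thesis using d by (auto simp: is_osc_def rep_zero[symmetric] rep_le)
next
  case False
  then obtain a where a: "mem a A" by auto
  define P where "P t \<longleftrightarrow> (\<exists>x\<in>elts A. \<exists>y\<in>elts A. t = \<bar>val f x - val f y\<bar>)" for t
  have dP: "dpred (\<lambda>e. P (rl (e 0)))" unfolding P_def by (intro dfn)
  have app_val: "app f x = rep (val f x)" if "mem x A" for x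
    using A that rep_val[OF f, of x] by auto
  have "{t. \<exists>x\<in>elts A. \<exists>y\<in>elts A. t = rabs R (app f x \<ominus>\<^bsub>real_ring R\<^esub> app f y)} = rep ` {t. P t}"
    by (auto simp: P_def app_val)
  then have osc: "is_osc R f A s \<longleftrightarrow> is_sup R (rep ` {t. P t}) s" for s
    using False by (simp add: is_osc_def)
  have ub: "is_upper_bound R (rep ` {t. P t}) (rep c) \<longleftrightarrow> (\<forall>t. P t \<longrightarrow> t \<le> c)" for c
    by (auto simp: is_upper_bound_def rep_le)
  have "(\<exists>s. is_osc R f A s \<and> leq R s (rep d)) \<longleftrightarrow> (\<forall>t. P t \<longrightarrow> t \<le> d)"
  proof
    assume "\<exists>s. is_osc R f A s \<and> leq R s (rep d)"
    then obtain s where s: "is_sup R (rep ` {t. P t}) s" "leq R s (rep d)"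
      unfolding osc by blast
    then have "mem s (rcarrier R)"
      unfolding is_sup_def is_upper_bound_def by simp
    then obtain s' where s': "s = rep s'"
      using ex_rep by blast
    have "\<forall>t. P t \<longrightarrow> t \<le> s'" using s(1) unfolding s' is_sup_def ub by blast
    then show "\<forall>t. P t \<longrightarrow> t \<le> d" using s(2) unfolding s' rep_le by (meson order_trans)
  next
    assume bd: "\<forall>t. P t \<longrightarrow> t \<le> d"
    have "P 0" using a unfolding P_def by (intro bexI[of _ a]) auto
    then obtain s where s: "\<And>t. P t \<Longrightarrow> t \<le> s" "\<And>c. (\<And>t. P t \<Longrightarrow> t \<le> c) \<Longrightarrow> s \<le> c"
      using real_sup[of P, OF dP] bd by metis
    have "is_sup R (rep ` {t. P t}) (rep s)"
      unfolding is_sup_def ub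
    proof (intro conjI allI impI)
      fix c assume c: "is_upper_bound R (rep ` {t. P t}) c"
      then have "mem c (rcarrier R)" unfolding is_upper_bound_def by simp
      then obtain c' where "c = rep c'" using ex_rep by blast
      then show "leq R (rep s) c" using c s(2) by (simp add: ub rep_le)
    qed (use s(1) in auto)
    then show "\<exists>s. is_osc R f A s \<and> leq R s (rep d)"
      unfolding osc using s(2)[of d] bd rep_le by blast
  qed
  then show ?thesis unfolding P_def by blast
qed

lemma carrier_U: "f \<in> carrier (U_aleph0 R X) \<longleftrightarrow> is_function f (points X) (rcarrier R) \<and> ucont (val f)"
proof (cases "is_function f (points X) (rcarrier R)")
  case f: True
  have "(\<exists>\<A>. countable_set \<A> \<and> (\<Union>A\<in>elts \<A>. elts A) = pts \<and>
      (\<forall>A\<in>elts \<A>. clopen_in X (elts A) \<and> (\<exists>s. is_osc R f A s \<and> leq R s (rep d)))) \<longleftrightarrow>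
    (\<exists>\<A>. clopen_cover (val f) d \<A>)"
    (is "(\<exists>\<A>. ?L \<A>) \<longleftrightarrow> (\<exists>\<A>. ?R \<A>)") if d: "0 < d" for d
  proof -
    have "?L \<A> \<longleftrightarrow> ?R \<A>" for \<A>
    proof -
      have *: "(clopen_in X (elts A) \<and> (\<exists>s. is_osc R f A s \<and> leq R s (rep d))) \<longleftrightarrow>
        clopen_in X (elts A) \<and> (\<forall>x\<in>elts A. \<forall>y\<in>elts A. \<bar>val f x - val f y\<bar> \<le> d)" for A
        using osc_le_iff[OF f clopen_subset d] by blast
      have **: "(\<Union>A\<in>elts \<A>. elts A) = pts \<longleftrightarrow> (\<forall>x\<in>pts. \<exists>A\<in>elts \<A>. mem x A)"
        if "\<And>A. A \<in> elts \<A> \<Longrightarrow> clopen_in X (elts A)"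
        using that clopen_subset by fastforce
      show ?thesis
        unfolding * countable_set_iff clopen_cover_def using ** by blast
    qed
    then show ?thesis by (rule iff_exI)
  qed
  then have "(\<forall>d\<in>elts (rcarrier R). less R (rzero R) d \<longrightarrow> (\<exists>\<A>. countable_set \<A> \<and>
      (\<Union>A\<in>elts \<A>. elts A) = pts \<and>
      (\<forall>A\<in>elts \<A>. clopen_in X (elts A) \<and> (\<exists>s. is_osc R f A s \<and> leq R s d)))) \<longleftrightarrow> ucont (val f)"
    unfolding ucont_def rep_zero[symmetric] ball_rep less_rep by simp
  then show ?thesis
    using f carrier_C ucont_cont by (auto simp: U_aleph0_def)
next
  case False
  then show ?thesis using carrier_C by (auto simp: U_aleph0_def)
qed

lemma mk_carrier_C: "dfun F \<Longrightarrow> mk F \<in> carrier (C_ring R X) \<longleftrightarrow> cont F"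
  unfolding carrier_C using mk_function cont_cong[of "val (mk F)" F] val_mk by auto

lemma mk_carrier_U: "dfun F \<Longrightarrow> mk F \<in> carrier (U_aleph0 R X) \<longleftrightarrow> ucont F"
  unfolding carrier_U using mk_function ucont_cong[of "val (mk F)" F] val_mk by auto

lemma C_ring_add: "dfun F \<Longrightarrow> dfun G \<Longrightarrow> add (C_ring R X) (mk F) (mk G) = mk (\<lambda>x. F x + G x)"
proof -
  assume d: "dfun F" "dfun G"
  have "lam (points X) (\<lambda>x. app (mk F) x \<oplus>\<^bsub>real_ring R\<^esub> app (mk G) x) = mk (\<lambda>x. F x + G x)"
    unfolding mk_def[of "\<lambda>x. F x + G x"] lam_def
    by (intro arg_cong[of _ _ vset] Collect_cong bex_cong refl) (simp add: app_mk d)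
  then show ?thesis by (simp add: C_ring_def)
qed

lemma C_ring_mult: "dfun F \<Longrightarrow> dfun G \<Longrightarrow> mult (C_ring R X) (mk F) (mk G) = mk (\<lambda>x. F x * G x)"
proof -
  assume d: "dfun F" "dfun G"
  have "lam (points X) (\<lambda>x. app (mk F) x \<otimes>\<^bsub>real_ring R\<^esub> app (mk G) x) = mk (\<lambda>x. F x * G x)"
    unfolding mk_def[of "\<lambda>x. F x * G x"] lam_def
    by (intro arg_cong[of _ _ vset] Collect_cong bex_cong refl) (simp add: app_mk d)
  then show ?thesis by (simp add: C_ring_def)
qed

lemma C_ring_one: "one (C_ring R X) = mk (\<lambda>x. 1)"
  by (simp add: C_ring_def mk_def rep_one)

lemma U_ring_simps: "add (U_aleph0 R X) = add (C_ring R X)" "mult (U_aleph0 R X) = mult (C_ring R X)"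
  "one (U_aleph0 R X) = one (C_ring R X)"
  by (simp_all add: U_aleph0_def)

lemma elts_carrier_C: "elts (vset (carrier (C_ring R X))) = carrier (C_ring R X)"
proof (rule elts_vset, rule ex_subclass)
  show "carrier (C_ring R X) \<subseteq> elts (pow (cartesian (points X) (rcarrier R)))"
    unfolding subset_iff carrier_C is_function_def by auto
  show "dpred (\<lambda>e. e 0 \<in> carrier (C_ring R X))"
    unfolding carrier_C cont_def by (intro dfn dpred_is_function)
qed

lemma elts_carrier_U: "elts (vset (carrier (U_aleph0 R X))) = carrier (U_aleph0 R X)"
proof (rule elts_vset, rule ex_subclass)
  show "carrier (U_aleph0 R X) \<subseteq> elts (pow (cartesian (points X) (rcarrier R)))"
    unfolding subset_iff carrier_U is_function_def by auto
  show "dpred (\<lambda>e. e 0 \<in> carrier (U_aleph0 R X))"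
    unfolding carrier_U ucont_def clopen_cover_def by (intro dfn dpred_is_function)
qed

end

section \<open>Strong zero-dimensionality\<close>

context real_space
begin

lemma ucont_by_sequence:
  assumes "\<And>d. 0 < d \<Longrightarrow> \<exists>D. dterm (\<lambda>e. D (e 0)) \<and> (\<forall>n\<in>elts omega. clopen_in X (elts (D n)) \<and>
      (\<forall>x\<in>elts (D n). \<forall>y\<in>elts (D n). \<bar>F x - F y\<bar> \<le> d)) \<and>
      (\<forall>x\<in>pts. \<exists>n\<in>elts omega. mem x (D n))"
  shows "ucont F"
  unfolding ucont_def
proof (intro allI impI)
  fix d :: 'k assume "0 < d"
  then obtain D where D: "dterm (\<lambda>e. D (e 0))"
    "\<And>n. n\<in>elts omega \<Longrightarrow> clopen_in X (elts (D n)) \<and> (\<forall>x\<in>elts (D n). \<forall>y\<in>elts (D n). \<bar>F x - F y\<bar> \<le> d)"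
    "\<And>x. x\<in>pts \<Longrightarrow> \<exists>n\<in>elts omega. mem x (D n)"
    using assms[OF \<open>0 < d\<close>] by blast
  have A: "A \<in> elts (vset (D ` elts omega)) \<longleftrightarrow> (\<exists>n\<in>elts omega. A = D n)" for A
    unfolding elts_image[OF D(1)] by blast
  have "\<exists>g. injects g (vset (D ` elts omega)) omega"
    using countable_image_omega[OF D(1)] unfolding countable_set_iff .
  moreover have "\<exists>A\<in>elts (vset (D ` elts omega)). mem x A" if "x \<in> pts" for x
    using D(3)[OF that] A by blast
  moreover have "clopen_in X (elts A) \<and> (\<forall>x\<in>elts A. \<forall>y\<in>elts A. \<bar>F x - F y\<bar> \<le> d)"
    if "A \<in> elts (vset (D ` elts omega))" for A
    using that D(2) unfolding A by blast
  ultimately show "\<exists>\<A>. clopen_cover F d \<A>"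
    unfolding clopen_cover_def by blast
qed

text \<open>A function that factors through a map into the natural numbers with clopen fibres is constant on
  the members of a countable clopen partition.\<close>

lemma ucont_factor:
  assumes p: "dterm (\<lambda>e. p (e 0))" "\<And>x. mem x (points X) \<Longrightarrow> mem (p x) omega"
    and fibre: "\<And>n. mem n omega \<Longrightarrow> clopen_in X {x \<in> pts. p x = n}"
  shows "ucont (\<lambda>x. G (p x))"
proof (rule ucont_by_sequence)
  fix d :: 'k assume d: "0 < d"
  note p' [dfn] = dterm_fun1[of p, OF p(1)]
  define D where "D n = sep (points X) (\<lambda>x. p x = n)" for n
  have D: "elts (D n) = {x \<in> pts. p x = n}" for n
    unfolding D_def by (rule elts_sep) (intro dfn)
  have memD: "mem x (D n) \<longleftrightarrow> mem x (points X) \<and> p x = n" for x n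
    unfolding D_def by (rule mem_sep) (intro dfn)
  have "dterm (\<lambda>e. D (e 0))" unfolding D_def by (intro dfn)
  then show "\<exists>D. dterm (\<lambda>e. D (e 0)) \<and> (\<forall>n\<in>elts omega. clopen_in X (elts (D n)) \<and>
      (\<forall>x\<in>elts (D n). \<forall>y\<in>elts (D n). \<bar>G (p x) - G (p y)\<bar> \<le> d)) \<and>
      (\<forall>x\<in>pts. \<exists>n\<in>elts omega. mem x (D n))"
    using fibre p(2) d by (intro exI[of _ D]) (auto simp: memD D)
qed

lemma ucont_lipschitz:
  assumes F: "ucont F" and L: "0 < L" "\<And>s t. \<bar>k s - k t\<bar> \<le> L * \<bar>s - t\<bar>"
  shows "ucont (\<lambda>x. k (F x))"
  unfolding ucont_def
proof (intro allI impI)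
  fix d :: 'k assume "0 < d"
  then have d: "0 < d / L" using L by simp
  obtain \<A> where A: "clopen_cover F (d / L) \<A>"
    using F d unfolding ucont_def by blast
  have "\<bar>k (F x) - k (F y)\<bar> \<le> d" if "\<bar>F x - F y\<bar> \<le> d / L" for x y
    using L(2)[of "F x" "F y"] that L(1) by (simp add: field_simps)
  then have "clopen_cover (\<lambda>x. k (F x)) d \<A>"
    using A unfolding clopen_cover_def by meson
  then show "\<exists>\<A>. clopen_cover (\<lambda>x. k (F x)) d \<A>" by blast
qed

lemma cont_lipschitz:
  assumes F: "cont F" and L: "\<And>s t. \<bar>k s - k t\<bar> \<le> \<bar>s - t\<bar>"
  shows "cont (\<lambda>x. k (F x))"
  using F L unfolding cont_def by (meson le_less_trans)

definition chi :: "'v \<Rightarrow> 'v \<Rightarrow> 'k" where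
  "chi A x = (if mem x A then 1 else 0)"

lemma dterm_chi [dfn]: "dterm s \<Longrightarrow> dterm t \<Longrightarrow> dterm (\<lambda>e. rep (chi (s e) (t e)))"
  unfolding chi_def by (intro dfn)

lemma ucont_chi:
  assumes A: "clopen_in X (elts A)"
  shows "ucont (chi A)"
proof -
  define p where "p x = (if mem x A then zero else succ zero)" for x
  have d: "dterm (\<lambda>e. p (e 0))" unfolding p_def by (intro dfn)
  have "clopen_in X {x \<in> pts. p x = n}" for n
  proof -
    have sub: "elts A \<subseteq> pts" using clopen_subset[OF A] .
    consider "n = zero" | "n = succ zero" | "n \<noteq> zero" "n \<noteq> succ zero" by blast
    then have "{x \<in> pts. p x = n} \<in> {elts A, pts - elts A, {}}"
    proof cases
      case 1
      then have "{x \<in> pts. p x = n} = elts A"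
        using sub succ_not_zero by (auto simp: p_def)
      then show ?thesis by simp
    next
      case 2
      then have "{x \<in> pts. p x = n} = pts - elts A"
        using succ_not_zero[symmetric] by (auto simp: p_def)
      then show ?thesis by simp
    next
      case 3
      then have "{x \<in> pts. p x = n} = {}"
        by (auto simp: p_def)
      then show ?thesis by simp
    qed
    moreover have "clopen_in X S" if "S \<in> {elts A, pts - elts A, {}}" for S
      using that A clopen_Compl[OF A] clopen_empty by blast
    ultimately show ?thesis by blast
  qed
  from ucont_factor[OF d _ this, of "\<lambda>n. if n = zero then 1 else 0"]
  have "ucont (\<lambda>x. if p x = zero then 1 else 0)" by (simp add: p_def)
  moreover have "(\<lambda>x. if p x = zero then 1 else 0) = chi A"
    using succ_not_zero by (auto simp: chi_def p_def fun_eq_iff)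
  ultimately show ?thesis by simp
qed

lemma zero_set_iff: "zero_set R X Z \<longleftrightarrow>
    (\<exists>F. dfun F \<and> cont F \<and> elts Z = {x \<in> pts. F x = 0})"
proof
  assume "zero_set R X Z"
  then obtain f where f: "f \<in> carrier (C_ring R X)" "elts Z = {x \<in> pts. app f x = rzero R}"
    unfolding zero_set_def by blast
  then have f': "is_function f (points X) (rcarrier R)" "cont (val f)"
    unfolding carrier_C by auto
  then have "elts Z = {x \<in> pts. val f x = 0}"
    unfolding f(2) rep_zero[symmetric] using rep_val[OF f'(1)] by (auto simp: rep_inject[symmetric] simp del: rep_inject)
  then show "\<exists>F. dfun F \<and> cont F \<and> elts Z = {x \<in> pts. F x = 0}"
    using f'(2) dfun_val by blast
next
  assume "\<exists>F. dfun F \<and> cont F \<and> elts Z = {x \<in> pts. F x = 0}"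
  then obtain F where F: "dfun F" "cont F" "elts Z = {x \<in> pts. F x = 0}" by blast
  then have "mk F \<in> carrier (C_ring R X)" by (simp add: mk_carrier_C)
  moreover have "elts Z = {x \<in> pts. app (mk F) x = rzero R}"
    unfolding F(3) rep_zero[symmetric] using app_mk[OF F(1)] by auto
  ultimately show "zero_set R X Z" unfolding zero_set_def by blast
qed

lemma ex_zero_set:
  assumes "dfun F" "cont F"
  obtains Z where "zero_set R X Z" "\<And>x. mem x Z \<longleftrightarrow> mem x (points X) \<and> F x = 0"
proof -
  have d: "dpred (\<lambda>e. F (e 0) = 0)" by (intro dfn assms(1))
  show ?thesis
    by (rule that[of "sep (points X) (\<lambda>x. F x = 0)"])
      (use elts_sep[OF d] mem_sep[OF d] assms in \<open>auto simp: zero_set_iff\<close>)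
qed

subsection \<open>All continuous functions of a strongly zero-dimensional space\<close>

text \<open>Let \<open>c\<^sub>n\<close> be an enumeration of the integer multiples of \<open>\<delta>\<close>. The sets where
  \<open>\<bar>F - c\<^sub>n\<bar> \<le> \<delta>\<close> cover the space, and each of them can be separated by a clopen set from the
  zero-set where \<open>\<bar>F - c\<^sub>n\<bar> \<ge> 2 \<delta>\<close>. Countable multiple choice selects for every \<open>n\<close> a nonempty finite set
  of separating sets. No single one has to be chosen, because their union separates as well.\<close>

lemma strongly_zero_dimensional_cont_ucont:
  assumes szd: "strongly_zero_dimensional R X" and CMC: CMC
    and F: "dfun F" "cont F"
  shows "ucont F"
proof (rule ucont_by_sequence)
  fix \<epsilon> :: 'k assume \<epsilon>: "0 < \<epsilon>"
  define \<delta> where "\<delta> = \<epsilon> / 4"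
  have \<delta>: "0 < \<delta>" "4 * \<delta> = \<epsilon>" using \<epsilon> by (auto simp: \<delta>_def)
  obtain q :: "'v \<Rightarrow> 'k" where q: "dterm (\<lambda>e. rep (q (e 0)))" "\<And>r. \<exists>n\<in>elts omega. \<bar>r - q n\<bar> \<le> 1"
    by (rule integer_sequence) blast
  note F' [dfn] = dfun_at[OF F(1)] and q' [dfn] = dfun_at[OF q(1)]
  define c where "c n = q n * \<delta>" for n
  define S where "S n = sep (opens X) (\<lambda>U. clopen_in X (elts U) \<and>
    (\<forall>x\<in>pts. \<bar>F x - c n\<bar> \<le> \<delta> \<longrightarrow> mem x U) \<and> (\<forall>x\<in>elts U. \<bar>F x - c n\<bar> < 2 * \<delta>))" for n
  have dS: "dterm (\<lambda>e. S (e 0))" unfolding S_def c_def by (intro dfn)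
  have memS: "mem U (S n) \<longleftrightarrow> mem U (opens X) \<and> clopen_in X (elts U) \<and>
    (\<forall>x\<in>pts. \<bar>F x - c n\<bar> \<le> \<delta> \<longrightarrow> mem x U) \<and> (\<forall>x\<in>elts U. \<bar>F x - c n\<bar> < 2 * \<delta>)" for U n
    unfolding S_def c_def by (rule mem_sep) (intro dfn)
  have ne: "elts (S n) \<noteq> {}" for n
  proof -
    \<comment> \<open>Truncation exhibits the two closed sets as zero-sets.\<close>
    define F1 where "F1 x = max (\<bar>F x - c n\<bar> - \<delta>) 0" for x
    define F2 where "F2 x = max (2 * \<delta> - \<bar>F x - c n\<bar>) 0" for x
    have d: "dfun F1" "dfun F2" unfolding F1_def F2_def by (intro dfn)+
    have c1: "cont F1"
      unfolding F1_def by (rule cont_lipschitz[OF F(2)]) (auto simp: abs_if max_def)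
    have c2: "cont F2"
      unfolding F2_def by (rule cont_lipschitz[OF F(2)]) (auto simp: abs_if max_def)
    obtain Z1 where Z1: "zero_set R X Z1" "\<And>x. mem x Z1 \<longleftrightarrow> mem x (points X) \<and> F1 x = 0"
      using ex_zero_set[OF d(1) c1] by blast
    obtain Z2 where Z2: "zero_set R X Z2" "\<And>x. mem x Z2 \<longleftrightarrow> mem x (points X) \<and> F2 x = 0"
      using ex_zero_set[OF d(2) c2] by blast
    have z1: "mem x Z1 \<longleftrightarrow> mem x (points X) \<and> \<bar>F x - c n\<bar> \<le> \<delta>" for x
      unfolding Z1 F1_def by auto
    have z2: "mem x Z2 \<longleftrightarrow> mem x (points X) \<and> 2 * \<delta> \<le> \<bar>F x - c n\<bar>" for x
      unfolding Z2 F2_def by auto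
    have "elts Z1 \<inter> elts Z2 = {}"
      using \<delta>(1) by (auto simp: z1 z2)
    then obtain U where U: "clopen_in X (elts U)" "elts Z1 \<subseteq> elts U" "elts U \<subseteq> pts - elts Z2"
      using szd Z1(1) Z2(1) unfolding strongly_zero_dimensional_def by blast
    have "mem U (S n)"
      unfolding memS
    proof (intro conjI ballI impI)
      show "mem U (opens X)" using U(1) unfolding clopen_in_iff by blast
      show "mem x U" if "x \<in> pts" "\<bar>F x - c n\<bar> \<le> \<delta>" for x
        using U(2) that z1 by (auto simp: subset_iff)
      show "\<bar>F x - c n\<bar> < 2 * \<delta>" if "x \<in> elts U" for x
        using U(3) that z2 by (auto simp: subset_iff not_le)
    qed (rule U(1))
    then show ?thesis by auto
  qed
  have S_fun: "is_function (lam omega S) omega (pow (opens X))"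
    by (rule lam_function[OF dS]) (auto simp: memS)
  have S_app: "app (lam omega S) n = S n" if "mem n omega" for n
    by (rule app_lam[OF dS that])
  have "\<forall>n\<in>elts omega. elts (app (lam omega S) n) \<noteq> {}"
    using ne S_app by simp
  then obtain T C where T: "is_function T omega C"
    "\<And>n. mem n omega \<Longrightarrow> elts (app T n) \<noteq> {} \<and> finite_set (app T n) \<and> elts (app T n) \<subseteq> elts (app (lam omega S) n)"
    using CMC S_fun unfolding CMC_def by (metis mem_elts)
  have T_sub: "mem U (S n)" if "mem n omega" "mem U (app T n)" for n U
    using T(2)[OF that(1)] S_app that by auto
  define D where "D n = sep (points X) (\<lambda>x. \<exists>U\<in>elts (apply0 T n). mem x U)" for n
  have dD: "dterm (\<lambda>e. D (e 0))" unfolding D_def by (intro dfn)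
  have D: "elts (D n) = {x \<in> pts. \<exists>U\<in>elts (app T n). mem x U}" if "mem n omega" for n
    unfolding D_def apply0_eq[OF T(1) that, symmetric] by (rule elts_sep) (intro dfn)
  have clopen: "clopen_in X (elts (D n))" if "mem n omega" for n
    unfolding D[OF that]
  proof (rule clopen_finite_union)
    show "finite_set (app T n)" using T(2)[OF that] by blast
    show "clopen_in X (elts A)" if "mem A (app T n)" for A
      using T_sub[OF \<open>mem n omega\<close> that] memS by blast
  qed
  have near: "\<bar>F x - c n\<bar> < 2 * \<delta>" if n: "mem n omega" and x: "mem x (D n)" for n x
  proof -
    have "x \<in> elts (D n)" using x by simp
    then obtain U where "mem U (app T n)" "mem x U" unfolding D[OF n] by auto
    then show ?thesis using T_sub[OF n] memS by (meson mem_elts)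
  qed
  have osc: "\<bar>F x - F y\<bar> \<le> \<epsilon>" if n: "mem n omega" and xy: "mem x (D n)" "mem y (D n)" for n x y
    using near[OF n xy(1)] near[OF n xy(2)] \<delta>(2) by (simp add: abs_if split: if_splits)
  have cover: "\<exists>n\<in>elts omega. mem x (D n)" if x: "mem x (points X)" for x
  proof -
    obtain n where n: "mem n omega" "\<bar>F x / \<delta> - q n\<bar> \<le> 1" using q(2)[of "F x / \<delta>"] by auto
    have "F x - c n = (F x / \<delta> - q n) * \<delta>"
      using \<delta>(1) by (simp add: c_def left_diff_distrib)
    then have "\<bar>F x - c n\<bar> = \<bar>F x / \<delta> - q n\<bar> * \<delta>"
      using \<delta>(1) by (simp add: abs_mult)
    then have near: "\<bar>F x - c n\<bar> \<le> \<delta>"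
      using n(2) \<delta>(1) by (simp add: mult_left_le_one_le)
    obtain U where U: "mem U (app T n)" using T(2)[OF n(1)] by auto
    then have "mem x U" using T_sub[OF n(1) U] near x memS by auto
    then have "x \<in> elts (D n)" unfolding D[OF n(1)] using U x by auto
    then show ?thesis using n(1) by auto
  qed
  show "\<exists>D. dterm (\<lambda>e. D (e 0)) \<and> (\<forall>n\<in>elts omega. clopen_in X (elts (D n)) \<and>
      (\<forall>x\<in>elts (D n). \<forall>y\<in>elts (D n). \<bar>F x - F y\<bar> \<le> \<epsilon>)) \<and>
      (\<forall>x\<in>pts. \<exists>n\<in>elts omega. mem x (D n))"
    using dD clopen osc cover by (intro exI[of _ D]) simp
qed

subsection \<open>Separation by clopen sets\<close>

text \<open>Take a countable clopen cover on whose members \<^term>\<open>F\<close> varies by at most one half, and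
  assign to each point the first member that contains it. This makes the cover disjoint, and the
  separating set is the union of the disjoint pieces that come from members meeting the zero-set.\<close>

lemma ucont_clopen_separation:
  assumes F: "dfun F" "ucont F"
  obtains U where "clopen_in X (elts U)" "\<And>x. mem x (points X) \<Longrightarrow> F x = 0 \<Longrightarrow> mem x U"
    "\<And>x. mem x U \<Longrightarrow> F x \<noteq> 1"
proof -
  have half: "(0::'k) < 1 / 2" "(1 / 2 :: 'k) < 1" by auto
  obtain g \<A> where g: "injects g \<A> omega" and cover: "\<And>x. mem x (points X) \<Longrightarrow> \<exists>A. mem A \<A> \<and> mem x A"
    and clopen: "\<And>A. mem A \<A> \<Longrightarrow> clopen_in X (elts A)"
    and osc: "\<And>A x y. mem A \<A> \<Longrightarrow> mem x A \<Longrightarrow> mem y A \<Longrightarrow> \<bar>F x - F y\<bar> \<le> 1 / 2"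
    by (rule ucontE[OF F(2) half(1)]) (rule that)
  note F' [dfn] = dfun_at[OF F(1)]
  define first where "first x A \<longleftrightarrow> mem A \<A> \<and> mem x A \<and>
    (\<forall>B\<in>elts \<A>. mem x B \<longrightarrow> \<not> mem (apply0 g B) (apply0 g A))" for x A
  have ex_first: "\<exists>A. first x A" if x: "mem x (points X)" for x
  proof -
    obtain A where A: "mem A \<A>" "mem x A" using cover[OF x] by blast
    define P where "P n \<longleftrightarrow> (\<exists>A\<in>elts \<A>. mem x A \<and> apply0 g A = n)" for n
    have d: "dpred (\<lambda>e. P (e 0))" unfolding P_def by (intro dfn)
    have "mem (apply0 g A) omega" using g A unfolding injects_def by simp
    from omega_least[of P, OF d this] A obtain m where
      m: "P m" "\<And>k. mem k m \<Longrightarrow> \<not> P k" unfolding P_def by (metis mem_elts)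
    then show ?thesis unfolding first_def P_def by (metis mem_elts)
  qed
  have first_unique: "A = B" if A: "first x A" and B: "first x B" for x A B
  proof -
    have "mem (apply0 g A) omega" "mem (apply0 g B) omega"
      using A B g unfolding injects_def first_def by simp_all
    then have "apply0 g A = apply0 g B"
      using omega_linear[of "apply0 g A" "apply0 g B"] A B unfolding first_def by auto
    then show ?thesis using A B g unfolding injects_def first_def by simp
  qed
  have nbhd: "\<exists>N. open_in X N \<and> x \<in> N \<and> (\<forall>y\<in>N. mem y (points X) \<and> first y A)" if A: "first x A" for x A
  proof -
    have A': "mem A \<A>" "mem x A" using A unfolding first_def by auto
    define E where "E = {y \<in> pts. \<exists>B\<in>elts \<A>. mem (apply0 g B) (apply0 g A) \<and> mem y B}"
    have "mem (apply0 g A) omega" using g A' unfolding injects_def by simp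
    from clopen_initial_union[OF g clopen this] have "clopen_in X E" unfolding E_def .
    then have "clopen_in X (elts A \<inter> (pts - E))"
      using clopen[OF A'(1)] clopen_Int clopen_Compl by blast
    then have "open_in X (elts A \<inter> (pts - E))" unfolding clopen_in_def by blast
    moreover have "x \<in> elts A \<inter> (pts - E)"
      using A A' clopen_subset[OF clopen[OF A'(1)]] unfolding E_def first_def by auto
    moreover have "\<forall>y\<in>elts A \<inter> (pts - E). mem y (points X) \<and> first y A"
      using A' unfolding E_def first_def by auto
    ultimately show ?thesis by blast
  qed
  define W where "W x \<longleftrightarrow> (\<exists>A. first x A \<and> (\<exists>z\<in>elts A. F z = 0))" for x
  have dW [dfn]: "dterm t \<Longrightarrow> dpred (\<lambda>e. W (t e))" for t
  proof (rule dpred_term)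
    show "dpred (\<lambda>e. W (e 0))" unfolding W_def first_def by (intro dfn)
  qed
  define U where "U = sep (points X) W"
  have U: "elts U = {x \<in> pts. W x}"
    unfolding U_def by (rule elts_sep) (intro dfn)
  have "open_in X (elts U)"
  proof (rule open_if_locally)
    show "dpred (\<lambda>e. e 0 \<in> elts U)" by (intro dfn)
    fix x assume "x \<in> elts U"
    then obtain A where A: "first x A" "\<exists>z\<in>elts A. F z = 0" unfolding U W_def by blast
    then show "\<exists>V. open_in X V \<and> x \<in> V \<and> V \<subseteq> elts U"
      using nbhd[OF A(1)] unfolding U W_def by fastforce
  qed
  moreover have "open_in X (pts - elts U)"
  proof (rule open_if_locally)
    show "dpred (\<lambda>e. e 0 \<in> pts - elts U)" unfolding Diff_iff by (intro dfn)
    fix x assume x: "x \<in> pts - elts U"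
    then obtain A where A: "first x A" using ex_first by auto
    then have "\<not> (\<exists>z\<in>elts A. F z = 0)" using x unfolding U W_def by blast
    then show "\<exists>V. open_in X V \<and> x \<in> V \<and> V \<subseteq> pts - elts U"
      using nbhd[OF A] first_unique unfolding U W_def by (smt (verit, best) DiffI mem_Collect_eq mem_elts subsetI)
  qed
  ultimately have "clopen_in X (elts U)"
    unfolding clopen_in_def closed_in_def U by auto
  moreover have "mem x U" if x: "mem x (points X)" "F x = 0" for x
  proof -
    obtain A where A: "first x A" using ex_first[OF x(1)] by blast
    then have "\<exists>z\<in>elts A. F z = 0" using x(2) unfolding first_def by auto
    then have "x \<in> elts U" unfolding U W_def using A x(1) by auto
    then show ?thesis by simp
  qed
  moreover have "F x \<noteq> 1" if "mem x U" for x
  proof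
    assume "F x = 1"
    have "x \<in> elts U" using that by simp
    then obtain A z where "mem A \<A>" "mem x A" "mem z A" "F z = 0" unfolding U W_def first_def by auto
    then show False using osc[of A x z] \<open>F x = 1\<close> half(2) by simp
  qed
  ultimately show ?thesis using that by blast
qed

text \<open>For disjoint zero-sets of nonnegative functions this quotient is the usual function that is 0 on
  one of them and 1 on the other.\<close>

lemma cont_ratio:
  assumes u: "cont u" "\<And>x. 0 \<le> u x" and v: "cont v" "\<And>x. 0 \<le> v x"
    and pos: "\<And>x. mem x (points X) \<Longrightarrow> 0 < u x + v x"
  shows "cont (\<lambda>x. u x / (u x + v x))"
  unfolding cont_def
proof (intro ballI allI impI)
  fix x and \<epsilon> :: 'k assume "x \<in> pts" and \<epsilon>: "0 < \<epsilon>"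
  then have x: "mem x (points X)" by simp
  define s where "s = u x + v x"
  have s: "0 < s" using pos x by (simp add: s_def)
  \<comment> \<open>The first bound keeps the denominator above s / 2, the second bounds the quotient.\<close>
  define \<delta> where "\<delta> = min (s / 4) (\<epsilon> * s / 4)"
  have \<delta>: "0 < \<delta>" "\<delta> \<le> s / 4" "\<delta> \<le> \<epsilon> * s / 4" using s \<epsilon> by (auto simp: \<delta>_def)
  obtain W where W: "mem W (opens X)" "mem x W" "\<And>z. mem z W \<Longrightarrow> \<bar>u z - u x\<bar> < \<delta>"
    "\<And>z. mem z W \<Longrightarrow> \<bar>v z - v x\<bar> < \<delta>"
    by (rule cont_commonE[OF u(1) v(1) x \<delta>(1)]) (rule that)
  have "\<bar>u z / (u z + v z) - u x / (u x + v x)\<bar> < \<epsilon>" if "mem z W" for z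
  proof -
    note z = W(3,4)[OF that]
    have t: "s / 2 \<le> u z + v z"
      using z \<delta>(2) unfolding s_def by (simp add: abs_if split: if_splits)
    then have t0: "0 < u z + v z" using s by (meson half_gt_zero less_le_trans)
    have "\<bar>u z * s - u x * (u z + v z)\<bar> = \<bar>(u z - u x) * v x - u x * (v z - v x)\<bar>"
      by (simp add: s_def algebra_simps)
    also have "\<dots> \<le> \<bar>u z - u x\<bar> * v x + u x * \<bar>v z - v x\<bar>"
      using abs_triangle_ineq4[of "(u z - u x) * v x" "u x * (v z - v x)"] u(2)[of x] v(2)[of x]
      by (simp add: abs_mult)
    also have "\<dots> \<le> \<delta> * v x + u x * \<delta>"
      using z u(2)[of x] v(2)[of x] by (intro add_mono mult_right_mono mult_left_mono) auto
    also have "\<dots> = \<delta> * s" by (simp add: s_def algebra_simps)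
    finally have num: "\<bar>u z * s - u x * (u z + v z)\<bar> \<le> \<delta> * s" .
    have "u z / (u z + v z) - u x / (u x + v x) = (u z * s - u x * (u z + v z)) / ((u z + v z) * s)"
      using t0 s by (simp add: s_def[symmetric] diff_frac_eq mult.commute)
    then have "\<bar>u z / (u z + v z) - u x / (u x + v x)\<bar> = \<bar>u z * s - u x * (u z + v z)\<bar> / ((u z + v z) * s)"
      using t0 s by (simp add: abs_mult)
    also have "\<dots> \<le> \<delta> * s / ((u z + v z) * s)"
      using num t0 s by (intro divide_right_mono) auto
    also have "\<dots> = \<delta> / (u z + v z)" using s by simp
    also have "\<dots> \<le> \<delta> / (s / 2)"
      using t s \<delta>(1) t0 by (intro divide_left_mono) auto
    also have "\<dots> \<le> \<epsilon> / 2" using \<delta>(3) s by (simp add: field_simps)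
    also have "\<dots> < \<epsilon>" using \<epsilon> by simp
    finally show ?thesis .
  qed
  then show "\<exists>U. mem U (opens X) \<and> mem x U \<and>
      (\<forall>z\<in>elts U. \<bar>u z / (u z + v z) - u x / (u x + v x)\<bar> < \<epsilon>)"
    using W(1,2) by (intro exI[of _ W]) simp
qed

lemma open_neq:
  assumes F: "dfun F" "cont F" and G: "dfun G" "cont G"
  shows "open_in X {x \<in> pts. F x \<noteq> G x}"
proof (rule open_if_locally)
  note F' [dfn] = dfun_at[OF F(1)] and G' [dfn] = dfun_at[OF G(1)]
  show "dpred (\<lambda>e. e 0 \<in> {x \<in> pts. F x \<noteq> G x})"
    unfolding mem_Collect_eq by (intro dfn)
  fix x assume "x \<in> {x \<in> pts. F x \<noteq> G x}"
  then have x: "mem x (points X)" "F x \<noteq> G x" by auto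
  define d where "d = \<bar>F x - G x\<bar> / 2"
  have d: "0 < d" "\<bar>F x - G x\<bar> = d + d" using x(2) by (auto simp: d_def)
  obtain W where W: "mem W (opens X)" "mem x W" "\<And>z. mem z W \<Longrightarrow> \<bar>F z - F x\<bar> < d"
    "\<And>z. mem z W \<Longrightarrow> \<bar>G z - G x\<bar> < d"
    by (rule cont_commonE[OF F(2) G(2) x(1) d(1)]) (rule that)
  have "F z \<noteq> G z" if z: "\<bar>F z - F x\<bar> < d" "\<bar>G z - G x\<bar> < d" for z
    using z d(2) by (auto simp: abs_if split: if_splits)
  then have "elts W \<subseteq> {x \<in> pts. F x \<noteq> G x}"
    using W(3,4) open_points[OF W(1)] by (auto simp: subset_iff)
  then show "\<exists>W. open_in X W \<and> x \<in> W \<and> W \<subseteq> {x \<in> pts. F x \<noteq> G x}"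
    using W(1,2) open_in_elts by (intro exI[of _ "elts W"]) simp
qed

lemma zero_dimensional_completely_regular:
  assumes "zero_dimensional X"
  shows "completely_regular R X"
  unfolding completely_regular_def is_base_def
proof (intro conjI allI impI ballI)
  fix B assume "\<exists>Z. zero_set R X Z \<and> elts B = pts - elts Z"
  then obtain F Z where F: "dfun F" "cont F" and Z: "elts Z = {x \<in> pts. F x = 0}"
    and B: "elts B = pts - elts Z"
    unfolding zero_set_iff by blast
  have "elts B = {x \<in> pts. F x \<noteq> 0}" unfolding B Z by blast
  note F = F this
  have "open_in X {x \<in> pts. F x \<noteq> 0}"
    by (rule open_neq[OF F(1,2)]) (intro dfn, auto simp: cont_def intro: exI[of _ "points X"] open_in_elts[THEN iffD1, OF open_whole])
  then show "B \<in> elts (opens X)" using F(3) open_in_elts by (metis mem_elts)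
next
  fix U x assume "U \<in> elts (opens X)" "x \<in> elts U"
  then obtain A where A: "clopen_in X (elts A)" "x \<in> elts A" "elts A \<subseteq> elts U"
    using assms unfolding zero_dimensional_def is_base_def by blast
  have dchi: "dfun (chi A)" by (intro dfn)
  obtain Z where Z: "zero_set R X Z" "\<And>x. mem x Z \<longleftrightarrow> mem x (points X) \<and> chi A x = 0"
    using ex_zero_set[OF dchi ucont_cont[OF ucont_chi[OF A(1)]]] by blast
  have "elts A = pts - elts Z"
    using Z(2) clopen_subset[OF A(1)] by (auto simp: chi_def split: if_splits)
  then show "\<exists>B. (\<exists>Z. zero_set R X Z \<and> elts B = pts - elts Z) \<and> x \<in> elts B \<and> elts B \<subseteq> elts U"
    using Z(1) A by blast
qed

lemma cont_ucont_strongly_zero_dimensional: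
  assumes zd: "zero_dimensional X" and all: "\<And>F. dfun F \<Longrightarrow> cont F \<Longrightarrow> ucont F"
  shows "strongly_zero_dimensional R X"
  unfolding strongly_zero_dimensional_def
proof (intro conjI allI impI zero_dimensional_completely_regular[OF zd])
  fix Z1 Z2 assume "zero_set R X Z1 \<and> zero_set R X Z2 \<and> elts Z1 \<inter> elts Z2 = {}"
  then have Z: "zero_set R X Z1" "zero_set R X Z2" and disj: "elts Z1 \<inter> elts Z2 = {}" by auto
  obtain F1 where F1: "dfun F1" "cont F1" "elts Z1 = {x \<in> pts. F1 x = 0}"
    using Z(1) unfolding zero_set_iff by blast
  obtain F2 where F2: "dfun F2" "cont F2" "elts Z2 = {x \<in> pts. F2 x = 0}"
    using Z(2) unfolding zero_set_iff by blast
  note F1' [dfn] = dfun_at[OF F1(1)] and F2' [dfn] = dfun_at[OF F2(1)]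
  define F where "F x = \<bar>F1 x\<bar> / (\<bar>F1 x\<bar> + \<bar>F2 x\<bar>)" for x
  have dF: "dfun F" unfolding F_def by (intro dfn)
  have pos: "0 < \<bar>F1 x\<bar> + \<bar>F2 x\<bar>" if "mem x (points X)" for x
    using disj that unfolding F1 F2 by (auto simp: add_pos_nonneg add_nonneg_pos)
  have abs_cont: "cont (\<lambda>x. \<bar>G x\<bar>)" if "cont G" for G
    by (rule cont_lipschitz[OF that]) (rule abs_triangle_ineq3)
  have "cont F"
    unfolding F_def by (rule cont_ratio) (use abs_cont F1 F2 pos in auto)
  then obtain U where U: "clopen_in X (elts U)" "\<And>x. mem x (points X) \<Longrightarrow> F x = 0 \<Longrightarrow> mem x U"
    "\<And>x. mem x U \<Longrightarrow> F x \<noteq> 1"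
    using ucont_clopen_separation[OF dF all[OF dF \<open>cont F\<close>]] by blast
  have "elts Z1 \<subseteq> elts U" unfolding F1 using U(2) by (auto simp: F_def)
  moreover have "elts U \<subseteq> pts - elts Z2"
    using U(3) clopen_subset[OF U(1)] pos unfolding F2 by (fastforce simp: F_def)
  ultimately show "\<exists>U. clopen_in X (elts U) \<and> elts Z1 \<subseteq> elts U \<and> elts U \<subseteq> pts - elts Z2"
    using U(1) by blast
qed

end

section \<open>Coordinates of N-compact spaces\<close>

context ZF_universe
begin

definition omega_functions :: "'v \<Rightarrow> 'v" where
  "omega_functions J = vset {f. is_function f J omega}"

lemma mem_omega_functions: "mem f (omega_functions J) \<longleftrightarrow> is_function f J omega"
proof -
  have "\<exists>c. elts c = {f. is_function f J omega}"
  proof (rule ex_subclass)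
    show "{f. is_function f J omega} \<subseteq> elts (pow (cartesian J omega))"
      unfolding is_function_def by auto
    show "dpred (\<lambda>e. e 0 \<in> {f. is_function f J omega})"
      unfolding mem_Collect_eq by (rule dpred_is_function)
  qed
  from elts_vset[OF this] show ?thesis
    unfolding omega_functions_def by (metis mem_Collect_eq mem_elts)
qed

definition subbasic :: "'v \<Rightarrow> 'v \<Rightarrow> 'v \<Rightarrow> 'v" where
  "subbasic J j V = sep (omega_functions J) (\<lambda>f. mem (apply0 f j) V)"

lemma mem_subbasic: "mem f (subbasic J j V) \<longleftrightarrow> mem f (omega_functions J) \<and> mem (apply0 f j) V"
  unfolding subbasic_def by (rule mem_sep) (intro dfn)

text \<open>A first-order description of the topologies on the set of functions that make all projections continuous.
  The topology of the power is the intersection of all of them.\<close>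

definition projection_topology :: "'v \<Rightarrow> 'v \<Rightarrow> bool" where
  "projection_topology J T \<longleftrightarrow> (\<forall>U\<in>elts T. elts U \<subseteq> elts (omega_functions J)) \<and>
    mem zero T \<and> mem (omega_functions J) T \<and>
    (\<forall>U\<in>elts T. \<forall>V\<in>elts T. \<exists>W\<in>elts T. \<forall>x. mem x W \<longleftrightarrow> mem x U \<and> mem x V) \<and>
    (\<forall>F. elts F \<subseteq> elts T \<longrightarrow> (\<exists>W\<in>elts T. \<forall>x. mem x W \<longleftrightarrow> (\<exists>U\<in>elts F. mem x U))) \<and>
    (\<forall>j\<in>elts J. \<forall>V. elts V \<subseteq> elts omega \<longrightarrow> mem (subbasic J j V) T)"

lemma projection_topology_iff:
  "projection_topology J T \<longleftrightarrow> topological_space \<lparr>points = omega_functions J, opens = T\<rparr> \<and>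
    (\<forall>j\<in>elts J. \<forall>V\<in>elts (opens discrete_omega).
      open_in \<lparr>points = omega_functions J, opens = T\<rparr> {f \<in> elts (omega_functions J). app f j \<in> elts V})"
proof -
  let ?X = "\<lparr>points = omega_functions J, opens = T\<rparr>"
  have open_iff: "open_in ?X S \<longleftrightarrow> (\<exists>U\<in>elts T. \<forall>x. mem x U \<longleftrightarrow> x \<in> S)" for S
    unfolding open_in_def by (simp add: set_eq_iff)
  have open_elts: "open_in ?X (elts U) \<longleftrightarrow> mem U T" for U
    unfolding open_in_def by (auto simp: elts_inject)
  have opens_omega: "opens discrete_omega = pow omega"
    by (simp add: discrete_omega_def pow_def)
  have "elts (subbasic J j V) = {f \<in> elts (omega_functions J). app f j \<in> elts V}" if "j \<in> elts J" for j V
    using apply0_eq[of _ J omega j] that by (auto simp: mem_subbasic mem_omega_functions)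
  then have "open_in ?X {f \<in> elts (omega_functions J). app f j \<in> elts V} \<longleftrightarrow> mem (subbasic J j V) T"
    if "j \<in> elts J" for j V
    using open_elts[of "subbasic J j V"] that by simp
  then have "(\<forall>j\<in>elts J. \<forall>V\<in>elts (opens discrete_omega).
      open_in ?X {f \<in> elts (omega_functions J). app f j \<in> elts V}) \<longleftrightarrow>
      (\<forall>j\<in>elts J. \<forall>V\<in>elts (pow omega). mem (subbasic J j V) T)"
    unfolding opens_omega by (intro ball_cong refl)
  then show ?thesis
    unfolding topological_space_def projection_topology_def
    using open_elts[of "omega_functions J"] open_elts[of zero] by (simp add: open_iff)
qed

text \<open>The discrete topology, which bounds the intersection by a set.\<close>

lemma projection_topology_pow: "projection_topology J (pow (omega_functions J))"
  unfolding projection_topology_def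
proof (intro conjI ballI allI impI)
  let ?P = "omega_functions J"
  show "\<exists>W\<in>elts (pow ?P). \<forall>x. mem x W \<longleftrightarrow> mem x U \<and> mem x V" if "U \<in> elts (pow ?P)" for U V
  proof -
    have d: "dpred (\<lambda>e. mem (e 0) V)" by (intro dfn)
    show ?thesis using that mem_sep[OF d] by (intro bexI[of _ "sep U (\<lambda>x. mem x V)"]) (auto simp: subset_iff)
  qed
  show "\<exists>W\<in>elts (pow ?P). \<forall>x. mem x W \<longleftrightarrow> (\<exists>U\<in>elts F. mem x U)" if F: "elts F \<subseteq> elts (pow ?P)" for F
  proof -
    obtain W where W: "elts W = (\<Union>x\<in>elts F. elts x)" using union by blast
    have "W \<in> elts (pow ?P)"
      using F unfolding elts_pow mem_Collect_eq W by blast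
    moreover have "mem x W \<longleftrightarrow> (\<exists>U\<in>elts F. mem x U)" for x
      using W mem_elts[of x W] by simp
    ultimately show ?thesis by blast
  qed
  show "mem (subbasic J j V) (pow ?P)" for j V
    by (auto simp: mem_subbasic)
qed auto

lemma power_space_eq: "power_space discrete_omega J =
    \<lparr>points = omega_functions J, opens = vset {U. \<forall>T. projection_topology J T \<longrightarrow> U \<in> elts T}\<rparr>"
  unfolding power_space_def Let_def projection_topology_iff omega_functions_def
  by (simp add: discrete_omega_def)

lemma opens_power_space:
  "mem U (opens (power_space discrete_omega J)) \<longleftrightarrow> (\<forall>T. projection_topology J T \<longrightarrow> mem U T)"
proof -
  have "{U. \<forall>T. projection_topology J T \<longrightarrow> U \<in> elts T} \<subseteq> elts (pow (omega_functions J))"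
    using projection_topology_pow by blast
  moreover have "dpred (\<lambda>e. e 0 \<in> {U. \<forall>T. projection_topology J T \<longrightarrow> U \<in> elts T})"
    unfolding mem_Collect_eq projection_topology_def subbasic_def by (intro dfn)
  ultimately have "\<exists>c. elts c = {U. \<forall>T. projection_topology J T \<longrightarrow> U \<in> elts T}"
    by (rule ex_subclass)
  then have "U \<in> elts (vset {U. \<forall>T. projection_topology J T \<longrightarrow> U \<in> elts T}) \<longleftrightarrow>
      (\<forall>T. projection_topology J T \<longrightarrow> U \<in> elts T)"
    by (simp only: elts_vset mem_Collect_eq)
  then show ?thesis by (simp add: power_space_eq)
qed

text \<open>The subsets with the property \<open>Q\<close> form a topology that makes the projections continuous, and the
  topology of the power is the least such topology. This principle replaces the
  description of the open sets by finite intersections of subbasic ones.\<close>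

lemma power_space_open_induct:
  assumes U: "mem U (opens (power_space discrete_omega J))" and dQ: "dpred (\<lambda>e. Q (e 0))"
    and whole: "Q (omega_functions J)" and empty: "Q zero"
    and Int: "\<And>U V W. Q U \<Longrightarrow> Q V \<Longrightarrow> (\<And>x. mem x W \<longleftrightarrow> mem x U \<and> mem x V) \<Longrightarrow> Q W"
    and Union: "\<And>F W. (\<And>U. mem U F \<Longrightarrow> Q U) \<Longrightarrow> (\<And>x. mem x W \<longleftrightarrow> (\<exists>U\<in>elts F. mem x U)) \<Longrightarrow> Q W"
    and sub: "\<And>j V. mem j J \<Longrightarrow> Q (subbasic J j V)"
  shows "Q U"
proof -
  let ?P = "omega_functions J"
  note memQ = mem_sep[OF dQ]
  note pow = projection_topology_pow[of J, unfolded projection_topology_def, THEN conjunct2, THEN conjunct2,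
      THEN conjunct2]
  have "projection_topology J (sep (pow ?P) Q)"
    unfolding projection_topology_def
  proof (intro conjI ballI allI impI)
    fix U assume U: "U \<in> elts (sep (pow ?P) Q)"
    then show "elts U \<subseteq> elts ?P" by (simp add: memQ)
    fix V assume V: "V \<in> elts (sep (pow ?P) Q)"
    have "U \<in> elts (pow ?P)" "V \<in> elts (pow ?P)" using U V by (simp_all add: memQ)
    then obtain W where W: "W \<in> elts (pow ?P)" "\<And>x. mem x W \<longleftrightarrow> mem x U \<and> mem x V"
      using pow[THEN conjunct1] by blast
    then have "Q W" using Int[of U V W] U V by (simp add: memQ)
    then show "\<exists>W\<in>elts (sep (pow ?P) Q). \<forall>x. mem x W \<longleftrightarrow> mem x U \<and> mem x V"
      using W by (intro bexI[of _ W]) (simp_all add: memQ)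
  next
    fix F assume F: "elts F \<subseteq> elts (sep (pow ?P) Q)"
    then have F': "Q U" "U \<in> elts (pow ?P)" if "mem U F" for U
      using that by (auto simp: memQ subset_iff)
    have "elts F \<subseteq> elts (pow ?P)" using F'(2) by (metis mem_elts subsetI)
    then obtain W where W: "W \<in> elts (pow ?P)" "\<And>x. mem x W \<longleftrightarrow> (\<exists>U\<in>elts F. mem x U)"
      using pow[THEN conjunct2, THEN conjunct1] by blast
    then have "Q W" using Union[of F W] F'(1) by simp
    then show "\<exists>W\<in>elts (sep (pow ?P) Q). \<forall>x. mem x W \<longleftrightarrow> (\<exists>U\<in>elts F. mem x U)"
      using W by (intro bexI[of _ W]) (simp_all add: memQ)
  qed (use whole empty sub in \<open>auto simp: memQ mem_subbasic\<close>)
  then show ?thesis using U unfolding opens_power_space by (metis memQ)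
qed

end

text \<open>What is used about a closed subspace of a power of the discrete natural numbers. The coordinates
  are definable, have clopen fibres and separate points. The last condition expresses closedness: a
  filter base \<open>N\<close> that decides every coordinate, with value \<open>t j\<close> in coordinate \<open>j\<close>, converges to a point of
  the space. It covers both uses below, for the clopen neighbourhoods of a point and for the
  clopen sets on which a ring homomorphism does not vanish.\<close>

locale coordinate_space = real_space mem R rep X
  for mem :: "'v \<Rightarrow> 'v \<Rightarrow> bool" and R and rep :: "'k::linordered_field \<Rightarrow> 'v" and X +
  fixes J :: 'v and p :: "'v \<Rightarrow> 'v \<Rightarrow> 'v"
  assumes dterm_coordinate: "dterm (\<lambda>e. p (e 0) (e 1))"
    and coordinate_omega: "mem j J \<Longrightarrow> mem x (points X) \<Longrightarrow> mem (p j x) omega"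
    and coordinate_clopen: "mem j J \<Longrightarrow> mem n omega \<Longrightarrow> clopen_in X {x \<in> pts. p j x = n}"
    and coordinate_eq: "mem x (points X) \<Longrightarrow> mem y (points X) \<Longrightarrow>
      (\<And>j. mem j J \<Longrightarrow> p j x = p j y) \<Longrightarrow> x = y"
    and coordinate_limit: "dpred (\<lambda>e. N (e 0)) \<Longrightarrow> is_function t J omega \<Longrightarrow> N (points X) \<Longrightarrow>
      (\<And>V. N V \<Longrightarrow> elts V \<noteq> {} \<and> elts V \<subseteq> pts) \<Longrightarrow>
      (\<And>V W. N V \<Longrightarrow> N W \<Longrightarrow> \<exists>Z. N Z \<and> elts Z \<subseteq> elts V \<inter> elts W) \<Longrightarrow>
      (\<And>j. mem j J \<Longrightarrow> \<exists>V. N V \<and> (\<forall>x. mem x V \<longrightarrow> p j x = app t j)) \<Longrightarrow>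
      \<exists>x. mem x (points X) \<and> (\<forall>j. mem j J \<longrightarrow> p j x = app t j) \<and>
        (\<forall>U. mem U (opens X) \<longrightarrow> mem x U \<longrightarrow> (\<exists>V. N V \<and> elts V \<subseteq> elts U))"

context real_space
begin

text \<open>The conditions except the last hold because the coordinates are continuous and determine a point. For the
  last one let \<open>t\<close> be the function of the values decided by \<open>N\<close>. By induction on open sets, every open set of the
  power that contains \<open>t\<close> contains the image of a member of \<open>N\<close>. For the complement of the closed subspace this
  is impossible, so \<open>t\<close> lies in the subspace and comes from a point of the space.\<close>

lemma N_compact_coordinates:
  assumes "N_compact X"
  obtains J p where "coordinate_space mem R rep X J p"
proof -
  obtain J F h where closed: "closed_in (power_space discrete_omega J) (elts F)"
    and h: "homeomorphism X (subspace (power_space discrete_omega J) F) h"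
    using assms unfolding N_compact_def by blast
  define P where "P = omega_functions J"
  define pw where "pw = power_space discrete_omega J"
  note memP = mem_omega_functions[of _ J, folded P_def]
  note mem_sub = mem_subbasic[of _ J, folded P_def]
  have points_pw: "points pw = P" by (simp add: pw_def P_def power_space_eq)
  have FP: "elts F \<subseteq> elts P" and F_compl: "open_in pw (elts P - elts F)"
    using closed unfolding closed_in_def pw_def[symmetric] points_pw by auto
  have "\<exists>c. elts c = {U. \<exists>V\<in>elts (opens pw). elts U = elts V \<inter> elts F}"
  proof (rule ex_subclass)
    show "{U. \<exists>V\<in>elts (opens pw). elts U = elts V \<inter> elts F} \<subseteq> elts (pow F)" by auto
    have "elts U = elts V \<inter> elts F \<longleftrightarrow> (\<forall>x. mem x U \<longleftrightarrow> mem x V \<and> mem x F)" for U V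
      by (auto simp: set_eq_iff)
    then show "dpred (\<lambda>e. e 0 \<in> {U. \<exists>V\<in>elts (opens pw). elts U = elts V \<inter> elts F})"
      unfolding mem_Collect_eq by (simp only:) (intro dfn)
  qed
  from elts_vset[OF this]
  have opens_F: "elts (opens (subspace pw F)) = {U. \<exists>V\<in>elts (opens pw). elts U = elts V \<inter> elts F}"
    by (simp add: subspace_def)
  have points_F: "points (subspace pw F) = F" by (simp add: subspace_def)
  have h_fun: "is_function h (points X) F" and h_bij: "bij_betw (app h) (pts) (elts F)"
    and h_cont: "\<And>V. V\<in>elts (opens (subspace pw F)) \<Longrightarrow> open_in X {x \<in> pts. app h x \<in> elts V}"
    and h_open: "\<And>U. mem U (opens X) \<Longrightarrow> open_in (subspace pw F) (app h ` elts U)"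
    using h unfolding homeomorphism_def is_bijection_def continuous_def pw_def[symmetric] points_F by auto
  have h_F: "mem (app h x) F" if "mem x (points X)" for x
    using app_mem[OF h_fun that] .
  have h_P: "mem (app h x) P" if "mem x (points X)" for x
    using FP h_F[OF that] by auto
  define p where "p j x = apply0 (apply0 h x) j" for j x
  have p: "p j x = app (app h x) j" if "mem j J" "mem x (points X)" for j x
    unfolding p_def apply0_eq[OF h_fun that(2)] using apply0_eq[OF _ that(1)] h_P[OF that(2)] memP by blast
  have p_open: "open_in X {x \<in> pts. mem (p j x) V}" if j: "mem j J" and V: "elts V \<subseteq> elts omega" for j V
  proof -
    have "mem (subbasic J j V) (opens pw)"
      unfolding pw_def opens_power_space projection_topology_def using j V by auto
    moreover have d: "dpred (\<lambda>e. mem (e 0) F)" by (intro dfn)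
    have W: "elts (sep (subbasic J j V) (\<lambda>x. mem x F)) = elts (subbasic J j V) \<inter> elts F"
      unfolding elts_sep[OF d] by auto
    ultimately have "sep (subbasic J j V) (\<lambda>x. mem x F) \<in> elts (opens (subspace pw F))"
      unfolding opens_F by auto
    from h_cont[OF this] have "open_in X {x \<in> pts. app h x \<in> elts (subbasic J j V) \<inter> elts F}"
      unfolding W .
    moreover have "{x \<in> pts. app h x \<in> elts (subbasic J j V) \<inter> elts F} = {x \<in> pts. mem (p j x) V}"
      using h_F h_P apply0_eq[OF h_fun] by (auto simp: mem_sub p_def)
    ultimately show ?thesis by simp
  qed
  have "coordinate_space mem R rep X J p"
  proof unfold_locales
    show "dterm (\<lambda>e. p (e 0) (e 1))" unfolding p_def by (intro dfn)
    show p_omega: "mem (p j x) omega" if "mem j J" "mem x (points X)" for j x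
      unfolding p[OF that] using app_mem[of "app h x" J omega j] h_P[OF that(2)] memP that(1) by blast
    show "clopen_in X {x \<in> pts. p j x = n}" if j: "mem j J" and n: "mem n omega" for j n
    proof -
      have d: "dpred (\<lambda>e. e 0 \<noteq> n)" by (intro dfn)
      have "open_in X {x \<in> pts. mem (p j x) (vset {n})}"
        by (rule p_open[OF j]) (use n in simp)
      moreover have "mem (p j x) (vset {n}) \<longleftrightarrow> p j x = n" for x
        using mem_elts[of "p j x" "vset {n}"] by (simp del: mem_elts)
      ultimately have 1: "open_in X {x \<in> pts. p j x = n}" by simp
      have "open_in X {x \<in> pts. mem (p j x) (sep omega (\<lambda>m. m \<noteq> n))}"
        by (rule p_open[OF j]) (use elts_sep[OF d] in auto)
      moreover have "{x \<in> pts. mem (p j x) (sep omega (\<lambda>m. m \<noteq> n))} =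
          pts - {x \<in> pts. p j x = n}"
        using p_omega[OF j] by (auto simp: mem_sep[OF d])
      ultimately have 2: "open_in X (pts - {x \<in> pts. p j x = n})"
        by simp
      show ?thesis unfolding clopen_in_def closed_in_def by (intro conjI 1 2) blast
    qed
    show "x = y" if x: "mem x (points X)" and y: "mem y (points X)" and eq: "\<And>j. mem j J \<Longrightarrow> p j x = p j y" for x y
    proof -
      have "app h x = app h y"
        using function_ext[of "app h x" J omega "app h y" omega] h_P[OF x] h_P[OF y] memP eq p x y by auto
      then show ?thesis using h_bij x y unfolding bij_betw_def inj_on_def by auto
    qed
    fix N t
    assume dN: "dpred (\<lambda>e. N (e 0))" and t: "is_function t J omega" and N_top: "N (points X)"
      and N_ne: "\<And>V. N V \<Longrightarrow> elts V \<noteq> {} \<and> elts V \<subseteq> pts"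
      and N_Int: "\<And>V W. N V \<Longrightarrow> N W \<Longrightarrow> \<exists>Z. N Z \<and> elts Z \<subseteq> elts V \<inter> elts W"
      and N_p: "\<And>j. mem j J \<Longrightarrow> \<exists>V. N V \<and> (\<forall>x. mem x V \<longrightarrow> p j x = app t j)"
    have dN' [dfn]: "dterm s \<Longrightarrow> dpred (\<lambda>e. N (s e))" for s
      by (rule dpred_term[where P = "\<lambda>_. N", OF _ dN])
    have tP: "mem t P" using t memP by blast
    have small: "\<exists>V. N V \<and> (\<forall>x. mem x V \<longrightarrow> mem (app h x) U)" if U: "mem U (opens pw)" "mem t U" for U
    proof -
      define Q where "Q U \<longleftrightarrow> (mem t U \<longrightarrow> (\<exists>V. N V \<and> (\<forall>x\<in>elts V. mem (apply0 h x) U)))" for U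
      have dQ: "dpred (\<lambda>e. Q (e 0))" unfolding Q_def by (intro dfn)
      have Q: "Q U \<longleftrightarrow> (mem t U \<longrightarrow> (\<exists>V. N V \<and> (\<forall>x. mem x V \<longrightarrow> mem (app h x) U)))" for U
        using N_ne apply0_eq[OF h_fun] unfolding Q_def by (metis mem_elts subsetD)
      have "Q U"
      proof (rule power_space_open_induct[OF U(1)[unfolded pw_def] dQ])
        show "Q (omega_functions J)"
          using N_top h_P unfolding P_def Q by blast
        show "Q zero" by (simp add: Q)
        show "Q W" if QUV: "Q U" "Q V" and W: "\<And>x. mem x W \<longleftrightarrow> mem x U \<and> mem x V" for U V W
          unfolding Q
        proof
          assume tW: "mem t W"
          obtain A where A: "N A" "\<forall>x. mem x A \<longrightarrow> mem (app h x) U"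
            using QUV(1) tW unfolding W Q by blast
          obtain B where B: "N B" "\<forall>x. mem x B \<longrightarrow> mem (app h x) V"
            using QUV(2) tW unfolding W Q by blast
          obtain Z where "N Z" "elts Z \<subseteq> elts A \<inter> elts B" using N_Int A(1) B(1) by blast
          with A B show "\<exists>V. N V \<and> (\<forall>x. mem x V \<longrightarrow> mem (app h x) W)"
            unfolding W by (intro exI[of _ Z]) (auto simp: subset_iff)
        qed
        show "Q W" if "\<And>U. mem U F \<Longrightarrow> Q U" "\<And>x. mem x W \<longleftrightarrow> (\<exists>U\<in>elts F. mem x U)" for F W
          using that(1) unfolding Q that(2) by (metis mem_elts)
        show "Q (subbasic J j V)" if j: "mem j J" for j V
          unfolding Q
        proof
          assume "mem t (subbasic J j V)"
          then have "mem (app t j) V" using apply0_eq[OF t j] by (simp add: mem_sub)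
          moreover obtain A where A: "N A" "\<forall>x. mem x A \<longrightarrow> p j x = app t j" using N_p j by blast
          moreover have "mem x (points X)" if "mem x A" for x
            using N_ne A(1) that by (metis mem_elts subsetD)
          ultimately show "\<exists>W. N W \<and> (\<forall>x. mem x W \<longrightarrow> mem (app h x) (subbasic J j V))"
            using h_P apply0_eq[OF h_fun] by (intro exI[of _ A]) (auto simp: mem_sub p_def)
        qed
      qed
      then show ?thesis using U(2) unfolding Q by blast
    qed
    have "mem t F"
    proof (rule ccontr)
      assume nF: "\<not> mem t F"
      obtain U where U: "U \<in> elts (opens pw)" "elts U = elts P - elts F"
        using F_compl unfolding open_in_def by blast
      have memU: "mem x U \<longleftrightarrow> mem x P \<and> \<not> mem x F" for x
        using U(2) mem_elts[of x U] by simp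
      obtain V where V: "N V" "\<forall>x. mem x V \<longrightarrow> mem (app h x) U"
        using small[of U] U(1) memU nF tP by auto
      obtain x where "mem x V" "mem x (points X)" using N_ne V(1) by (metis ex_in_conv mem_elts subsetD)
      then show False using V(2) memU h_F by blast
    qed
    then obtain x where x: "mem x (points X)" "app h x = t"
      using h_bij unfolding bij_betw_def by (metis imageE mem_elts)
    show "\<exists>x. mem x (points X) \<and> (\<forall>j. mem j J \<longrightarrow> p j x = app t j) \<and>
           (\<forall>U. mem U (opens X) \<longrightarrow> mem x U \<longrightarrow> (\<exists>V. N V \<and> elts V \<subseteq> elts U))"
    proof (rule exI[of _ x], intro conjI allI impI)
      show "mem x (points X)" by fact
      show "p j x = app t j" if "mem j J" for j using p[OF that x(1)] x(2) by simp
      fix U assume U: "mem U (opens X)" "mem x U"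
      obtain W where W: "W \<in> elts (opens (subspace pw F))" "elts W = app h ` elts U"
        using h_open[OF U(1)] unfolding open_in_def by blast
      then obtain W' where W': "mem W' (opens pw)" "app h ` elts U = elts W' \<inter> elts F"
        unfolding opens_F by auto
      have "app h x \<in> app h ` elts U" using U(2) by simp
      then have "mem t W'" unfolding W'(2) x(2) by simp
      then obtain V where V: "N V" "\<forall>x. mem x V \<longrightarrow> mem (app h x) W'"
        using small[OF W'(1)] by blast
      have "elts V \<subseteq> elts U"
      proof (rule subsetI)
        fix z assume z: "z \<in> elts V"
        then have zX: "mem z (points X)" using N_ne V(1) by (metis mem_elts subsetD)
        then have "app h z \<in> elts W' \<inter> elts F" using V(2) z h_F by simp
        then obtain u where u: "u \<in> elts U" "app h z = app h u" unfolding W'(2)[symmetric] by blast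
        moreover have "inj_on (app h) (pts)" using h_bij unfolding bij_betw_def by blast
        ultimately have "z = u"
          using zX open_points[OF U(1), of u] by (auto dest: inj_onD)
        then show "z \<in> elts U" using u(1) by simp
      qed
      then show "\<exists>V. N V \<and> elts V \<subseteq> elts U" using V(1) by blast
    qed
  qed
  then show ?thesis by (rule that)
qed

lemma clopen_zero_dimensional:
  assumes "\<And>U x. mem U (opens X) \<Longrightarrow> mem x U \<Longrightarrow> \<exists>A. clopen_in X (elts A) \<and> mem x A \<and> elts A \<subseteq> elts U"
  shows "zero_dimensional X"
  unfolding zero_dimensional_def is_base_def
  using assms clopen_in_iff by (metis mem_elts)

end

context coordinate_space
begin

lemmas dterm_coordinate_at [dfn] = dterm_fun2[of p, OF dterm_coordinate]

lemma coordinates_separate: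
  assumes xy: "mem x (points X)" "mem y (points X)" "x \<noteq> y"
  obtains A where "clopen_in X (elts A)" "mem x A" "\<not> mem y A"
proof -
  obtain j where j: "mem j J" "p j x \<noteq> p j y" using coordinate_eq[OF xy(1,2)] xy(3) by blast
  have "clopen_in X {z \<in> pts. p j z = p j x}"
    by (rule coordinate_clopen[OF j(1) coordinate_omega[OF j(1) xy(1)]])
  moreover from this obtain A where A: "elts A = {z \<in> pts. p j z = p j x}"
    by (rule clopen_inE)
  moreover have "mem z A \<longleftrightarrow> mem z (points X) \<and> p j z = p j x" for z
    using A mem_elts[of z A] by simp
  ultimately show thesis using j(2) xy by (intro that[of A]) simp_all
qed

lemma coordinates_T1: "T1_space X"
  unfolding T1_space_def closed_in_def
proof (intro ballI conjI)
  fix x assume x: "x \<in> pts"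
  then show "{x} \<subseteq> pts" by simp
  show "open_in X (pts - {x})"
  proof (rule open_if_locally)
    show "dpred (\<lambda>e. e 0 \<in> pts - {x})"
      unfolding Diff_iff singleton_iff by (intro dfn)
    fix y assume "y \<in> pts - {x}"
    then obtain A where A: "clopen_in X (elts A)" "mem y A" "\<not> mem x A"
      using coordinates_separate[of y x] x by auto
    then show "\<exists>U. open_in X U \<and> y \<in> U \<and> U \<subseteq> pts - {x}"
      using clopen_subset[OF A(1)] unfolding clopen_in_def by (intro exI[of _ "elts A"]) auto
  qed
qed

text \<open>The clopen neighbourhoods of a point \<open>x\<close> decide all coordinates with the values that they have at \<open>x\<close>. The point
  to which they converge therefore is \<open>x\<close>, and convergence says that they form a base at \<open>x\<close>.\<close>

lemma coordinates_zero_dimensional: "zero_dimensional X"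
proof (rule clopen_zero_dimensional)
  fix U x assume U: "mem U (opens X)" "mem x U"
  then have x: "mem x (points X)" using open_points by blast
  define N where "N V \<longleftrightarrow> clopen_in X (elts V) \<and> mem x V" for V

  define t where "t = lam J (\<lambda>j. p j x)"
  have dt: "dterm (\<lambda>e. p (e 0) x)" by (intro dfn)
  have t: "is_function t J omega" unfolding t_def by (rule lam_function[OF dt]) (use coordinate_omega x in auto)
  have t_app: "app t j = p j x" if "mem j J" for j unfolding t_def by (rule app_lam[OF dt that])
  have "\<exists>y. mem y (points X) \<and> (\<forall>j. mem j J \<longrightarrow> p j y = app t j) \<and>
      (\<forall>U. mem U (opens X) \<longrightarrow> mem y U \<longrightarrow> (\<exists>V. N V \<and> elts V \<subseteq> elts U))"
  proof (rule coordinate_limit)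
    show "dpred (\<lambda>e. N (e 0))" unfolding N_def by (intro dfn)
    show "is_function t J omega" by (rule t)
    show "N (points X)" using clopen_whole x by (simp add: N_def)
    show "elts V \<noteq> {} \<and> elts V \<subseteq> pts" if "N V" for V
      using that clopen_subset unfolding N_def by auto
    show "\<exists>Z. N Z \<and> elts Z \<subseteq> elts V \<inter> elts W" if "N V" "N W" for V W
    proof -
      have VW: "clopen_in X (elts V \<inter> elts W)" using that clopen_Int unfolding N_def by blast
      then obtain Z where Z: "elts Z = elts V \<inter> elts W" by (rule clopen_inE)
      then have "mem x Z" using that mem_elts[of x Z] unfolding N_def by simp
      then show ?thesis using VW Z unfolding N_def by (intro exI[of _ Z]) simp
    qed
    show "\<exists>V. N V \<and> (\<forall>y. mem y V \<longrightarrow> p j y = app t j)" if j: "mem j J" for j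
    proof -
      have *: "clopen_in X {y \<in> pts. p j y = p j x}" using coordinate_clopen coordinate_omega j x by blast
      then obtain Z where Z: "elts Z = {y \<in> pts. p j y = p j x}"
        by (rule clopen_inE)
      then have "mem y Z \<longleftrightarrow> mem y (points X) \<and> p j y = p j x" for y
        using mem_elts[of y Z] by simp
      then show ?thesis using * x t_app[OF j] Z unfolding N_def by (intro exI[of _ Z]) simp
    qed
  qed
  then obtain y where y: "mem y (points X)" "\<And>j. mem j J \<Longrightarrow> p j y = app t j"
    "\<And>U. mem U (opens X) \<Longrightarrow> mem y U \<Longrightarrow> \<exists>V. N V \<and> elts V \<subseteq> elts U" by blast
  have "y = x" by (rule coordinate_eq[OF y(1) x]) (simp add: y(2) t_app)
  then show "\<exists>A. clopen_in X (elts A) \<and> mem x A \<and> elts A \<subseteq> elts U"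
    using y(3)[of U] U unfolding N_def by blast
qed

end

section \<open>Isomorphisms of function rings\<close>

text \<open>The isomorphism turns every point \<open>y\<close> of \<^term>\<open>Y\<close> into a homomorphism \<open>ev y\<close> from the ring on
  \<^term>\<open>X\<close> to the real numbers. The aim is to show that these homomorphisms are evaluations at points
  of \<^term>\<open>X\<close>.\<close>

locale function_ring_iso = coordinate_space mem R rep X J p
  for mem :: "'v \<Rightarrow> 'v \<Rightarrow> bool" and R and rep :: "'k::linordered_field \<Rightarrow> 'v" and X J p +
  fixes Y :: "'v tspace" and \<phi> :: 'v
  assumes topology_Y: "topological_space Y"
    and phi_function: "is_function \<phi> (vset (carrier (U_aleph0 R X))) (vset (carrier (C_ring R Y)))"
    and phi_iso: "app \<phi> \<in> ring_iso (U_aleph0 R X) (C_ring R Y)"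
begin

interpretation Y: real_space mem R rep Y
  by unfold_locales (rule topology_Y)

definition ev :: "'v \<Rightarrow> ('v \<Rightarrow> 'k) \<Rightarrow> 'k" where
  "ev y F = val (apply0 \<phi> (mk F)) y"

lemma apply0_phi: "dfun F \<Longrightarrow> ucont F \<Longrightarrow> apply0 \<phi> (mk F) = app \<phi> (mk F)"
  by (rule apply0_eq[OF phi_function]) (subst mem_elts[symmetric], simp only: elts_carrier_U mk_carrier_U)

lemma phi_carrier: "dfun F \<Longrightarrow> ucont F \<Longrightarrow> app \<phi> (mk F) \<in> carrier (C_ring R Y)"
  using phi_iso mk_carrier_U[of F] unfolding ring_iso_def ring_hom_def by auto

lemma phi_eq: "dfun F \<Longrightarrow> ucont F \<Longrightarrow> app \<phi> (mk F) = Y.mk (\<lambda>y. ev y F)"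
  using Y.mk_val[of "app \<phi> (mk F)"] phi_carrier Y.carrier_C apply0_phi unfolding ev_def by auto

lemma dfun_ev: "dfun (\<lambda>y. ev y F)"
  unfolding ev_def by (intro dfn)

lemma cont_ev: "dfun F \<Longrightarrow> ucont F \<Longrightarrow> Y.cont (\<lambda>y. ev y F)"
  using phi_carrier phi_eq Y.mk_carrier_C[OF dfun_ev] by metis

lemma ev_cong:
  assumes "dfun F" "dfun G" "\<And>x. mem x (points X) \<Longrightarrow> F x = G x"
  shows "ev y F = ev y G"
  unfolding ev_def using mk_cong[OF assms] by simp

lemma phi_hom:
  assumes "f \<in> carrier (U_aleph0 R X)" "g \<in> carrier (U_aleph0 R X)"
  shows "app \<phi> (f \<oplus>\<^bsub>C_ring R X\<^esub> g) = app \<phi> f \<oplus>\<^bsub>C_ring R Y\<^esub> app \<phi> g"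
    and "app \<phi> (f \<otimes>\<^bsub>C_ring R X\<^esub> g) = app \<phi> f \<otimes>\<^bsub>C_ring R Y\<^esub> app \<phi> g"
  using phi_iso assms unfolding ring_iso_def ring_hom_def U_ring_simps by blast+

lemma ev_add:
  assumes F: "dfun F" "ucont F" and G: "dfun G" "ucont G" and FG: "ucont (\<lambda>x. F x + G x)"
    and y: "mem y (points Y)"
  shows "ev y (\<lambda>x. F x + G x) = ev y F + ev y G"
proof -
  have d: "dfun (\<lambda>x. F x + G x)" by (intro dfn F G)
  have "app \<phi> (mk (\<lambda>x. F x + G x)) = app \<phi> (mk F) \<oplus>\<^bsub>C_ring R Y\<^esub> app \<phi> (mk G)"
    using phi_hom(1)[of "mk F" "mk G"] F G by (simp add: mk_carrier_U C_ring_add)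
  also have "\<dots> = Y.mk (\<lambda>y. ev y F + ev y G)"
    unfolding phi_eq[OF F] phi_eq[OF G] by (rule Y.C_ring_add[OF dfun_ev dfun_ev])
  finally have *: "app \<phi> (mk (\<lambda>x. F x + G x)) = Y.mk (\<lambda>y. ev y F + ev y G)" .
  have d': "dfun (\<lambda>y. ev y F + ev y G)" by (intro dfn dfun_ev)
  show ?thesis
    unfolding ev_def[of y "\<lambda>x. F x + G x"] apply0_phi[OF d FG] * by (rule Y.val_mk[OF d' y])
qed

lemma ev_mult:
  assumes F: "dfun F" "ucont F" and G: "dfun G" "ucont G" and FG: "ucont (\<lambda>x. F x * G x)"
    and y: "mem y (points Y)"
  shows "ev y (\<lambda>x. F x * G x) = ev y F * ev y G"
proof -
  have d: "dfun (\<lambda>x. F x * G x)" by (intro dfn F G)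
  have "app \<phi> (mk (\<lambda>x. F x * G x)) = app \<phi> (mk F) \<otimes>\<^bsub>C_ring R Y\<^esub> app \<phi> (mk G)"
    using phi_hom(2)[of "mk F" "mk G"] F G by (simp add: mk_carrier_U C_ring_mult)
  also have "\<dots> = Y.mk (\<lambda>y. ev y F * ev y G)"
    unfolding phi_eq[OF F] phi_eq[OF G] by (rule Y.C_ring_mult[OF dfun_ev dfun_ev])
  finally have *: "app \<phi> (mk (\<lambda>x. F x * G x)) = Y.mk (\<lambda>y. ev y F * ev y G)" .
  have d': "dfun (\<lambda>y. ev y F * ev y G)" by (intro dfn dfun_ev)
  show ?thesis
    unfolding ev_def[of y "\<lambda>x. F x * G x"] apply0_phi[OF d FG] * by (rule Y.val_mk[OF d' y])
qed

lemma ucont_const: "ucont (\<lambda>x. c)"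
  by (rule ucont_lipschitz[OF ucont_chi[OF clopen_whole], of 1 "\<lambda>_. c"]) auto

lemma ev_one: "mem y (points Y) \<Longrightarrow> ev y (\<lambda>x. 1) = 1"
proof -
  assume y: "mem y (points Y)"
  have d: "dfun (\<lambda>x. 1)" by (intro dfn)
  have "app \<phi> (mk (\<lambda>x. 1)) = Y.mk (\<lambda>y. 1)"
    using phi_iso unfolding ring_iso_def ring_hom_def U_ring_simps C_ring_one Y.C_ring_one by auto
  then show ?thesis unfolding ev_def using apply0_phi[OF d ucont_const] Y.val_mk[OF d y] by simp
qed

text \<open>On constants \<open>ev y\<close> is an endomorphism of the real numbers. It is definable because
  \<^term>\<open>\<phi>\<close> is a set of the model.\<close>

lemma ev_const:
  assumes y: "mem y (points Y)"
  shows "ev y (\<lambda>x. c) = c"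
proof (rule real_endomorphism_id[of "\<lambda>c. ev y (\<lambda>x. c)"])
  show "dpred (\<lambda>e. ev y (\<lambda>x. rl (e 0)) = rl (e 0))"
    unfolding ev_def mk_def by (intro dfn)
  have d: "dfun (\<lambda>x. a)" for a by (intro dfn)
  show "ev y (\<lambda>x. a + b) = ev y (\<lambda>x. a) + ev y (\<lambda>x. b)" for a b
    by (rule ev_add[OF d ucont_const d ucont_const ucont_const y])
  show "ev y (\<lambda>x. a * b) = ev y (\<lambda>x. a) * ev y (\<lambda>x. b)" for a b
    by (rule ev_mult[OF d ucont_const d ucont_const ucont_const y])
  show "ev y (\<lambda>x. 1) = 1" by (rule ev_one[OF y])
qed

lemma ev_shift:
  assumes F: "dfun F" "ucont F" "ucont (\<lambda>x. F x - c)" and y: "mem y (points Y)"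
  shows "ev y (\<lambda>x. F x - c) = ev y F - c"
proof -
  have d: "dfun (\<lambda>x. F x - c)" "dfun (\<lambda>x. c)" by (intro dfn F)+
  have "ev y (\<lambda>x. (F x - c) + c) = ev y (\<lambda>x. F x - c) + ev y (\<lambda>x. c)"
    by (rule ev_add[OF d(1) F(3) d(2) ucont_const _ y]) (simp add: F)
  then show ?thesis by (simp add: ev_const[OF y])
qed

lemma dfun_chi: "dfun (chi A)"
  by (intro dfn)

lemma ev_chi_Int:
  assumes A: "clopen_in X (elts A)" and B: "clopen_in X (elts B)" and C: "elts C = elts A \<inter> elts B"
    and y: "mem y (points Y)"
  shows "ev y (chi C) = ev y (chi A) * ev y (chi B)"
proof -
  have "chi C = (\<lambda>x. chi A x * chi B x)"
    using C mem_elts[of _ C] by (auto simp: chi_def fun_eq_iff)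
  moreover have "ucont (chi C)" using A B C clopen_Int by (intro ucont_chi) simp
  ultimately show ?thesis
    using ev_mult[OF dfun_chi ucont_chi[OF A] dfun_chi ucont_chi[OF B] _ y] by simp
qed

lemma ev_chi_empty: "mem y (points Y) \<Longrightarrow> ev y (chi zero) = 0"
  using ev_const[of y 0] by (simp add: chi_def[abs_def])

text \<open>Composing the coordinate with an injection \<open>q\<close> of the natural numbers into the real numbers gives a
  member of the ring, which \<open>ev y\<close> sends to a number \<open>c\<close>. If \<open>c\<close> were not one of its values, its difference to \<open>c\<close>
  would be invertible, although \<open>ev y\<close> vanishes on it. So \<open>c\<close> is the image of some \<open>n\<close>, and the same
  argument shows that \<open>ev y\<close> vanishes on the function \<open>v\<close> that is 0 on the fibre over \<open>n\<close> and 1 elsewhere.\<close>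

lemma ev_coordinate:
  assumes y: "mem y (points Y)" and j: "mem j J"
  obtains n A where "mem n omega" "elts A = {x \<in> pts. p j x = n}" "ev y (chi A) = 1"
proof -
  obtain q :: "'v \<Rightarrow> 'k" where q: "dterm (\<lambda>e. rep (q (e 0)))"
    "\<And>m n. mem m omega \<Longrightarrow> mem n omega \<Longrightarrow> q m = q n \<Longrightarrow> m = n"
    by (rule integer_sequence) blast
  note q' [dfn] = dfun_at[OF q(1)]
  have dp: "dterm (\<lambda>e. p j (e 0))" by (intro dfn)
  have ucont_p: "ucont (\<lambda>x. G (p j x))" for G
    by (rule ucont_factor[OF dp coordinate_omega[OF j] coordinate_clopen[OF j]])
  define c where "c = ev y (\<lambda>x. q (p j x))"
  define v :: "'v \<Rightarrow> 'k" where "v x = (if q (p j x) = c then 0 else 1)" for x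
  have dv: "dfun v" unfolding v_def by (intro dfn)
  have uv: "ucont v" unfolding v_def by (rule ucont_p[of "\<lambda>n. if q n = c then 0 else 1"])
  have v0: "ev y v = 0"
  proof -
    define w where "w x = (if q (p j x) = c then 0 else 1 / (q (p j x) - c))" for x
    have dw: "dfun w" unfolding w_def by (intro dfn)
    have uw: "ucont w" unfolding w_def by (rule ucont_p[of "\<lambda>n. if q n = c then 0 else 1 / (q n - c)"])
    have du: "dfun (\<lambda>x. q (p j x))" "dfun (\<lambda>x. q (p j x) - c)" by (intro dfn)+
    have uu: "ucont (\<lambda>x. q (p j x) - c)" by (rule ucont_p[of "\<lambda>n. q n - c"])
    have "v = (\<lambda>x. (q (p j x) - c) * w x)" by (auto simp: v_def w_def)
    then have "ev y v = ev y (\<lambda>x. q (p j x) - c) * ev y w"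
      using ev_mult[OF du(2) uu dw uw _ y] uv by simp
    also have "ev y (\<lambda>x. q (p j x) - c) = 0"
      using ev_shift[OF du(1) ucont_p uu y] by (simp add: c_def)
    finally show ?thesis by simp
  qed
  have "\<exists>n. mem n omega \<and> q n = c"
  proof (rule ccontr)
    assume "\<not> ?thesis"
    then have "v x = 1" if "mem x (points X)" for x
      using coordinate_omega[OF j that] by (auto simp: v_def)
    then have "ev y v = ev y (\<lambda>x. 1)"
      by (intro ev_cong dv) (intro dfn)
    then show False using v0 ev_one[OF y] by simp
  qed
  then obtain n where n: "mem n omega" "q n = c" by blast
  have clopen: "clopen_in X {x \<in> pts. p j x = n}" by (rule coordinate_clopen[OF j n(1)])
  then obtain A where A: "elts A = {x \<in> pts. p j x = n}" by (rule clopen_inE)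
  have uA: "ucont (chi A)" by (rule ucont_chi) (simp only: A clopen)
  have eq: "v x + chi A x = 1" if x: "mem x (points X)" for x
  proof -
    have "mem x A \<longleftrightarrow> p j x = n" using A x mem_elts[of x A] by simp
    moreover have "q (p j x) = c \<longleftrightarrow> p j x = n"
      using q(2)[OF coordinate_omega[OF j x] n(1)] n(2) by metis
    ultimately show ?thesis unfolding v_def chi_def by simp
  qed
  have u1: "ucont (\<lambda>x. v x + chi A x)"
    using ucont_cong[of "\<lambda>x. v x + chi A x" "\<lambda>x. 1"] eq ucont_const by simp
  have "ev y (\<lambda>x. v x + chi A x) = ev y (\<lambda>x. 1)"
    by (rule ev_cong) (intro dfn dv dfun_chi, intro dfn, rule eq)
  then have "ev y v + ev y (chi A) = 1"
    using ev_add[OF dv uv dfun_chi uA u1 y] ev_one[OF y] by simp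
  then show ?thesis using v0 n(1) A that by simp
qed

text \<open>The clopen sets on whose characteristic functions \<open>ev y\<close> is 1 decide every coordinate, so they
  converge to a point.\<close>

lemma ev_point:
  assumes y: "mem y (points Y)"
  obtains x where "mem x (points X)" "\<And>A. clopen_in X (elts A) \<Longrightarrow> mem x A \<Longrightarrow> ev y (chi A) = 1"
proof -
  define N where "N V \<longleftrightarrow> clopen_in X (elts V) \<and> ev y (chi V) = 1" for V
  have dN: "dpred (\<lambda>e. N (e 0))" unfolding N_def ev_def mk_def by (intro dfn)
  have N_Int: "N C" if "N A" "N B" "elts C = elts A \<inter> elts B" for A B C
    using that ev_chi_Int[of A B C y] y clopen_Int[of "elts A" "elts B"] unfolding N_def by simp
  have N_ne: "elts V \<noteq> {}" if "N V" for V
  proof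
    assume "elts V = {}"
    then have "V = zero" by (metis elts_empty elts_inject)
    then show False using that ev_chi_empty[OF y] unfolding N_def by simp
  qed
  \<comment> \<open>K j n says that coordinate j has the value n at the point to be found.\<close>
  define K where "K j n \<longleftrightarrow> N (sep (points X) (\<lambda>x. p j x = n))" for j n
  have K_elts: "elts (sep (points X) (\<lambda>x. p j x = n)) = {x \<in> pts. p j x = n}" for j n
    by (rule elts_sep) (intro dfn)
  have K_ex: "\<exists>n. mem n omega \<and> K j n" if j: "mem j J" for j
  proof -
    obtain n A where n: "mem n omega" "elts A = {x \<in> pts. p j x = n}" "ev y (chi A) = 1"
      by (rule ev_coordinate[OF y j])
    then have "A = sep (points X) (\<lambda>x. p j x = n)" using K_elts elts_inject by metis
    then show ?thesis using n coordinate_clopen[OF j n(1)] unfolding K_def N_def by auto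
  qed
  have K_unique: "m = n" if "K j m" "K j n" for j m n
  proof (rule ccontr)
    assume "m \<noteq> n"
    have "N zero"
      by (rule N_Int[OF that[unfolded K_def]]) (use \<open>m \<noteq> n\<close> in \<open>auto simp: K_elts\<close>)
    then show False using N_ne[of zero] by simp
  qed
  define t where "t = sep (cartesian J omega) (\<lambda>r. \<exists>j\<in>elts J. \<exists>n\<in>elts omega. r = opair j n \<and> K j n)"
  have dt: "dpred (\<lambda>e. \<exists>j\<in>elts J. \<exists>n\<in>elts omega. e 0 = opair j n \<and> K j n)"
    unfolding K_def N_def ev_def mk_def by (intro dfn)
  have mem_t: "mem (opair j n) t \<longleftrightarrow> mem j J \<and> mem n omega \<and> K j n" for j n
    unfolding t_def mem_sep[OF dt] by auto
  have t: "is_function t J omega"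
    unfolding is_function_def
  proof (intro conjI ballI)
    show "elts t \<subseteq> elts (cartesian J omega)" unfolding t_def elts_sep[OF dt] by blast
    show "\<exists>!n. opair j n \<in> elts t" if "j \<in> elts J" for j
      using K_ex[of j] K_unique[of j] that mem_t by auto
  qed
  have t_app: "K j (app t j)" if "mem j J" for j
    using function_graph[OF t that, of "app t j"] mem_t by simp
  have "\<exists>x. mem x (points X) \<and> (\<forall>j. mem j J \<longrightarrow> p j x = app t j) \<and>
      (\<forall>U. mem U (opens X) \<longrightarrow> mem x U \<longrightarrow> (\<exists>V. N V \<and> elts V \<subseteq> elts U))"
  proof (rule coordinate_limit[OF dN t])
    show "N (points X)"
    proof -
      have "ev y (chi (points X)) = ev y (\<lambda>x. 1)"
        by (rule ev_cong[OF dfun_chi]) (intro dfn, simp add: chi_def)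
      then show ?thesis using clopen_whole ev_one[OF y] unfolding N_def by simp
    qed
    show "elts V \<noteq> {} \<and> elts V \<subseteq> pts" if "N V" for V
      using N_ne[OF that] that clopen_subset unfolding N_def by blast
    show "\<exists>Z. N Z \<and> elts Z \<subseteq> elts V \<inter> elts W" if "N V" "N W" for V W
    proof -
      have "clopen_in X (elts V \<inter> elts W)" using that clopen_Int unfolding N_def by blast
      then obtain Z where "elts Z = elts V \<inter> elts W" by (rule clopen_inE)
      then show ?thesis using N_Int[OF that] by blast
    qed
    show "\<exists>V. N V \<and> (\<forall>x. mem x V \<longrightarrow> p j x = app t j)" if "mem j J" for j
    proof -
      have d: "dpred (\<lambda>e. p j (e 0) = app t j)" by (intro dfn)
      show ?thesis using t_app[OF that] mem_sep[OF d, of _ "points X"] unfolding K_def by blast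
    qed
  qed
  then obtain x where x: "mem x (points X)" "\<And>U. mem U (opens X) \<Longrightarrow> mem x U \<Longrightarrow> \<exists>V. N V \<and> elts V \<subseteq> elts U"
    by blast
  show ?thesis
  proof (rule that[OF x(1)])
    fix A assume A: "clopen_in X (elts A)" "mem x A"
    then obtain V where V: "N V" "elts V \<subseteq> elts A"
      using x(2)[of A] unfolding clopen_in_iff by blast
    then have "ev y (chi V) = ev y (chi V) * ev y (chi A)"
      using A(1) y unfolding N_def by (intro ev_chi_Int) auto
    then show "ev y (chi A) = 1" using V(1) unfolding N_def by simp
  qed
qed

text \<open>Suppose \<open>c = ev y F\<close> differs from \<open>F x\<close>. Near \<open>x\<close>, on a clopen set \<open>A\<close>, the
  difference \<open>F - c\<close> keeps its sign and a distance \<open>d\<close> from 0. Its truncation to the interval from \<open>-d\<close> to \<open>d\<close>, divided by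
  \<open>d\<close>, is a multiple of \<open>F - c\<close> in the ring, on which \<open>ev y\<close> vanishes. But on \<open>A\<close> it
  is the constant 1 or -1, so \<open>ev y\<close> would vanish on the characteristic function of \<open>A\<close>.\<close>

lemma ev_eq_value:
  assumes y: "mem y (points Y)" and x: "mem x (points X)"
    and chi: "\<And>A. clopen_in X (elts A) \<Longrightarrow> mem x A \<Longrightarrow> ev y (chi A) = 1"
    and F: "dfun F" "ucont F"
  shows "ev y F = F x"
proof (rule ccontr)
  assume neq: "ev y F \<noteq> F x"
  note F' [dfn] = dfun_at[OF F(1)]
  define c where "c = ev y F"
  define d where "d = \<bar>F x - c\<bar> / 2"
  have d: "0 < d" "\<bar>F x - c\<bar> = 2 * d" using neq by (auto simp: d_def c_def)
  obtain g \<A> where "injects g \<A> omega" and cover: "\<And>x. mem x (points X) \<Longrightarrow> \<exists>A. mem A \<A> \<and> mem x A"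
    "\<And>A. mem A \<A> \<Longrightarrow> clopen_in X (elts A)"
    "\<And>A x y. mem A \<A> \<Longrightarrow> mem x A \<Longrightarrow> mem y A \<Longrightarrow> \<bar>F x - F y\<bar> \<le> d"
    by (rule ucontE[OF F(2) d(1)]) (rule that)
  obtain A where A: "clopen_in X (elts A)" "mem x A" "\<And>z. mem z A \<Longrightarrow> \<bar>F z - F x\<bar> \<le> d"
    using cover(1)[OF x] cover(2,3) by blast
  define \<sigma> :: 'k where "\<sigma> = (if c \<le> F x then 1 else - 1)"
  define k where "k t = 1 / max \<bar>t - c\<bar> d" for t
  define clip where "clip t = max (- 1) (min 1 ((t - c) / d))" for t
  \<comment> \<open>Lipschitz functions of F are in the ring; this is why division is truncated.\<close>
  have clip_eq: "clip t = (t - c) * k t" for t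
    using d(1) unfolding clip_def k_def by (auto simp: max_def min_def abs_if field_simps split: if_splits)
  have m_pos: "d \<le> max \<bar>t - c\<bar> d" for t by simp
  have k_lip: "\<bar>k s - k t\<bar> \<le> (1 / (d * d)) * \<bar>s - t\<bar>" for s t
  proof -
    let ?a = "max \<bar>s - c\<bar> d" and ?b = "max \<bar>t - c\<bar> d"
    have ab: "0 < ?a" "0 < ?b" "d * d \<le> ?a * ?b"
      using d(1) m_pos[of s] m_pos[of t] by (auto intro: less_le_trans mult_mono)
    have "\<bar>k s - k t\<bar> = \<bar>?b - ?a\<bar> / (?a * ?b)"
      using ab unfolding k_def by (simp add: diff_frac_eq abs_mult del: max_less_iff_conj less_max_iff_disj)
    also have "\<dots> \<le> \<bar>s - t\<bar> / (?a * ?b)"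
      using ab by (intro divide_right_mono) (auto simp: max_def abs_if)
    also have "\<dots> \<le> \<bar>s - t\<bar> / (d * d)"
      using ab d(1) by (intro divide_left_mono) auto
    finally show ?thesis by simp
  qed
  have clip_lip: "\<bar>clip s - clip t\<bar> \<le> (1 / d) * \<bar>s - t\<bar>" for s t
  proof -
    have "\<bar>max (- 1) (min 1 a) - max (- 1) (min 1 b)\<bar> \<le> \<bar>a - b\<bar>" for a b :: 'k
      by (auto simp: max_def min_def abs_if)
    then have "\<bar>clip s - clip t\<bar> \<le> \<bar>(s - c) / d - (t - c) / d\<bar>"
      unfolding clip_def by blast
    also have "\<dots> = \<bar>(s - t) / d\<bar>" by (simp add: diff_divide_distrib)
    also have "\<dots> = (1 / d) * \<bar>s - t\<bar>" using d(1) by (simp add: abs_divide)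
    finally show ?thesis .
  qed
  have u: "ucont (\<lambda>x. F x - c)" "ucont (\<lambda>x. k (F x))" "ucont (\<lambda>x. clip (F x))" "ucont (\<lambda>x. \<sigma> * chi A x)"
  proof -
    show "ucont (\<lambda>x. F x - c)" by (rule ucont_lipschitz[OF F(2), of 1 "\<lambda>t. t - c"]) auto
    show "ucont (\<lambda>x. k (F x))" by (rule ucont_lipschitz[OF F(2) _ k_lip]) (use d in simp)
    show "ucont (\<lambda>x. clip (F x))" by (rule ucont_lipschitz[OF F(2) _ clip_lip]) (use d in simp)
    show "ucont (\<lambda>x. \<sigma> * chi A x)"
      by (rule ucont_lipschitz[OF ucont_chi[OF A(1)], of 1 "\<lambda>t. \<sigma> * t"]) (auto simp: \<sigma>_def)
  qed
  have df: "dfun (\<lambda>x. F x - c)" "dfun (\<lambda>x. k (F x))" "dfun (\<lambda>x. clip (F x))" "dfun (\<lambda>x. \<sigma> * chi A x)"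
    unfolding k_def clip_def by (intro dfn)+
  have "ev y (\<lambda>x. F x - c) = 0"
    using ev_shift[OF F u(1) y] by (simp add: c_def)
  then have "ev y (\<lambda>x. clip (F x)) = 0"
    using ev_mult[OF df(1) u(1) df(2) u(2) _ y] u(3) unfolding clip_eq by simp
  moreover have eq: "(\<lambda>x. clip (F x) * chi A x) = (\<lambda>x. \<sigma> * chi A x)"
  proof
    fix z
    have "clip (F z) = \<sigma>" if z: "mem z A"
    proof (cases "c \<le> F x")
      case True
      then have "d \<le> F z - c" using d A(3)[OF z] by (auto simp: abs_if split: if_splits)
      then show ?thesis using True d(1) by (simp add: clip_def \<sigma>_def pos_le_divide_eq)
    next
      case False
      then have "F z - c \<le> - d" using d A(3)[OF z] by (auto simp: abs_if split: if_splits)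
      then have "(F z - c) / d \<le> - 1" using d(1) by (simp add: pos_divide_le_eq)
      then show ?thesis using False by (simp add: clip_def \<sigma>_def)
    qed
    then show "clip (F z) * chi A z = \<sigma> * chi A z" by (simp add: chi_def)
  qed
  ultimately have "ev y (\<lambda>x. \<sigma> * chi A x) = 0"
    using ev_mult[OF df(3) u(3) dfun_chi ucont_chi[OF A(1)] _ y] u(4) by simp
  moreover have "(\<lambda>x. (\<sigma> * chi A x) * (\<sigma> * chi A x)) = chi A"
    by (auto simp: fun_eq_iff \<sigma>_def chi_def)
  ultimately have "ev y (chi A) = 0"
    using ev_mult[OF df(4) u(4) df(4) u(4) _ y] ucont_chi[OF A(1)] by simp
  then show False using chi[OF A(1,2)] by simp
qed

text \<open>Sending \<open>y\<close> to the point at which \<open>ev y\<close> evaluates is a continuous map \<open>h\<close> from \<^term>\<open>Y\<close> to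
  \<^term>\<open>X\<close> with dense range, and \<^term>\<open>\<phi>\<close> is composition with \<open>h\<close>. A continuous function \<open>F\<close> on
  \<^term>\<open>X\<close> yields the continuous function \<open>F \<circ> h\<close> on \<^term>\<open>Y\<close>. By surjectivity \<open>F \<circ> h = F1 \<circ> h\<close> for some
  \<open>F1\<close> in the ring on \<^term>\<open>X\<close>, and density gives \<open>F = F1\<close>.\<close>

theorem cont_imp_ucont:
  assumes F: "dfun F" "cont F"
  shows "ucont F"
proof -
  note F' [dfn] = dfun_at[OF F(1)]
  have base: "\<exists>A. clopen_in X (elts A) \<and> mem x A \<and> elts A \<subseteq> elts U" if "mem U (opens X)" "mem x U" for U x
    using coordinates_zero_dimensional that unfolding zero_dimensional_def is_base_def
    by (metis mem_elts)
  define H where "H y x \<longleftrightarrow> (\<forall>A. clopen_in X (elts A) \<longrightarrow> mem x A \<longrightarrow> ev y (chi A) = 1)" for y x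
  have H_unique: "x = x'" if y: "mem y (points Y)" and x: "mem x (points X)" "H y x" "mem x' (points X)" "H y x'" for y x x'
  proof (rule ccontr)
    assume "x \<noteq> x'"
    then obtain A where A: "clopen_in X (elts A)" "mem x A" "\<not> mem x' A"
      using coordinates_separate[OF x(1,3)] by blast
    obtain B where B: "elts B = pts - elts A" by (rule clopen_inE[OF clopen_Compl[OF A(1)]])
    have B': "clopen_in X (elts B)" "mem x' B"
      using clopen_Compl[OF A(1)] B A(3) x(3) mem_elts[of x' B] by simp_all
    have "ev y (chi zero) = ev y (chi A) * ev y (chi B)"
      by (rule ev_chi_Int[OF A(1) B'(1) _ y]) (auto simp: B)
    then show False
      using x(2,4) A B' ev_chi_empty[OF y] unfolding H_def by simp
  qed
  define h where "h = sep (cartesian (points Y) (points X))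
    (\<lambda>r. \<exists>y\<in>elts (points Y). \<exists>x\<in>pts. r = opair y x \<and> H y x)"
  have dh: "dpred (\<lambda>e. \<exists>y\<in>elts (points Y). \<exists>x\<in>pts. e 0 = opair y x \<and> H y x)"
    unfolding H_def ev_def mk_def by (intro dfn)
  have mem_h: "mem (opair y x) h \<longleftrightarrow> mem y (points Y) \<and> mem x (points X) \<and> H y x" for y x
    unfolding h_def mem_sep[OF dh] by auto
  have h: "is_function h (points Y) (points X)"
    unfolding is_function_def
  proof (intro conjI ballI)
    show "elts h \<subseteq> elts (cartesian (points Y) (points X))" unfolding h_def elts_sep[OF dh] by blast
    fix y assume "y \<in> elts (points Y)"
    then have y: "mem y (points Y)" by simp
    obtain x where "mem x (points X)" "H y x" unfolding H_def by (rule ev_point[OF y]) blast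
    then show "\<exists>!x. opair y x \<in> elts h"
      using H_unique[OF y] mem_h y by (intro ex1I[of _ x]) auto
  qed
  have hX: "mem (app h y) (points X)" and hH: "H y (app h y)" if "mem y (points Y)" for y
    using function_graph[OF h that, of "app h y"] mem_h by simp_all
  have ev_h: "ev y G = G (app h y)" if "dfun G" "ucont G" "mem y (points Y)" for G y
    using ev_eq_value[OF that(3) hX[OF that(3)] _ that(1,2)] hH[OF that(3)] unfolding H_def by blast
  define G where "G y = F (apply0 h y)" for y
  have dG: "dfun G" unfolding G_def by (intro dfn)
  have G: "G y = F (app h y)" if "mem y (points Y)" for y
    unfolding G_def apply0_eq[OF h that] ..
  have "Y.cont G"
    unfolding Y.cont_def
  proof (intro ballI allI impI)
    fix y and d :: 'k assume "y \<in> elts (points Y)" and d: "0 < d"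
    then have y: "mem y (points Y)" by simp
    obtain U where U: "mem U (opens X)" "mem (app h y) U" "\<forall>z\<in>elts U. \<bar>F z - F (app h y)\<bar> < d"
      using F(2) hX[OF y] d unfolding cont_def by (metis mem_elts)
    obtain A where A: "clopen_in X (elts A)" "mem (app h y) A" "elts A \<subseteq> elts U"
      using base[OF U(1,2)] by blast
    have chi_h: "ev z (chi A) = chi A (app h z)" if "mem z (points Y)" for z
      by (rule ev_h[OF dfun_chi ucont_chi[OF A(1)] that])
    obtain W where W: "mem W (opens Y)" "mem y W" "\<forall>z\<in>elts W. \<bar>ev z (chi A) - ev y (chi A)\<bar> < 1"
      using cont_ev[OF dfun_chi ucont_chi[OF A(1)]] y unfolding Y.cont_def by (metis mem_elts zero_less_one)
    have "\<bar>G z - G y\<bar> < d" if z: "mem z W" for z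
    proof -
      have zY: "mem z (points Y)" using Y.open_points[OF W(1) z] .
      have "\<bar>chi A (app h z) - 1\<bar> < 1"
        using W(3)[rule_format, of z] z A(2) chi_h[OF zY] chi_h[OF y] by (simp add: chi_def[of A "app h y"])
      then have "mem (app h z) A" by (auto simp: chi_def split: if_splits)
      then show ?thesis using A(3) U(3) by (auto simp: G[OF zY] G[OF y] subset_iff)
    qed
    then show "\<exists>W. mem W (opens Y) \<and> mem y W \<and> (\<forall>z\<in>elts W. \<bar>G z - G y\<bar> < d)"
      using W by auto
  qed
  then have "Y.mk G \<in> carrier (C_ring R Y)" using Y.mk_carrier_C[OF dG] by simp
  then obtain g where g: "g \<in> carrier (U_aleph0 R X)" "app \<phi> g = Y.mk G"
    using phi_iso unfolding ring_iso_def bij_betw_def by (smt (verit) imageE mem_Collect_eq)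
  define F1 where "F1 = val g"
  have F1: "dfun F1" "ucont F1" "mk F1 = g"
    using g(1) dfun_val mk_val unfolding carrier_U F1_def by auto
  have agree: "F1 (app h y) = F (app h y)" if y: "mem y (points Y)" for y
  proof -
    have "F1 (app h y) = ev y F1" using ev_h[OF F1(1,2) y] by simp
    also have "\<dots> = val (Y.mk G) y"
      using apply0_phi[OF F1(1,2)] F1(3) g(2) unfolding ev_def by simp
    also have "\<dots> = F (app h y)" using Y.val_mk[OF dG y] G[OF y] by simp
    finally show ?thesis .
  qed
  have "F1 x = F x" if x: "mem x (points X)" for x
  proof (rule ccontr)
    assume neq: "F1 x \<noteq> F x"
    have "open_in X {x \<in> pts. F1 x \<noteq> F x}"
      by (rule open_neq[OF F1(1) ucont_cont[OF F1(2)] F])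
    then obtain U where U: "mem U (opens X)" "elts U = {x \<in> pts. F1 x \<noteq> F x}"
      by (rule open_inE)
    have "mem x U" using U(2) x neq mem_elts[of x U] by simp
    then obtain A where A: "clopen_in X (elts A)" "mem x A" "elts A \<subseteq> elts U"
      using base[OF U(1)] by blast
    \<comment> \<open>A clopen set that misses the range of h has a characteristic function in the kernel; this
    is the density of the range.\<close>
    have "ev y (chi A) = ev y (chi zero)" if y: "mem y (points Y)" for y
    proof -
      have "\<not> mem (app h y) A" using agree[OF y] A(3) unfolding U(2) by auto
      then show ?thesis
        using ev_h[OF dfun_chi ucont_chi[OF A(1)] y] ev_chi_empty[OF y] by (simp add: chi_def)
    qed
    then have "Y.mk (\<lambda>y. ev y (chi A)) = Y.mk (\<lambda>y. ev y (chi zero))"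
      by (intro Y.mk_cong dfun_ev)
    moreover have u0: "ucont (chi zero)" by (rule ucont_chi) (simp add: clopen_empty)
    ultimately have "app \<phi> (mk (chi A)) = app \<phi> (mk (chi zero))"
      using phi_eq[OF dfun_chi ucont_chi[OF A(1)]] phi_eq[OF dfun_chi u0] by simp
    moreover have "inj_on (app \<phi>) (carrier (U_aleph0 R X))"
      using phi_iso unfolding ring_iso_def bij_betw_def by blast
    ultimately have "mk (chi A) = mk (chi zero)"
      using mk_carrier_U[OF dfun_chi] ucont_chi[OF A(1)] u0 by (meson inj_onD)
    then have "chi A x = chi zero x"
      using val_mk[OF dfun_chi x] by metis
    then show False using A(2) by (simp add: chi_def)
  qed
  then show ?thesis using ucont_cong[of F1 F] F1(2) by blast
qed

end

section \<open>The equivalence\<close>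

context real_space
begin

lemma cont_add:
  assumes F: "cont F" and G: "cont G"
  shows "cont (\<lambda>x. F x + G x)"
  unfolding cont_def
proof (intro ballI allI impI)
  fix x and d :: 'k assume "x \<in> pts" and "0 < d"
  then have x: "mem x (points X)" and d: "0 < d / 2" by simp_all
  obtain W where W: "mem W (opens X)" "mem x W" "\<And>z. mem z W \<Longrightarrow> \<bar>F z - F x\<bar> < d / 2"
    "\<And>z. mem z W \<Longrightarrow> \<bar>G z - G x\<bar> < d / 2"
    by (rule cont_commonE[OF F G x d]) (rule that)
  have "\<bar>(F z + G z) - (F x + G x)\<bar> < d" if "mem z W" for z
  proof -
    from W(3,4)[OF that] have "\<bar>F z - F x\<bar> + \<bar>G z - G x\<bar> < d" using add_strict_mono by fastforce
    then show ?thesis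
      using abs_triangle_ineq[of "F z - F x" "G z - G x"] by (simp add: algebra_simps)
  qed
  then show "\<exists>U. mem U (opens X) \<and> mem x U \<and> (\<forall>z\<in>elts U. \<bar>(F z + G z) - (F x + G x)\<bar> < d)"
    using W(1,2) by (intro exI[of _ W]) simp
qed

lemma cont_mult:
  assumes F: "cont F" and G: "cont G"
  shows "cont (\<lambda>x. F x * G x)"
  unfolding cont_def
proof (intro ballI allI impI)
  fix x and d :: 'k assume "x \<in> pts" and d: "0 < d"
  then have x: "mem x (points X)" by simp
  define M where "M = \<bar>F x\<bar> + \<bar>G x\<bar> + 1"
  have M: "0 < M" unfolding M_def by (simp add: add_nonneg_pos)
  define r where "r = min 1 (d / (2 * M))"
  have "r \<le> d / (2 * M)" by (simp add: r_def)
  then have "r * (2 * M) \<le> d" using M by (simp add: pos_le_divide_eq)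
  then have r: "0 < r" "r \<le> 1" "r * M \<le> d / 2" using d M by (auto simp: r_def)
  obtain W where W: "mem W (opens X)" "mem x W" "\<And>z. mem z W \<Longrightarrow> \<bar>F z - F x\<bar> < r"
    "\<And>z. mem z W \<Longrightarrow> \<bar>G z - G x\<bar> < r"
    by (rule cont_commonE[OF F G x r(1)]) (rule that)
  have "\<bar>F z * G z - F x * G x\<bar> < d" if "mem z W" for z
  proof -
    note z = W(3,4)[OF that, THEN less_imp_le]
    have Gz: "\<bar>G z\<bar> \<le> \<bar>G x\<bar> + 1" using z(2) r(2) by (simp add: abs_if split: if_splits)
    have "\<bar>F z * G z - F x * G x\<bar> = \<bar>(F z - F x) * G z + F x * (G z - G x)\<bar>"
      by (simp add: algebra_simps)
    also have "\<dots> \<le> \<bar>F z - F x\<bar> * \<bar>G z\<bar> + \<bar>F x\<bar> * \<bar>G z - G x\<bar>"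
      by (metis abs_mult abs_triangle_ineq)
    also have "\<dots> \<le> r * (\<bar>G x\<bar> + 1) + \<bar>F x\<bar> * r"
      using z Gz r(1) by (intro add_mono mult_mono) auto
    also have "\<dots> = r * M" by (simp add: M_def algebra_simps)
    also have "\<dots> \<le> d / 2" by (rule r(3))
    also have "\<dots> < d" using d by simp
    finally show ?thesis .
  qed
  then show "\<exists>U. mem U (opens X) \<and> mem x U \<and> (\<forall>z\<in>elts U. \<bar>F z * G z - F x * G x\<bar> < d)"
    using W(1,2) by (intro exI[of _ W]) simp
qed

text \<open>The identity has to be a homomorphism on the carrier, which therefore must be closed under the
  operations.\<close>

lemma isomorphic_rings_refl:
  assumes eq: "carrier (U_aleph0 R X) = carrier (C_ring R X)"
  shows "isomorphic_rings (U_aleph0 R X) (C_ring R X)"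
proof -
  define C where "C = vset (carrier (C_ring R X))"
  have C: "elts C = carrier (C_ring R X)" unfolding C_def by (rule elts_carrier_C)
  have d: "dterm (\<lambda>e. e 0)" by (intro dfn)
  define i where "i = lam C (\<lambda>f. f)"
  have i: "is_function i C C" unfolding i_def by (rule lam_function[OF d]) simp
  have app_i: "app i f = f" if "f \<in> carrier (C_ring R X)" for f
    unfolding i_def by (rule app_lam[OF d]) (use that C mem_elts in blast)
  have closed: "f \<otimes>\<^bsub>C_ring R X\<^esub> g \<in> carrier (C_ring R X)" "f \<oplus>\<^bsub>C_ring R X\<^esub> g \<in> carrier (C_ring R X)"
    if "f \<in> carrier (C_ring R X)" "g \<in> carrier (C_ring R X)" for f g
  proof -
    have f: "mk (val f) = f" "cont (val f)" and g: "mk (val g) = g" "cont (val g)"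
      using that mk_val unfolding carrier_C by auto
    have d: "dfun (\<lambda>x. val f x * val g x)" "dfun (\<lambda>x. val f x + val g x)" by (intro dfn)+
    show "f \<otimes>\<^bsub>C_ring R X\<^esub> g \<in> carrier (C_ring R X)"
      using C_ring_mult[OF dfun_val dfun_val, of f g] mk_carrier_C[OF d(1)] cont_mult[OF f(2) g(2)] f(1) g(1)
      by simp
    show "f \<oplus>\<^bsub>C_ring R X\<^esub> g \<in> carrier (C_ring R X)"
      using C_ring_add[OF dfun_val dfun_val, of f g] mk_carrier_C[OF d(2)] cont_add[OF f(2) g(2)] f(1) g(1)
      by simp
  qed
  have one: "\<one>\<^bsub>C_ring R X\<^esub> \<in> carrier (C_ring R X)"
  proof -
    have "dfun (\<lambda>x. 1)" by (intro dfn)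
    moreover have "cont (\<lambda>x. 1)"
      using open_in_elts[THEN iffD1, OF open_whole] unfolding cont_def by auto
    ultimately show ?thesis unfolding C_ring_one by (simp add: mk_carrier_C)
  qed
  have "app i \<in> ring_iso (U_aleph0 R X) (C_ring R X)"
    unfolding ring_iso_def ring_hom_def eq U_ring_simps
    using closed one by (auto simp: app_i bij_betw_def inj_on_def image_def)
  then show ?thesis
    unfolding isomorphic_rings_def eq using i unfolding C_def by blast
qed

text \<open>For the forward implication \<^term>\<open>X\<close> itself serves as \<^term>\<open>Y\<close>, because both rings have the same
  elements. Conversely, if the rings are isomorphic, every continuous function on \<^term>\<open>X\<close> has
  small oscillation on countable clopen covers, and if all of them do, disjoint zero-sets are
  separated.\<close>

theorem strongly_zero_dimensional_iff:
  assumes N: "N_compact X" and CMC: CMC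
  shows "strongly_zero_dimensional R X \<longleftrightarrow>
    (\<exists>Y. topological_space Y \<and> Tychonoff R Y \<and> isomorphic_rings (U_aleph0 R X) (C_ring R Y))"
proof
  obtain J p where "coordinate_space mem R rep X J p" by (rule N_compact_coordinates[OF N])
  then interpret coordinate_space mem R rep X J p .
  {
    assume szd: "strongly_zero_dimensional R X"
    have "carrier (U_aleph0 R X) = carrier (C_ring R X)"
      unfolding set_eq_iff carrier_U carrier_C
      using strongly_zero_dimensional_cont_ucont[OF szd CMC dfun_val] ucont_cont by blast
    then have "isomorphic_rings (U_aleph0 R X) (C_ring R X)" by (rule isomorphic_rings_refl)
    moreover have "Tychonoff R X"
      using szd coordinates_T1 unfolding Tychonoff_def strongly_zero_dimensional_def by blast
    ultimately show "\<exists>Y. topological_space Y \<and> Tychonoff R Y \<and> isomorphic_rings (U_aleph0 R X) (C_ring R Y)"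
      using topology by blast
  next
    assume "\<exists>Y. topological_space Y \<and> Tychonoff R Y \<and> isomorphic_rings (U_aleph0 R X) (C_ring R Y)"
    then obtain Y \<phi> where Y: "topological_space Y"
      "is_function \<phi> (vset (carrier (U_aleph0 R X))) (vset (carrier (C_ring R Y)))"
      "app \<phi> \<in> ring_iso (U_aleph0 R X) (C_ring R Y)"
      unfolding isomorphic_rings_def by blast
    interpret function_ring_iso mem R rep X J p Y \<phi>
      by unfold_locales (use Y in auto)
    show "strongly_zero_dimensional R X"
      by (rule cont_ucont_strongly_zero_dimensional[OF coordinates_zero_dimensional cont_imp_ucont])
  }
qed

end

section \<open>A type for the real numbers of one model\<close>

text \<open>The interpretation of the real numbers of the model as a type of class \<^class>\<open>linordered_field\<close>
  meets the obstacle that types do not depend on the model. The model is therefore fixed first: if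
  the equivalence fails in some model on the type \<^typ>\<open>'v\<close>, then one such model is
  chosen, and its ordered field becomes a type that depends on \<^typ>\<open>'v\<close> alone. For this type the equivalence
  has been proved, which is a contradiction. If there is no such model, the rational numbers fill the place.\<close>

definition ordered_field_structure :: "'a ring \<Rightarrow> ('a \<Rightarrow> 'a \<Rightarrow> bool) \<Rightarrow> bool" where
  "ordered_field_structure F lq \<longleftrightarrow> field F \<and>
     (\<forall>a\<in>carrier F. lq a a) \<and>
     (\<forall>a\<in>carrier F. \<forall>b\<in>carrier F. (lq a b \<or> lq b a) \<and> (lq a b \<and> lq b a \<longrightarrow> a = b)) \<and>
     (\<forall>a\<in>carrier F. \<forall>b\<in>carrier F. \<forall>c\<in>carrier F. lq a b \<and> lq b c \<longrightarrow> lq a c) \<and>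
     (\<forall>a\<in>carrier F. \<forall>b\<in>carrier F. \<forall>c\<in>carrier F. lq a b \<longrightarrow> lq (a \<oplus>\<^bsub>F\<^esub> c) (b \<oplus>\<^bsub>F\<^esub> c)) \<and>
     (\<forall>a\<in>carrier F. \<forall>b\<in>carrier F. lq \<zero>\<^bsub>F\<^esub> a \<and> lq \<zero>\<^bsub>F\<^esub> b \<longrightarrow> lq \<zero>\<^bsub>F\<^esub> (a \<otimes>\<^bsub>F\<^esub> b))"

lemma image_ring_hom:
  assumes "field F" "inj_on f (carrier F)" "a \<in> carrier F" "b \<in> carrier F"
  shows "f a \<oplus>\<^bsub>image_ring f F\<^esub> f b = f (a \<oplus>\<^bsub>F\<^esub> b)" "f a \<otimes>\<^bsub>image_ring f F\<^esub> f b = f (a \<otimes>\<^bsub>F\<^esub> b)"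
proof -
  interpret field F by fact
  have "f \<in> ring_iso F (image_ring f F)" by (rule inj_imp_image_ring_iso[OF assms(2)])
  then have "f \<in> ring_hom F (image_ring f F)" by (simp add: ring_iso_def)
  then show "f a \<oplus>\<^bsub>image_ring f F\<^esub> f b = f (a \<oplus>\<^bsub>F\<^esub> b)" "f a \<otimes>\<^bsub>image_ring f F\<^esub> f b = f (a \<otimes>\<^bsub>F\<^esub> b)"
    using assms(3,4) by (simp_all add: ring_hom_def)
qed

lemma ordered_field_structure_image:
  assumes F: "ordered_field_structure F lq" and f: "inj_on f (carrier F)"
    and order: "\<And>a b. a \<in> carrier F \<Longrightarrow> b \<in> carrier F \<Longrightarrow> lq' (f a) (f b) \<longleftrightarrow> lq a b"
  shows "ordered_field_structure (image_ring f F) lq'"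
proof -
  interpret field F using F unfolding ordered_field_structure_def by blast
  have fld: "field F" by unfold_locales
  have img: "field (image_ring f F)" by (rule inj_imp_image_ring_is_field[OF f])
  note ord = F[unfolded ordered_field_structure_def]
  have ball: "(\<forall>x\<in>f ` A. P x) \<longleftrightarrow> (\<forall>x\<in>A. P (f x))" for A P by blast
  show ?thesis
    unfolding ordered_field_structure_def image_ring_carrier image_ring_zero ball
  proof (intro conjI ballI)
    show "lq' (f a) (f a)" if a: "a \<in> carrier F" for a
      using ord a by (simp add: order)
    fix a b assume a: "a \<in> carrier F" and b: "b \<in> carrier F"
    have "lq a b \<or> lq b a" using ord a b by blast
    then show "lq' (f a) (f b) \<or> lq' (f b) (f a)" using a b by (simp add: order)
    have "lq a b \<Longrightarrow> lq b a \<Longrightarrow> a = b" using ord a b by blast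
    then show "lq' (f a) (f b) \<and> lq' (f b) (f a) \<longrightarrow> f a = f b" using a b by (auto simp: order)
    have "lq \<zero>\<^bsub>F\<^esub> a \<Longrightarrow> lq \<zero>\<^bsub>F\<^esub> b \<Longrightarrow> lq \<zero>\<^bsub>F\<^esub> (a \<otimes>\<^bsub>F\<^esub> b)" using ord a b by blast
    then show "lq' (f \<zero>\<^bsub>F\<^esub>) (f a) \<and> lq' (f \<zero>\<^bsub>F\<^esub>) (f b) \<longrightarrow> lq' (f \<zero>\<^bsub>F\<^esub>) (f a \<otimes>\<^bsub>image_ring f F\<^esub> f b)"
      using a b by (simp add: image_ring_hom[OF fld f] order)
    fix c assume c: "c \<in> carrier F"
    have "lq a b \<Longrightarrow> lq b c \<Longrightarrow> lq a c" using ord a b c by blast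
    then show "lq' (f a) (f b) \<and> lq' (f b) (f c) \<longrightarrow> lq' (f a) (f c)" using a b c by (auto simp: order)
    have "lq a b \<Longrightarrow> lq (a \<oplus>\<^bsub>F\<^esub> c) (b \<oplus>\<^bsub>F\<^esub> c)" using ord a b c by blast
    then show "lq' (f a) (f b) \<longrightarrow> lq' (f a \<oplus>\<^bsub>image_ring f F\<^esub> f c) (f b \<oplus>\<^bsub>image_ring f F\<^esub> f c)"
      using a b c by (simp add: image_ring_hom[OF fld f] order)
  qed (rule img)
qed

definition rat_ring :: "rat ring" where
  "rat_ring = \<lparr>carrier = UNIV, mult = (*), one = 1, zero = 0, add = (+)\<rparr>"

lemma rat_ordered_field: "ordered_field_structure rat_ring (\<le>)"
proof -
  have "\<exists>y. x + y = 0" for x :: rat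
    by (rule exI[of _ "- x"]) simp
  then have "cring rat_ring"
    unfolding rat_ring_def
    by (intro cringI) (auto intro!: abelian_groupI comm_monoidI simp: algebra_simps)
  then interpret cring rat_ring .
  have "field rat_ring"
  proof (rule cring_fieldI2)
    show "\<zero>\<^bsub>rat_ring\<^esub> \<noteq> \<one>\<^bsub>rat_ring\<^esub>" by (simp add: rat_ring_def)
    show "\<exists>b\<in>carrier rat_ring. a \<otimes>\<^bsub>rat_ring\<^esub> b = \<one>\<^bsub>rat_ring\<^esub>" if "a \<noteq> \<zero>\<^bsub>rat_ring\<^esub>" for a
      using that by (intro bexI[of _ "inverse a"]) (simp_all add: rat_ring_def)
  qed
  then show ?thesis by (auto simp: ordered_field_structure_def rat_ring_def)
qed

definition counterexample :: "('v \<Rightarrow> 'v \<Rightarrow> bool) \<times> 'v real_structure \<Rightarrow> bool" where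
  "counterexample = (\<lambda>(mem, R). ZF_universe mem \<and> universe.complete_ordered_field mem R \<and>
     (\<exists>X. universe.topological_space mem X \<and> universe.N_compact mem X \<and> universe.CMC mem \<and>
        \<not> (universe.strongly_zero_dimensional mem R X \<longleftrightarrow>
           (\<exists>Y. universe.topological_space mem Y \<and> universe.Tychonoff mem R Y \<and>
              universe.isomorphic_rings mem (universe.U_aleph0 mem R X) (universe.C_ring mem R Y)))))"

definition chosen :: "('v \<Rightarrow> 'v \<Rightarrow> bool) \<times> 'v real_structure" where
  "chosen = (SOME s. counterexample s)"

text \<open>The sum type provides room for the rational numbers, whatever the size of \<^typ>\<open>'v\<close> is.\<close>

definition chosen_field :: "('v + rat) ring" where
  "chosen_field = (if \<exists>s :: ('v \<Rightarrow> 'v \<Rightarrow> bool) \<times> 'v real_structure. counterexample s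
     then image_ring Inl (universe.real_ring (fst chosen) (snd chosen)) else image_ring Inr rat_ring)"

definition chosen_le :: "'v + rat \<Rightarrow> 'v + rat \<Rightarrow> bool" where
  "chosen_le a b = (if \<exists>s :: ('v \<Rightarrow> 'v \<Rightarrow> bool) \<times> 'v real_structure. counterexample s
     then universe.leq (fst chosen) (snd chosen) (projl a) (projl b) else projr a \<le> projr b)"

lemma chosen_counterexample:
  fixes s :: "('v \<Rightarrow> 'v \<Rightarrow> bool) \<times> 'v real_structure"
  shows "counterexample s \<Longrightarrow> counterexample (chosen :: ('v \<Rightarrow> 'v \<Rightarrow> bool) \<times> 'v real_structure)"
  unfolding chosen_def by (rule someI[of counterexample])

lemma real_ordered_field:
  assumes "universe.complete_ordered_field mem R"
  shows "ordered_field_structure (universe.real_ring mem R) (universe.leq mem R)"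
proof -
  have eqs: "carrier (universe.real_ring mem R) = universe.elts mem (rcarrier R)"
    "\<zero>\<^bsub>universe.real_ring mem R\<^esub> = rzero R"
    by (simp_all add: universe.real_ring_def)
  show ?thesis
    unfolding ordered_field_structure_def eqs
    by (insert assms[unfolded universe.complete_ordered_field_def], elim conjE, intro conjI; assumption)
qed

lemma chosen_ordered_field: "ordered_field_structure (chosen_field :: ('v + rat) ring) chosen_le"
proof (cases "\<exists>s :: ('v \<Rightarrow> 'v \<Rightarrow> bool) \<times> 'v real_structure. counterexample s")
  case True
  then have "counterexample (chosen :: ('v \<Rightarrow> 'v \<Rightarrow> bool) \<times> 'v real_structure)"
    using chosen_counterexample by blast
  then have "universe.complete_ordered_field (fst chosen) (snd (chosen :: ('v \<Rightarrow> 'v \<Rightarrow> bool) \<times> 'v real_structure))"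
    unfolding counterexample_def by (simp add: case_prod_beta)
  show ?thesis
    unfolding chosen_field_def if_P[OF True]
    by (rule ordered_field_structure_image[OF real_ordered_field[OF \<open>universe.complete_ordered_field _ _\<close>]])
      (simp_all only: chosen_le_def if_P[OF True] sum.sel inj_Inl)
next
  case False
  show ?thesis
    unfolding chosen_field_def if_not_P[OF False]
    by (rule ordered_field_structure_image[OF rat_ordered_field]) (simp_all only: chosen_le_def if_not_P[OF False] sum.sel inj_Inr)
qed

lemma chosen_field: "field chosen_field"
  using chosen_ordered_field unfolding ordered_field_structure_def by blast

typedef 'v chosen_real = "carrier (chosen_field :: ('v + rat) ring)"
proof
  interpret field "chosen_field :: ('v + rat) ring" by (rule chosen_field)
  show "\<zero>\<^bsub>chosen_field\<^esub> \<in> carrier (chosen_field :: ('v + rat) ring)" by simp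
qed

instantiation chosen_real :: (type) linordered_field
begin

definition "0 = Abs_chosen_real \<zero>\<^bsub>chosen_field\<^esub>"
definition "1 = Abs_chosen_real \<one>\<^bsub>chosen_field\<^esub>"
definition "a + b = Abs_chosen_real (Rep_chosen_real a \<oplus>\<^bsub>chosen_field\<^esub> Rep_chosen_real b)"
definition "a * b = Abs_chosen_real (Rep_chosen_real a \<otimes>\<^bsub>chosen_field\<^esub> Rep_chosen_real b)"
definition "- a = Abs_chosen_real (\<ominus>\<^bsub>chosen_field\<^esub> Rep_chosen_real a)"
definition "a - b = a + - (b :: 'a chosen_real)"
definition "inverse a = (if a = 0 then 0 else Abs_chosen_real (inv\<^bsub>chosen_field\<^esub> Rep_chosen_real a))"
definition "a div b = a * inverse (b :: 'a chosen_real)"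
definition "a \<le> b \<longleftrightarrow> chosen_le (Rep_chosen_real a) (Rep_chosen_real b)"
definition "a < b \<longleftrightarrow> a \<le> b \<and> a \<noteq> (b :: 'a chosen_real)"
definition "\<bar>a\<bar> = (if a < 0 then - a else (a :: 'a chosen_real))"
definition "sgn a = (if a = 0 then 0 else if 0 < a then 1 else - 1 :: 'a chosen_real)"

lemma Rep_ops:
  fixes a b :: "'a chosen_real"
  shows "Rep_chosen_real (0 :: 'a chosen_real) = \<zero>\<^bsub>chosen_field\<^esub>"
    "Rep_chosen_real (1 :: 'a chosen_real) = \<one>\<^bsub>chosen_field\<^esub>"
    "Rep_chosen_real (a + b) = Rep_chosen_real a \<oplus>\<^bsub>chosen_field\<^esub> Rep_chosen_real b"
    "Rep_chosen_real (a * b) = Rep_chosen_real a \<otimes>\<^bsub>chosen_field\<^esub> Rep_chosen_real b"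
    "Rep_chosen_real (- a) = \<ominus>\<^bsub>chosen_field\<^esub> Rep_chosen_real a"
    "a \<noteq> 0 \<Longrightarrow> Rep_chosen_real (inverse a) = inv\<^bsub>chosen_field\<^esub> Rep_chosen_real a"
proof -
  interpret F: field "chosen_field :: ('a + rat) ring" by (rule chosen_field)
  note [simp] = Abs_chosen_real_inverse Rep_chosen_real Rep_chosen_real_inject
  show 0: "Rep_chosen_real (0 :: 'a chosen_real) = \<zero>\<^bsub>chosen_field\<^esub>"
    by (simp add: zero_chosen_real_def)
  show "Rep_chosen_real (1 :: 'a chosen_real) = \<one>\<^bsub>chosen_field\<^esub>"
    "Rep_chosen_real (a + b) = Rep_chosen_real a \<oplus>\<^bsub>chosen_field\<^esub> Rep_chosen_real b"
    "Rep_chosen_real (a * b) = Rep_chosen_real a \<otimes>\<^bsub>chosen_field\<^esub> Rep_chosen_real b"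
    "Rep_chosen_real (- a) = \<ominus>\<^bsub>chosen_field\<^esub> Rep_chosen_real a"
    by (simp_all add: one_chosen_real_def plus_chosen_real_def times_chosen_real_def uminus_chosen_real_def)
  assume "a \<noteq> 0"
  then have "Rep_chosen_real a \<noteq> \<zero>\<^bsub>chosen_field\<^esub>" using 0 Rep_chosen_real_inject by metis
  then have "inv\<^bsub>chosen_field\<^esub> Rep_chosen_real a \<in> carrier chosen_field"
    using F.field_Units Rep_chosen_real[of a] by (intro F.Units_inv_closed) blast
  then show "Rep_chosen_real (inverse a) = inv\<^bsub>chosen_field\<^esub> Rep_chosen_real a"
    using \<open>a \<noteq> 0\<close> by (simp add: inverse_chosen_real_def)
qed

instance
proof
  interpret F: field "chosen_field :: ('a + rat) ring" by (rule chosen_field)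
  note [simp] = Rep_ops Rep_chosen_real
  note eq = Rep_chosen_real_inject[symmetric]
  note ord = chosen_ordered_field[where ?'v = 'a, unfolded ordered_field_structure_def]
  fix a b c :: "'a chosen_real"
  show "a + b + c = a + (b + c)" "a + b = b + a" "0 + a = a" "- a + a = 0"
    unfolding eq by (simp_all add: F.a_ac F.r_neg)
  show "a * b * c = a * (b * c)" "a * b = b * a" "1 * a = a" "(a + b) * c = a * c + b * c"
    unfolding eq by (simp_all add: F.m_ac F.r_distr F.l_distr)
  show "(0 :: 'a chosen_real) \<noteq> 1" unfolding eq by simp
  show "a - b = a + - b" by (simp add: minus_chosen_real_def)
  show "a + b - a = b"
    unfolding minus_chosen_real_def eq Rep_ops
    using F.r_neg2[of "Rep_chosen_real a" "Rep_chosen_real b"] by (simp add: F.a_ac)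
  show "a - b - c = a - (b + c)"
    unfolding minus_chosen_real_def eq by (simp add: F.minus_add F.a_assoc)
  show "0 * a = 0" "a * 0 = 0" unfolding eq by simp_all
  show "inverse a * a = 1" if "a \<noteq> 0"
  proof -
    have "Rep_chosen_real a \<noteq> \<zero>\<^bsub>chosen_field\<^esub>" using that Rep_ops(1) Rep_chosen_real_inject by metis
    then have "Rep_chosen_real a \<in> Units chosen_field" using F.field_Units Rep_chosen_real[of a] by blast
    then show ?thesis unfolding eq using that by simp
  qed
  show "a div b = a * inverse b" by (simp add: divide_chosen_real_def)
  show "inverse (0 :: 'a chosen_real) = 0" by (simp add: inverse_chosen_real_def)
  show refl: "a \<le> a" for a :: "'a chosen_real" using ord by (simp add: less_eq_chosen_real_def)
  show antisym: "a = b" if "a \<le> b" "b \<le> a" for a b :: "'a chosen_real"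
    using ord that unfolding less_eq_chosen_real_def eq by (metis Rep_chosen_real)
  show "(a < b) = (a \<le> b \<and> \<not> b \<le> a)"
    using antisym refl unfolding less_chosen_real_def by blast
  show trans: "a \<le> c" if "a \<le> b" "b \<le> c" for a b c :: "'a chosen_real"
    using ord that unfolding less_eq_chosen_real_def by (metis Rep_chosen_real)
  show "a \<le> b \<or> b \<le> a"
    using ord unfolding less_eq_chosen_real_def by (metis Rep_chosen_real)
  have add_mono: "a + c \<le> b + c" if "a \<le> b" for a b c :: "'a chosen_real"
    using ord that unfolding less_eq_chosen_real_def Rep_ops by (metis Rep_chosen_real)
  have comm: "x + y = y + x" for x y :: "'a chosen_real"
    unfolding eq by (simp add: F.a_comm)
  show "c + a \<le> c + b" if "a \<le> b"
    using add_mono[OF that, of c] comm[of c] by simp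
  have mult_nonneg: "0 \<le> a * b" if "0 \<le> a" "0 \<le> b" for a b :: "'a chosen_real"
    using ord that unfolding less_eq_chosen_real_def Rep_ops by (metis Rep_chosen_real)
  show "c * a < c * b" if ab: "a < b" and c: "0 < c"
  proof -
    have "a + - a \<le> b + - a" using ab by (intro add_mono) (simp add: less_chosen_real_def)
    moreover have "a + - a = 0" unfolding eq by (simp add: F.r_neg)
    ultimately have "0 \<le> c * (b + - a)" using c by (intro mult_nonneg) (simp_all add: less_chosen_real_def)
    from add_mono[OF this, of "c * a"] have "0 + c * a \<le> c * (b + - a) + c * a" .
    moreover have "0 + c * a = c * a" unfolding eq by simp
    moreover have "c * (b + - a) + c * a = c * b"
    proof -
      have "c * (b + - a) + c * a = c * (b + (- a + a))"
        unfolding eq by (simp add: F.r_distr F.a_assoc)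
      moreover have "b + (- a + a) = b" unfolding eq by (simp add: F.l_neg)
      ultimately show ?thesis by simp
    qed
    ultimately have "c * a \<le> c * b" by simp
    moreover have "c * a \<noteq> c * b"
      using ab c F.m_lcancel[of "Rep_chosen_real c" "Rep_chosen_real a" "Rep_chosen_real b"]
      unfolding less_chosen_real_def eq by auto
    ultimately show ?thesis by (simp add: less_chosen_real_def)
  qed
  show "\<bar>a\<bar> = (if a < 0 then - a else a)" by (rule abs_chosen_real_def)
  show "sgn a = (if a = 0 then 0 else if 0 < a then 1 else - 1)" by (rule sgn_chosen_real_def)
qed

end

lemma no_counterexample: "\<not> counterexample (s :: ('v \<Rightarrow> 'v \<Rightarrow> bool) \<times> 'v real_structure)"
proof
  assume s: "counterexample s"
  obtain mem :: "'v \<Rightarrow> 'v \<Rightarrow> bool" and R where chosen: "chosen = (mem, R)" by fastforce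
  from chosen_counterexample[OF s] have "counterexample (mem, R)" unfolding chosen .
  then obtain X where ZF: "ZF_universe mem" and R: "universe.complete_ordered_field mem R"
    and X: "universe.topological_space mem X" "universe.N_compact mem X" "universe.CMC mem"
    and neg: "\<not> (universe.strongly_zero_dimensional mem R X \<longleftrightarrow>
           (\<exists>Y. universe.topological_space mem Y \<and> universe.Tychonoff mem R Y \<and>
              universe.isomorphic_rings mem (universe.U_aleph0 mem R X) (universe.C_ring mem R Y)))"
    unfolding counterexample_def by blast
  interpret ZF_universe mem by (rule ZF)
  have fld: "field (real_ring R)" using R unfolding complete_ordered_field_def by blast
  have inj: "inj_on Inl (carrier (real_ring R))" by simp
  have ex: "\<exists>s :: ('v \<Rightarrow> 'v \<Rightarrow> bool) \<times> 'v real_structure. counterexample s" using s by blast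
  have field_eq: "chosen_field = (image_ring Inl (real_ring R) :: ('v + rat) ring)"
    unfolding chosen_field_def if_P[OF ex] chosen by simp
  define rep :: "'v chosen_real \<Rightarrow> 'v" where "rep a = projl (Rep_chosen_real a)" for a
  have car: "carrier (real_ring R) = elts (rcarrier R)" by (simp add: real_ring_def)
  have Rep: "Rep_chosen_real a = Inl (rep a)" "rep a \<in> carrier (real_ring R)" for a :: "'v chosen_real"
    using Rep_chosen_real[of a] unfolding field_eq image_ring_carrier rep_def by auto
  have "real_space mem R rep X"
  proof unfold_locales
    show "complete_ordered_field R" by (rule R)
    show "topological_space X" by (rule X(1))
    show "bij_betw rep UNIV (elts (rcarrier R))"
      unfolding bij_betw_def car[symmetric]
    proof
      show "inj rep" by (rule injI) (metis Rep(1) Rep_chosen_real_inject)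
      have "\<exists>a :: 'v chosen_real. v = rep a" if "v \<in> carrier (real_ring R)" for v
      proof -
        have "Inl v \<in> carrier (chosen_field :: ('v + rat) ring)" using that by (simp add: field_eq image_ring_carrier)
        then have "rep (Abs_chosen_real (Inl v)) = v" by (simp add: rep_def Abs_chosen_real_inverse)
        then show ?thesis by metis
      qed
      then show "range rep = carrier (real_ring R)" using Rep(2) by blast
    qed
    fix a b :: "'v chosen_real"
    have "Inl (rep (a + b)) = (Inl (rep a \<oplus>\<^bsub>real_ring R\<^esub> rep b) :: 'v + rat)"
      using image_ring_hom(1)[OF fld inj Rep(2) Rep(2), of a b] Rep_ops(3)[of a b] unfolding field_eq Rep(1) by simp
    then show "rep (a + b) = app (rplus R) (opair (rep a) (rep b))" by (simp add: real_ring_def)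
    have "Inl (rep (a * b)) = (Inl (rep a \<otimes>\<^bsub>real_ring R\<^esub> rep b) :: 'v + rat)"
      using image_ring_hom(2)[OF fld inj Rep(2) Rep(2), of a b] Rep_ops(4)[of a b] unfolding field_eq Rep(1) by simp
    then show "rep (a * b) = app (rtimes R) (opair (rep a) (rep b))" by (simp add: real_ring_def)
    show "rep 0 = rzero R" "rep 1 = rone R"
      unfolding rep_def Rep_ops field_eq image_ring_zero image_ring_one by (simp_all add: real_ring_def)
    show "leq R (rep a) (rep b) \<longleftrightarrow> a \<le> b"
      unfolding less_eq_chosen_real_def chosen_le_def rep_def if_P[OF ex] chosen by simp
  qed
  then show False using real_space.strongly_zero_dimensional_iff[of mem R rep X] X neg by blast
qed

theorem theorem9p1:
  fixes mem :: "'v \<Rightarrow> 'v \<Rightarrow> bool"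
    and R :: "'v real_structure"
    and X :: "'v tspace"
  assumes "ZF_universe mem"
    and "universe.complete_ordered_field mem R"
    and "universe.topological_space mem X"
    and "universe.elts mem (points X) \<noteq> {}"
    and "universe.N_compact mem X"
    and "\<exists>B b. universe.Banaschewski_compactification mem X B b"
  shows "universe.CMC mem \<longrightarrow>
    (universe.strongly_zero_dimensional mem R X \<longleftrightarrow>
      (\<exists>Y. universe.topological_space mem Y \<and> universe.Tychonoff mem R Y \<and>
         universe.isomorphic_rings mem (universe.U_aleph0 mem R X) (universe.C_ring mem R Y)))"
  using no_counterexample[of "(mem, R)"] assms unfolding counterexample_def by blast

end
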